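(* Let $(X,d,m)$ be a space of homogeneous type with $d$ a metric, and let $F\subset X$ be closed with $m(F)=0$. Let $\mu$ be a nontrivial Borel measure with support $F$ which is doubling for balls centered in $F$, and assume that there exists $\gamma>0$ such that $$\frac{m(B)}{\mu(B)}\sim r^{\gamma}$$ for all balls $B$ centered in $F$ with radius $r<2\,\mathrm{diam}(F)$ (with comparability constants independent of $B$). Then there is a linear extension operator $\mathcal{E}$, defined for all $f\in L^1_{loc}(F,\mu)$, with values in measurable functions on $X$, i.e. for every $f\in L^1_{loc}(F,\mu)$ the limit $$\lim_{r\to 0}\frac{1}{m(B(t,r))}\int_{B(t,r)}\mathcal{E}f(x)\,dm(x)$$ exists and equals $f(t)$ for $\mu$-almost every $t\in F$, such that for all $1\leq p<\infty$, $1\leq q\leq\infty$ and $0<\beta<1-\gamma/p$, the operator $$\mathcal{E}:B^\beta_{p,q}(F,\mu)\to B^\alpha_{p,q}(X,m),\qquad \alpha=\beta+\gamma/p,$$ is bounded.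
   Context: A space of homogeneous type with $d$ a metric is a metric space $(X,d)$ with a measure $m$ for which balls and open sets are measurable, $0<m(B)<\infty$ for balls $B$, and $m(B(x,2r))\leq Cm(B(x,r))$ for all $x\in X$, $r>0$ with $C$ independent of $x,r$. "$\mu$ is doubling for balls centered in $F$" means $0<\mu(B(x,2r))\leq C\mu(B(x,r))<\infty$ for all $x\in F$, $r>0$. $A\sim B$ means $C^{-1}A\le B\le CA$ with $C\ge1$ independent of the variables involved. Besov spaces: for a metric measure space $(Y,d,\nu)$, $1\leq p<\infty$, $f\in L^1_{loc}(Y,\nu)$ and $t>0$, let $$E_pf(t)=\left(\int_Y \frac{1}{\nu(B(x,t))}\int_{B(x,t)}|f(y)-f(x)|^p\,d\nu(y)\,d\nu(x)\right)^{1/p}.$$ For $\alpha>0$ and $1\leq q<\infty$, $B^\alpha_{p,q}(Y,\nu)$ is the space of $f$ with $$\|f\|_{B^\alpha_{p,q}}=\|f\|_{L^p(\nu)}+\left(\int_0^\infty (t^{-\alpha}E_pf(t))^q\frac{dt}{t}\right)^{1/q}<\infty,$$ and for $q=\infty$ the second term is replaced by $\sup_{t>0}t^{-\alpha}E_pf(t)$. For $(F,\mu)$ one uses the metric $d$ restricted to $F$ and the measure $\mu$. *)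

theory Defs
  imports "HOL-Analysis.Analysis"
begin

text \<open>The ambient space is a type of class \<^class>\<open>metric_space\<close>. The \<open>\<sigma>\<close>-algebra of \<open>m\<close> contains
  the open sets but may be larger than the Borel one. Functions are real-valued.\<close>

definition homogeneous_type :: "'a::metric_space measure \<Rightarrow> bool" where
  "homogeneous_type m \<longleftrightarrow>
     (\<forall>U. open U \<longrightarrow> U \<in> sets m) \<and>
     (\<forall>x. \<forall>r>0. 0 < emeasure m (ball x r) \<and> emeasure m (ball x r) < \<infinity>) \<and>
     (\<exists>C::real. \<forall>x. \<forall>r>0. emeasure m (ball x (2 * r)) \<le> ennreal C * emeasure m (ball x r))"

definition doubling_centered :: "'a::metric_space set \<Rightarrow> 'a measure \<Rightarrow> bool" where
  "doubling_centered F \<mu> \<longleftrightarrow>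
     (\<exists>C::real. \<forall>x\<in>F. \<forall>r>0.
        0 < emeasure \<mu> (ball x (2 * r)) \<and>
        emeasure \<mu> (ball x (2 * r)) \<le> ennreal C * emeasure \<mu> (ball x r) \<and>
        ennreal C * emeasure \<mu> (ball x r) < \<infinity>)"

definition measure_support :: "'a::metric_space measure \<Rightarrow> 'a set" where
  "measure_support \<mu> = {x. \<forall>U. open U \<and> x \<in> U \<longrightarrow> 0 < emeasure \<mu> U}"

text \<open>\<open>m(B)/\<mu>(B) \<sim> r\<^sup>\<gamma>\<close> for balls centered in \<open>F\<close> with radius \<open>r < 2 diam F\<close>. The
  library's \<^const>\<open>diameter\<close> is only meaningful for bounded sets; for unbounded \<open>F\<close> every
  radius is allowed.\<close>

definition codim_comparable ::
    "'a::metric_space measure \<Rightarrow> 'a measure \<Rightarrow> 'a set \<Rightarrow> real \<Rightarrow> bool" where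
  "codim_comparable m \<mu> F \<gamma> \<longleftrightarrow>
     (\<exists>C::real. C \<ge> 1 \<and>
       (\<forall>x\<in>F. \<forall>r>0. (bounded F \<longrightarrow> r < 2 * diameter F) \<longrightarrow>
          inverse C * r powr \<gamma> \<le> measure m (ball x r) / measure \<mu> (ball x r) \<and>
          measure m (ball x r) / measure \<mu> (ball x r) \<le> C * r powr \<gamma>))"

text \<open>The function spaces below are parametrised by a subset \<open>Y\<close> of the ambient type, which
  carries the restricted metric (so its balls are \<open>ball x r \<inter> Y\<close>) and the restriction of \<open>\<nu>\<close>.
  Values of functions outside \<open>Y\<close> are irrelevant.

  Local integrability means integrability over every ball, as is usual on spaces of
  homogeneous type (balls need not be relatively compact). For nonempty \<open>Y\<close> it includes
  measurability on \<open>Y\<close>.\<close>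

definition L1_loc :: "'a::metric_space set \<Rightarrow> 'a measure \<Rightarrow> ('a \<Rightarrow> real) set" where
  "L1_loc Y \<nu> = {f. \<forall>x\<in>Y. \<forall>r>0. set_integrable \<nu> (ball x r \<inter> Y) f}"

text \<open>Real powers with positive exponent on \<open>[0,\<infinity>]\<close>.\<close>

definition ennreal_rpow :: "ennreal \<Rightarrow> real \<Rightarrow> ennreal" where
  "ennreal_rpow x a = (if x = \<infinity> then \<infinity> else ennreal (enn2real x powr a))"

definition Lp_enorm :: "'a set \<Rightarrow> 'a measure \<Rightarrow> real \<Rightarrow> ('a \<Rightarrow> real) \<Rightarrow> ennreal" where
  "Lp_enorm Y \<nu> p f = ennreal_rpow (\<integral>\<^sup>+x\<in>Y. ennreal (\<bar>f x\<bar> powr p) \<partial>\<nu>) (1 / p)"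

definition Lp_modulus ::
    "'a::metric_space set \<Rightarrow> 'a measure \<Rightarrow> real \<Rightarrow> ('a \<Rightarrow> real) \<Rightarrow> real \<Rightarrow> ennreal" where
  "Lp_modulus Y \<nu> p f t =
     ennreal_rpow
       (\<integral>\<^sup>+x\<in>Y. (\<integral>\<^sup>+y\<in>ball x t \<inter> Y. ennreal (\<bar>f y - f x\<bar> powr p) \<partial>\<nu>) / emeasure \<nu> (ball x t \<inter> Y) \<partial>\<nu>)
       (1 / p)"

definition besov_seminorm ::
    "'a::metric_space set \<Rightarrow> 'a measure \<Rightarrow> real \<Rightarrow> real \<Rightarrow> ennreal \<Rightarrow> ('a \<Rightarrow> real) \<Rightarrow> ennreal" where
  "besov_seminorm Y \<nu> \<alpha> p q f =
     (if q = \<infinity> then SUP t\<in>{0<..}. ennreal (t powr (-\<alpha>)) * Lp_modulus Y \<nu> p f t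
      else ennreal_rpow
        (\<integral>\<^sup>+t\<in>{0<..}. ennreal_rpow (ennreal (t powr (-\<alpha>)) * Lp_modulus Y \<nu> p f t) (enn2real q)
                         * ennreal (1 / t) \<partial>lborel)
        (1 / enn2real q))"

definition besov_norm ::
    "'a::metric_space set \<Rightarrow> 'a measure \<Rightarrow> real \<Rightarrow> real \<Rightarrow> ennreal \<Rightarrow> ('a \<Rightarrow> real) \<Rightarrow> ennreal" where
  "besov_norm Y \<nu> \<alpha> p q f = Lp_enorm Y \<nu> p f + besov_seminorm Y \<nu> \<alpha> p q f"

definition besov_space ::
    "'a::metric_space set \<Rightarrow> 'a measure \<Rightarrow> real \<Rightarrow> real \<Rightarrow> ennreal \<Rightarrow> ('a \<Rightarrow> real) set" where
  "besov_space Y \<nu> \<alpha> p q = {f \<in> L1_loc Y \<nu>. besov_norm Y \<nu> \<alpha> p q f < \<infinity>}"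

text \<open>The averages of \<open>u\<close> over small balls at \<open>t\<close> are well defined and converge to \<open>v\<close>. The
  integrability requirement is needed because the library assigns the integral 0 to
  non-integrable functions.\<close>

definition has_ball_average_limit ::
    "'a::metric_space measure \<Rightarrow> ('a \<Rightarrow> real) \<Rightarrow> 'a \<Rightarrow> real \<Rightarrow> bool" where
  "has_ball_average_limit m u t v \<longleftrightarrow>
     (\<forall>\<^sub>F r in at_right 0. set_integrable m (ball t r) u) \<and>
     ((\<lambda>r. 1 / measure m (ball t r) * (LINT x:ball t r|m. u x)) \<longlongrightarrow> v) (at_right 0)"

text \<open>A linear operator from \<open>L1_loc F \<mu>\<close> to the \<open>m\<close>-measurable functions. It acts on
  representatives and respects almost everywhere equality; in particular it only depends on the
  values on \<open>F\<close>.\<close>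

definition linear_operator_L1_loc ::
    "'a::metric_space set \<Rightarrow> 'a measure \<Rightarrow> 'a measure \<Rightarrow> (('a \<Rightarrow> real) \<Rightarrow> ('a \<Rightarrow> real)) \<Rightarrow> bool" where
  "linear_operator_L1_loc F \<mu> m E \<longleftrightarrow>
     (\<forall>f\<in>L1_loc F \<mu>. E f \<in> borel_measurable m) \<and>
     (\<forall>f\<in>L1_loc F \<mu>. \<forall>g\<in>L1_loc F \<mu>.
        (AE x in \<mu>. x \<in> F \<longrightarrow> f x = g x) \<longrightarrow> (AE x in m. E f x = E g x)) \<and>
     (\<forall>f\<in>L1_loc F \<mu>. \<forall>g\<in>L1_loc F \<mu>. \<forall>a b.
        E (\<lambda>x. a * f x + b * g x) = (\<lambda>x. a * E f x + b * E g x))"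

definition extension_operator_L1_loc ::
    "'a::metric_space set \<Rightarrow> 'a measure \<Rightarrow> 'a measure \<Rightarrow> (('a \<Rightarrow> real) \<Rightarrow> ('a \<Rightarrow> real)) \<Rightarrow> bool" where
  "extension_operator_L1_loc F \<mu> m E \<longleftrightarrow>
     (\<forall>f\<in>L1_loc F \<mu>. AE t in \<mu>. t \<in> F \<longrightarrow> has_ball_average_limit m (E f) t (f t))"

end

theory Submission
  imports Defs
begin

text \<open>
  For \<open>x \<notin> F\<close> let \<open>E f(x)\<close> be a Lipschitz average of \<open>f\<close> over the points of \<open>F\<close> within distance
  comparable to \<open>d(x, F)\<close>, multiplied by a Lipschitz cutoff supported near \<open>F\<close>. The explicit kernel
  \<open>max 0 (min 1 (3 - d(x, z) / d(x, F)))\<close> replaces a Whitney decomposition with a partition of unity: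
  it makes \<open>E f\<close> locally Lipschitz off \<open>F\<close>, with constant \<open>1 / d(x, F)\<close> times the oscillation of \<open>f\<close>
  at that scale.

  By Tonelli everything reduces to the \<open>m\<close>-integral of the kernel over \<open>{0 < d(x, F) < r}\<close>, which is at
  most a multiple of \<open>m(B(z, r)) / \<mu>(B(z, r)) \<sim> r\<^sup>\<gamma>\<close> after summing over dyadic shells. For small \<open>t\<close> the
  points with \<open>d(x, F) < 4 t\<close> contribute \<open>t\<^sup>\<gamma> (E\<^sub>p f(64 t))\<^sup>p\<close> to \<open>(E\<^sub>p (E f)(t))\<^sup>p\<close>, and the shells
  \<open>d(x, F) \<approx> 2\<^sup>j t\<close> contribute \<open>2\<^sup>-\<^sup>j\<^sup>p (2\<^sup>j t)\<^sup>\<gamma> (E\<^sub>p f(64 \<sqdot> 2\<^sup>j t))\<^sup>p\<close>; since \<open>\<beta> + \<gamma> / p < 1\<close>, the sum over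
  \<open>j\<close> converges after weighting by \<open>t\<close> to the power \<open>-(\<beta> + \<gamma> / p)\<close>. The trace is recovered at the Lebesgue
  points of \<open>f\<close>.
\<close>

section \<open>Extended nonnegative powers and Jensen's inequality\<close>

text \<open>The kernel, and with it the operator, is built from \<open>\<mu>\<close>,
  \<open>F\<close> and a length \<open>R\<close> only, so one operator serves all \<open>p\<close>,
  \<open>q\<close> and \<beta>. An average reproduces constants; hence any constant may be
  subtracted from \<open>f\<close>, which turns values into oscillations. Three obstacles shape the
  rest. Tonelli needs \<open>dist\<close> to be measurable for the product of two Borel
  sigma-algebras, which is obtained from separability, itself a consequence of doubling. Balls
  centered off \<open>F\<close> need not be doubling for \<open>\<mu>\<close>, so each is compared
  with balls around a nearby point of \<open>F\<close>. Finally, a one-point \<open>F\<close>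
  carries no information on the relation between the two measures; there oscillations vanish, and
  the trace is controlled through ratios of the measures of balls instead of powers of the radius.
  The scale 64 comes from shells of size \<open>8 * 2 ^ j * t\<close>, which see pairs of points of
  \<open>F\<close> at distance up to 8 times that size.\<close>

lemma ennreal_inverse_le_mult:
  fixes b v :: ennreal and C :: real
  assumes "b \<le> ennreal C * v" "C > 0"
  shows "inverse v \<le> ennreal C * inverse b"
proof (cases "b = 0 \<or> v = \<infinity> \<or> b = \<infinity>")
  case True
  then show ?thesis
    using assms by (auto simp: ennreal_mult_top ennreal_mult_eq_top_iff top_unique)
next
  case False
  then obtain b' v' where b': "b = ennreal b'" "b' > 0" and v': "v = ennreal v'" "v' \<ge> 0"
    by (metis ennreal_cases infinity_ennreal_def le_zero_eq ennreal_neg not_le ennreal_eq_0_iff)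
  have le: "b' \<le> C * v'"
    using assms b' v' by (simp add: ennreal_mult[symmetric])
  then have "v' > 0"
    using b' v' assms(2) by (smt (verit) mult_nonneg_nonpos mult_zero_right)
  then have "inverse v' \<le> C * inverse b'"
    using le b' by (simp add: field_simps)
  then show ?thesis
    using b' v' \<open>v' > 0\<close> assms(2) by (simp add: inverse_ennreal ennreal_mult[symmetric] ennreal_leI)
qed

lemma ennreal_rpow_0 [simp]: "ennreal_rpow 0 a = 0"
  by (simp add: ennreal_rpow_def)

lemma ennreal_rpow_top [simp]: "ennreal_rpow \<infinity> a = \<infinity>" "ennreal_rpow top a = top"
  by (simp_all add: ennreal_rpow_def)

lemma ennreal_rpow_ennreal: "x \<ge> 0 \<Longrightarrow> ennreal_rpow (ennreal x) a = ennreal (x powr a)"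
  by (simp add: ennreal_rpow_def)

lemma ennreal_rpow_eq_top_iff: "ennreal_rpow x a = \<infinity> \<longleftrightarrow> x = \<infinity>"
  by (simp add: ennreal_rpow_def)

lemma ennreal_rpow_mono: "x \<le> y \<Longrightarrow> a \<ge> 0 \<Longrightarrow> ennreal_rpow x a \<le> ennreal_rpow y a"
  by (cases x; cases y) (auto simp: ennreal_rpow_ennreal powr_mono2 ennreal_leI top_unique)

lemma ennreal_rpow_rpow: "ennreal_rpow (ennreal_rpow x a) b = ennreal_rpow x (a * b)"
  by (cases x) (auto simp: ennreal_rpow_ennreal powr_powr)

lemma ennreal_rpow_1 [simp]: "ennreal_rpow x 1 = x"
  by (cases x) (auto simp: ennreal_rpow_ennreal)

lemma ennreal_rpow_mult:
  assumes "a > 0"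
  shows "ennreal_rpow (x * y) a = ennreal_rpow x a * ennreal_rpow y a"
proof (cases x)
  case (real r)
  show ?thesis
  proof (cases y)
    case (real s)
    then show ?thesis using \<open>0 \<le> r\<close> \<open>x = ennreal r\<close>
      by (simp add: ennreal_rpow_ennreal ennreal_mult[symmetric] powr_mult)
  next
    case top
    show ?thesis
    proof (cases "r = 0")
      case False
      then show ?thesis using \<open>0 \<le> r\<close> \<open>x = ennreal r\<close> top
        by (simp add: ennreal_mult_top ennreal_rpow_ennreal)
    qed (use real in simp)
  qed
next
  case top
  show ?thesis
  proof (cases y)
    case (real s)
    show ?thesis
    proof (cases "s = 0")
      case False
      then show ?thesis using real top
        by (simp add: ennreal_top_mult ennreal_rpow_ennreal)
    qed (use real in simp)
  qed (use top in simp)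
qed

text \<open>The crude constant comes from \<open>x + y \<le> 2 * max x y\<close> and serves every
  \<open>a \<ge> 0\<close>. Exponents \<open>q\<close> above 1 and \<open>1 / p\<close>,
  \<open>1 / q\<close> below 1 both occur, so convexity and subadditivity need not be
  distinguished.\<close>

lemma ennreal_rpow_add_le:
  assumes "a \<ge> 0"
  shows "ennreal_rpow (x + y) a \<le> ennreal (2 powr a) * (ennreal_rpow x a + ennreal_rpow y a)"
proof -
  have *: "ennreal_rpow (x + y) a \<le> ennreal (2 powr a) * (ennreal_rpow x a + ennreal_rpow y a)"
    if le: "x \<le> y" for x y
  proof (cases y)
    case (real s)
    then obtain r where r: "x = ennreal r" "r \<ge> 0" "r \<le> s"
      using le by (cases x) (auto simp: top_unique)
    have "(r + s) powr a \<le> (2 * s) powr a"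
      using r assms by (intro powr_mono2) auto
    also have "\<dots> = 2 powr a * s powr a"
      using real by (simp add: powr_mult)
    also have "\<dots> \<le> 2 powr a * (r powr a + s powr a)"
      by (intro mult_left_mono) auto
    finally show ?thesis
      using r real by (simp add: ennreal_rpow_ennreal ennreal_mult[symmetric] ennreal_leI flip: ennreal_plus)
  qed (simp add: ennreal_mult_top)
  show ?thesis
    using *[of x y] *[of y x] by (cases "x \<le> y") (auto simp: add.commute)
qed

lemma borel_measurable_ennreal_rpow [measurable]:
  assumes [measurable]: "f \<in> borel_measurable M"
  shows "(\<lambda>x. ennreal_rpow (f x) a) \<in> borel_measurable M"
  unfolding ennreal_rpow_def by measurable

lemma powr_add_le:
  fixes x y p :: real
  assumes "x \<ge> 0" "y \<ge> 0" "p \<ge> 0"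
  shows "(x + y) powr p \<le> 2 powr p * (x powr p + y powr p)"
proof -
  have "(x + y) powr p \<le> (2 * max x y) powr p"
    using assms by (intro powr_mono2) auto
  also have "\<dots> = 2 powr p * max x y powr p"
    using assms by (simp add: powr_mult)
  also have "\<dots> \<le> 2 powr p * (x powr p + y powr p)"
    by (intro mult_left_mono) (auto simp: max_def)
  finally show ?thesis .
qed

text \<open>Convexity of the power, as the tangent line at \<open>a\<close>, rearranged so that both
  sides are nonnegative and survive the passage to \<open>ennreal\<close>.\<close>

lemma powr_ge_tangent:
  fixes s a p :: real
  assumes "s \<ge> 0" "a > 0" "p \<ge> 1"
  shows "p * a powr (p - 1) * s \<le> s powr p + (p - 1) * a powr p"
\<comment> \<open>The tangent inequality is applied on the open half-line, so the endpoint is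
  treated apart.\<close>
proof (cases "s = 0")
  case False
  have "s powr p - a powr p \<ge> p * a powr (p - 1) * (s - a)"
    using assms False
    by (intro convex_on_imp_above_tangent[of "{0<..}"] powr_convex)
       (auto intro!: derivative_eq_intros simp: interior_open)
  moreover have "a powr (p - 1) * a = a powr p"
    using assms by (simp add: powr_mult_base[of a "p - 1"] mult.commute)
  then have "p * a powr (p - 1) * a = p * a powr p"
    by (simp add: mult.assoc)
  ultimately show ?thesis
    unfolding right_diff_distrib left_diff_distrib by linarith
qed (use assms in auto)

text \<open>The tangent is taken at the lower bound \<open>a\<close>, not at the mean, so the mean
  itself may be infinite.\<close>

lemma jensen_powr_prob:
  fixes k :: "'a \<Rightarrow> ennreal" and g :: "'a \<Rightarrow> real"
  assumes [measurable]: "k \<in> borel_measurable M" "g \<in> borel_measurable M"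
    and g: "\<And>z. g z \<ge> 0" and p: "p \<ge> 1" and a: "a \<ge> 0"
    and le: "ennreal a \<le> (\<integral>\<^sup>+z. k z * ennreal (g z) \<partial>M)" and k: "(\<integral>\<^sup>+z. k z \<partial>M) \<le> 1"
  shows "ennreal (a powr p) \<le> (\<integral>\<^sup>+z. k z * ennreal (g z powr p) \<partial>M)" (is "_ \<le> ?A")
proof (cases "a = 0 \<or> ?A = \<infinity>")
  case False
  then have a: "a > 0" using a by auto
  define c where "c = p * a powr (p - 1)"
  have "c \<ge> 0" using p by (simp add: c_def)
  have ca: "c * a = p * a powr p"
    using a by (simp add: c_def powr_mult_base[of a "p - 1"] mult.commute mult.left_commute)
  have "ennreal (p * a powr p) = ennreal c * ennreal a"
    using \<open>c \<ge> 0\<close> a by (simp add: ca flip: ennreal_mult)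
  also have "\<dots> \<le> ennreal c * (\<integral>\<^sup>+z. k z * ennreal (g z) \<partial>M)"
    by (intro mult_left_mono le) auto
  also have "\<dots> = (\<integral>\<^sup>+z. k z * ennreal (c * g z) \<partial>M)"
    using \<open>c \<ge> 0\<close> by (subst nn_integral_cmult[symmetric]) (auto simp: ennreal_mult' ac_simps)
  also have "\<dots> \<le> (\<integral>\<^sup>+z. k z * (ennreal (g z powr p) + ennreal ((p - 1) * a powr p)) \<partial>M)"
    using powr_ge_tangent[OF g a p] p
    by (intro nn_integral_mono mult_left_mono) (auto simp: c_def simp flip: ennreal_plus intro!: ennreal_leI)
  also have "\<dots> = ?A + ennreal ((p - 1) * a powr p) * (\<integral>\<^sup>+z. k z \<partial>M)"
    by (simp add: distrib_left nn_integral_add nn_integral_multc mult.commute)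
  \<comment> \<open>Mass at most 1 enters here; afterwards the finite term
    \<open>(p - 1) * a powr p\<close> is subtracted.\<close>
  also have "\<dots> \<le> ?A + ennreal ((p - 1) * a powr p) * 1"
    by (intro add_left_mono mult_left_mono k) auto
  finally have *: "ennreal (p * a powr p) \<le> ?A + ennreal ((p - 1) * a powr p)" by simp
  obtain r where r: "?A = ennreal r" "r \<ge> 0"
    using False by (cases ?A) auto
  have "p * a powr p \<le> r + (p - 1) * a powr p"
    using * r p by (simp flip: ennreal_plus)
  then show ?thesis
    using r by (simp add: algebra_simps ennreal_leI)
qed auto

lemma jensen_powr:
  fixes k :: "'a \<Rightarrow> ennreal" and g :: "'a \<Rightarrow> real"
  assumes [measurable]: "k \<in> borel_measurable M" "g \<in> borel_measurable M"
    and g: "\<And>z. g z \<ge> 0" and p: "p \<ge> 1" and a: "a \<ge> 0" and K: "K \<ge> 1"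
    and le: "ennreal a \<le> (\<integral>\<^sup>+z. k z * ennreal (g z) \<partial>M)" and k: "(\<integral>\<^sup>+z. k z \<partial>M) \<le> ennreal K"
  shows "ennreal (a powr p) \<le> ennreal (K powr p) * (\<integral>\<^sup>+z. k z * ennreal (g z powr p) \<partial>M)"
proof -
  define i where "i = ennreal (1 / K)"
  have iK: "i * ennreal K = 1"
    using K by (simp add: i_def flip: ennreal_mult)
  have "ennreal (a / K) = i * ennreal a"
    using K a by (simp add: i_def flip: ennreal_mult)
  also have "\<dots> \<le> i * (\<integral>\<^sup>+z. k z * ennreal (g z) \<partial>M)"
    by (intro mult_left_mono le) auto
  also have "\<dots> = (\<integral>\<^sup>+z. (i * k z) * ennreal (g z) \<partial>M)"
    by (subst nn_integral_cmult[symmetric]) (auto simp: ac_simps)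
  finally have 1: "ennreal (a / K) \<le> (\<integral>\<^sup>+z. (i * k z) * ennreal (g z) \<partial>M)" .
  have "(\<integral>\<^sup>+z. i * k z \<partial>M) = i * (\<integral>\<^sup>+z. k z \<partial>M)"
    by (rule nn_integral_cmult) auto
  also have "\<dots> \<le> i * ennreal K"
    by (intro mult_left_mono k) auto
  finally have 2: "(\<integral>\<^sup>+z. i * k z \<partial>M) \<le> 1" by (simp add: iK)
  have "ennreal ((a / K) powr p) \<le> (\<integral>\<^sup>+z. (i * k z) * ennreal (g z powr p) \<partial>M)"
    using 1 2 K a by (intro jensen_powr_prob[OF _ _ g p]) auto
  \<comment> \<open>Discarding the factor \<open>1 / K\<close> loses one power of \<open>K\<close>:
    Hoelder would give \<open>K powr (p - 1)\<close>.\<close>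
  also have "\<dots> \<le> (\<integral>\<^sup>+z. k z * ennreal (g z powr p) \<partial>M)"
  proof (intro nn_integral_mono mult_right_mono)
    fix z
    have "i * k z \<le> 1 * k z"
      using K by (intro mult_right_mono) (auto simp: i_def)
    then show "i * k z \<le> k z" by simp
  qed auto
  finally have "ennreal (K powr p) * ennreal ((a / K) powr p) \<le> ennreal (K powr p) * (\<integral>\<^sup>+z. k z * ennreal (g z powr p) \<partial>M)"
    by (intro mult_left_mono) auto
  moreover have "K powr p * (a / K) powr p = a powr p"
    using K a by (simp add: powr_divide)
  ultimately show ?thesis
    by (simp flip: ennreal_mult)
qed

section \<open>Packing by disjoint sets\<close>

lemma infinite_disjoint_measure_top:
  fixes c :: ennreal
  assumes "infinite S" "disjoint_family_on A S" "\<And>x. x \<in> S \<Longrightarrow> A x \<in> sets M" 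
    "\<And>x. x \<in> S \<Longrightarrow> A x \<subseteq> B" "B \<in> sets M" "\<And>x. x \<in> S \<Longrightarrow> c \<le> emeasure M (A x)" "c > 0"
  shows "emeasure M B = \<infinity>"
proof -
  have "of_nat n * c \<le> emeasure M B" for n
  proof -
    obtain T where T: "T \<subseteq> S" "finite T" "card T = n"
      using assms(1) infinite_arbitrarily_large by metis
    have "of_nat n * c = (\<Sum>x\<in>T. c)" using T by simp
    also have "\<dots> \<le> (\<Sum>x\<in>T. emeasure M (A x))"
      using T assms by (intro sum_mono) auto
    also have "\<dots> = emeasure M (\<Union>x\<in>T. A x)"
      using T assms(2,3) by (intro sum_emeasure disjoint_family_on_mono[OF T(1)]) auto
    also have "\<dots> \<le> emeasure M B"
      using T assms by (intro emeasure_mono) auto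
    finally show ?thesis .
  qed
  note le = this
  show ?thesis
  proof (rule ccontr)
    assume "emeasure M B \<noteq> \<infinity>"
    then obtain r where r: "emeasure M B = ennreal r" "r \<ge> 0" by (cases "emeasure M B") auto
    have "c \<noteq> \<infinity>" using le[of 1] r by (auto simp: top_unique)
    then obtain d where d: "c = ennreal d" "d > 0"
      using \<open>c > 0\<close> by (cases c) auto
    obtain n where "r / d < real n" using reals_Archimedean2 by blast
    moreover have "real n * d \<le> r"
      using le[of n] r d by (simp add: ennreal_of_nat_eq_real_of_nat flip: ennreal_mult)
    ultimately show False using d by (simp add: field_simps)
  qed
qed

section \<open>Separability, regularity and covering in metric spaces\<close>

lemma doubling_iterate:
  assumes "\<And>r. r > 0 \<Longrightarrow> emeasure M (ball x (2 * r)) \<le> ennreal C * emeasure M (ball x r)"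
    and "C \<ge> 0" "r > 0"
  shows "emeasure M (ball x (2 ^ k * r)) \<le> ennreal (C ^ k) * emeasure M (ball x r)"
proof (induction k)
  case (Suc k)
  have "emeasure M (ball x (2 ^ Suc k * r)) \<le> ennreal C * emeasure M (ball x (2 ^ k * r))"
    using assms(1)[of "2 ^ k * r"] assms(3) by (simp add: mult.assoc)
  also have "\<dots> \<le> ennreal C * (ennreal (C ^ k) * emeasure M (ball x r))"
    by (intro mult_left_mono Suc.IH) auto
  finally show ?case
    using assms(2) by (simp add: ennreal_mult mult.assoc)
qed simp

text \<open>An inequality because the value at \<open>q = 0\<close> is
  \<open>top * 0 = 0\<close>.\<close>

lemma ennreal_inverse_mult_le: "q \<ge> 0 \<Longrightarrow> inverse (ennreal q) * ennreal q \<le> 1"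
  by (cases "q = 0") (simp_all add: inverse_ennreal flip: ennreal_mult)

text \<open>A separated set that is maximal for inclusion is a net: a point at distance at least
  \<open>e\<close> from all of it could be added.\<close>

lemma maximal_separated_set:
  fixes B :: "'a::metric_space set"
  assumes "e > 0"
  shows "\<exists>S\<subseteq>B. (\<forall>x\<in>S. \<forall>y\<in>S. x \<noteq> y \<longrightarrow> e \<le> dist x y) \<and> (\<forall>x\<in>B. \<exists>s\<in>S. dist s x < e)"
proof -
  define \<A> where "\<A> = {S. S \<subseteq> B \<and> (\<forall>x\<in>S. \<forall>y\<in>S. x \<noteq> y \<longrightarrow> e \<le> dist x y)}"
  have "\<exists>S\<in>\<A>. \<forall>X\<in>\<A>. S \<subseteq> X \<longrightarrow> X = S"
  proof (rule subset_Zorn')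
    fix C assume C: "subset.chain \<A> C"
    then have sub: "C \<subseteq> \<A>" and ch: "\<And>X Y. X \<in> C \<Longrightarrow> Y \<in> C \<Longrightarrow> X \<subseteq> Y \<or> Y \<subseteq> X"
      by (auto simp: subset.chain_def)
    have "e \<le> dist x y" if xy: "X \<in> C" "x \<in> X" "Y \<in> C" "y \<in> Y" "x \<noteq> y" for x y X Y
    proof -
      have "\<exists>Z\<in>C. x \<in> Z \<and> y \<in> Z" using ch[OF xy(1,3)] xy by blast
      then show ?thesis using sub xy(5) unfolding \<A>_def by blast
    qed
    moreover have "\<Union>C \<subseteq> B" using sub unfolding \<A>_def by blast
    ultimately show "\<Union>C \<in> \<A>" unfolding \<A>_def by blast
  qed
  then obtain S where S: "S \<in> \<A>" "\<And>X. X \<in> \<A> \<Longrightarrow> S \<subseteq> X \<Longrightarrow> X = S" by blast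
  have "\<exists>s\<in>S. dist s x < e" if "x \<in> B" for x
  proof (rule ccontr)
    assume *: "\<not> (\<exists>s\<in>S. dist s x < e)"
    then have "insert x S \<in> \<A>"
      using S(1) that unfolding \<A>_def by (auto simp: dist_commute not_less)
    then have "x \<in> S" using S(2)[of "insert x S"] by blast
    moreover have "dist x x < e" using assms by simp
    ultimately show False using * by blast
  qed
  moreover have "S \<subseteq> B" "\<forall>x\<in>S. \<forall>y\<in>S. x \<noteq> y \<longrightarrow> e \<le> dist x y"
    using S(1) unfolding \<A>_def by simp_all
  ultimately show ?thesis by (intro exI[of _ S]) simp
qed

text \<open>A maximal \<open>e\<close>-separated subset of a ball is finite: the balls of radius
  \<open>e / 2\<close> about its points are disjoint, lie in one ball of finite measure, and by
  doubling have measures bounded below. Such nets for integer radii and meshes \<open>1 / k\<close>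
  together form a countable dense set.\<close>

lemma doubling_imp_separable:
  fixes M :: "'a::metric_space measure"
  assumes op: "\<And>U. open U \<Longrightarrow> U \<in> sets M"
    and fin: "\<And>x r. r > 0 \<Longrightarrow> 0 < emeasure M (ball x r)" "\<And>x r. r > 0 \<Longrightarrow> emeasure M (ball x r) < \<infinity>"
    and dbl: "\<And>x r. r > 0 \<Longrightarrow> emeasure M (ball x (2 * r)) \<le> ennreal C * emeasure M (ball x r)" and C: "C \<ge> 0"
  shows "\<exists>D::'a set. countable D \<and> (\<forall>x. \<forall>e>0. \<exists>d\<in>D. dist d x < e)"
proof -
  fix x0 :: 'a
  have "\<exists>S::'a set. finite S \<and> (\<forall>x\<in>ball x0 R. \<exists>s\<in>S. dist s x < e)" if "R > 0" "e > 0" for R e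
  proof -
    obtain S where S: "S \<subseteq> ball x0 R" "\<forall>x\<in>S. \<forall>y\<in>S. x \<noteq> y \<longrightarrow> e \<le> dist x y"
      "\<forall>x\<in>ball x0 R. \<exists>s\<in>S. dist s x < e"
      using maximal_separated_set[OF \<open>e > 0\<close>, of "ball x0 R"] by blast
    \<comment> \<open>After \<open>k\<close> doublings a ball of radius \<open>e / 2\<close> about a
      point of \<open>ball x0 R\<close> contains all of \<open>ball x0 R\<close>; this makes
      \<open>c\<close> below a uniform lower bound.\<close>
    obtain k where k: "2 * R / (e / 2) < 2 ^ k"
      using real_arch_pow[of 2] by auto
    define c where "c = inverse (ennreal (C ^ k)) * emeasure M (ball x0 R)"
    have "finite S"
    proof (rule ccontr)
      assume inf: "infinite S"
      have "emeasure M (ball x0 (R + e)) = \<infinity>"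
      proof (rule infinite_disjoint_measure_top[OF inf, of "\<lambda>s. ball s (e / 2)" _ _ c])
        show "disjoint_family_on (\<lambda>s. ball s (e / 2)) S"
        proof (unfold disjoint_family_on_def, intro ballI impI)
          fix s t assume "s \<in> S" "t \<in> S" "s \<noteq> t"
          then have "e \<le> dist s t" using S(2) by blast
          then show "ball s (e / 2) \<inter> ball t (e / 2) = {}"
            by (intro disjoint_ballI) auto
        qed
        show "ball s (e / 2) \<subseteq> ball x0 (R + e)" if "s \<in> S" for s
        proof
          fix z assume "z \<in> ball s (e / 2)"
          moreover have "dist x0 s < R" using S(1) that by auto
          ultimately show "z \<in> ball x0 (R + e)"
            using dist_triangle[of x0 z s] \<open>e > 0\<close> by simp
        qed
        show "c \<le> emeasure M (ball s (e / 2))" if "s \<in> S" for s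
        proof -
          have "dist x0 s < R" using S(1) that by auto
          moreover have "R \<le> 2 ^ k * (e / 2) - R" using k \<open>e > 0\<close> by (simp add: field_simps)
          ultimately have "ball x0 R \<subseteq> ball s (2 ^ k * (e / 2))"
            by (intro subsetI) (metis (no_types, opaque_lifting) add_strict_mono dist_commute dist_triangle le_diff_eq less_le_trans mem_ball order_le_less_trans)
          then have "emeasure M (ball x0 R) \<le> emeasure M (ball s (2 ^ k * (e / 2)))"
            by (intro emeasure_mono op) auto
          also have "\<dots> \<le> ennreal (C ^ k) * emeasure M (ball s (e / 2))"
            using \<open>e > 0\<close> by (intro doubling_iterate dbl C) auto
          finally have le: "emeasure M (ball x0 R) \<le> ennreal (C ^ k) * emeasure M (ball s (e / 2))" .
          have "c \<le> inverse (ennreal (C ^ k)) * (ennreal (C ^ k) * emeasure M (ball s (e / 2)))"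
            unfolding c_def by (intro mult_left_mono le) auto
          also have "\<dots> \<le> 1 * emeasure M (ball s (e / 2))"
            unfolding mult.assoc[symmetric]
            using ennreal_inverse_mult_le[of "C ^ k"] C by (intro mult_right_mono) auto
          finally show ?thesis by simp
        qed
        show "c > 0"
          using fin(1)[OF \<open>R > 0\<close>, of x0]
          by (simp add: c_def ennreal_zero_less_mult_iff zero_less_iff_neq_zero)
      qed (auto intro: op)
      then show False using fin(2)[of "R + e" x0] that by auto
    qed
    then show ?thesis using S(3) by blast
  qed
  then have "\<forall>n k. \<exists>S::'a set. finite S \<and> (\<forall>x\<in>ball x0 (real (Suc n)). \<exists>s\<in>S. dist s x < 1 / real (Suc k))"
    by simp
  then obtain S :: "nat \<Rightarrow> nat \<Rightarrow> 'a set" where S: "\<And>n k. finite (S n k)"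
    "\<And>n k x. x \<in> ball x0 (real (Suc n)) \<Longrightarrow> \<exists>s\<in>S n k. dist s x < 1 / real (Suc k)"
    by metis
  show ?thesis
  proof (intro exI conjI allI impI)
    show "countable (\<Union>n k. S n k)" using countable_finite[OF S(1)] by (intro countable_UN) auto
    fix x and e :: real assume "e > 0"
    obtain k where k: "1 / real (Suc k) < e" using nat_approx_posE[OF \<open>e > 0\<close>] by auto
    obtain n where n: "dist x0 x < real n" using reals_Archimedean2 by blast
    then have "x \<in> ball x0 (real (Suc n))" by simp
    then show "\<exists>d\<in>\<Union>n k. S n k. dist d x < e" using S(2)[of x n k] k by (auto intro: less_trans)
  qed
qed

section \<open>Approximation of Borel sets by closed and open sets\<close>

text \<open>Induction over the generation from closed sets. A closed set is the intersection of its
  \<open>infdist\<close>-neighbourhoods; complements exchange the closed and the open approximation;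
  in countable unions the inner one is truncated, since only finite unions of closed sets stay
  closed.\<close>

lemma regular_finite_borel_measure:
  fixes N :: "'a::metric_space measure"
  assumes "finite_measure N" and sets[measurable_cong]: "sets N = sets borel"
    and A: "A \<in> sets borel" and "e > 0"
  shows "\<exists>K U. closed K \<and> open U \<and> K \<subseteq> A \<and> A \<subseteq> U \<and> measure N (U - K) < e"
proof -
  interpret finite_measure N by fact
  have "A \<in> sigma_sets UNIV (Collect closed)"
    using A by (simp add: borel_eq_closed)
  then show ?thesis using \<open>e > 0\<close>
  proof (induction arbitrary: e)
    case (Basic K)
    then have "closed K" by simp
    show ?case
    \<comment> \<open>\<open>infdist x {}\<close> is 0, so these neighbourhoods would not shrink to
      the empty set.\<close>
    proof (cases "K = {}")
      case False
      define U where "U n = {x. infdist x K < 1 / real (Suc n)}" for n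
      have op: "open (U n)" for n
        unfolding U_def by (intro open_Collect_less continuous_intros)
      have sub: "K \<subseteq> U n" for n
        by (auto simp: U_def)
      have meas: "U n - K \<in> sets N" for n
        using op[of n] \<open>closed K\<close> by (auto simp: sets)
      have dec: "decseq (\<lambda>n. U n - K)"
      proof (rule decseq_SucI)
        fix n
        have "1 / real (Suc (Suc n)) \<le> 1 / real (Suc n)" by (simp add: field_simps)
        then show "U (Suc n) - K \<subseteq> U n - K" unfolding U_def by (auto intro: less_le_trans)
      qed
      have "(\<Inter>n. U n - K) = {}"
      proof safe
        fix x assume x: "x \<in> (\<Inter>n. U n - K)"
        have "infdist x K \<le> 0"
        proof (rule ccontr)
          assume "\<not> infdist x K \<le> 0"
          then obtain n where "1 / real (Suc n) < infdist x K" using nat_approx_posE[of "infdist x K"] by auto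
          moreover have "infdist x K < 1 / real (Suc n)" using x by (auto simp: U_def)
          ultimately show False by simp
        qed
        then have "x \<in> K" using \<open>closed K\<close> False infdist_nonneg[of x K]
          by (simp add: in_closed_iff_infdist_zero)
        then show "x \<in> {}" using x by auto
      qed
      then have "(\<lambda>n. measure N (U n - K)) \<longlonglongrightarrow> measure N {}"
        using finite_Lim_measure_decseq[OF _ dec] meas by (metis image_subsetI)
      then have "\<forall>\<^sub>F n in sequentially. measure N (U n - K) < e"
        using \<open>e > 0\<close> by (intro order_tendstoD(2)) auto
      then obtain n where "measure N (U n - K) < e"
        by (auto simp: eventually_sequentially)
      then show ?thesis using op sub \<open>closed K\<close> by blast
    qed (use \<open>e > 0\<close> in \<open>intro exI[of _ "{}"], auto\<close>)
  next
    case Empty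
    then show ?case by (intro exI[of _ "{}"]) auto
  next
    case (Compl A)
    obtain K U where KU: "closed K" "open U" "K \<subseteq> A" "A \<subseteq> U" "measure N (U - K) < e"
      using Compl.IH[OF Compl.prems] by auto
    moreover have "- K - - U = U - K" by auto
    ultimately show ?case
      by (intro exI[of _ "- U"] exI[of _ "- K"]) (auto simp: closed_Compl open_Compl)
  next
    case (Union A)
    \<comment> \<open>The errors add up to \<open>e / 2\<close>; the other half is left for
      truncating the union of the \<open>K i\<close>.\<close>
    have "\<forall>i. \<exists>K U. closed K \<and> open U \<and> K \<subseteq> A i \<and> A i \<subseteq> U \<and> measure N (U - K) < (e / 2) * (1/2) ^ Suc i"
      using Union.prems by (intro allI Union.IH) simp
    then obtain K U where KU: "\<And>i. closed (K i)" "\<And>i. open (U i)" "\<And>i. K i \<subseteq> A i" "\<And>i. A i \<subseteq> U i"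
      "\<And>i. measure N (U i - K i) < (e / 2) * (1/2) ^ Suc i" by metis
    define L where "L n = (\<Union>i\<le>n. K i)" for n
    have [measurable]: "U i \<in> sets N" "K i \<in> sets N" for i using KU by (auto simp: sets)
    have cl: "closed (L n)" for n unfolding L_def using KU(1) by (intro closed_UN) auto
    have sums: "(\<lambda>i. (e / 2) * (1/2) ^ Suc i) sums (e / 2)"
      using sums_mult[OF power_half_series, of "e/2"] by simp
    have summ: "summable (\<lambda>i. measure N (U i - K i))"
    proof (rule summable_comparison_test'[OF sums_summable[OF sums]])
      show "norm (measure N (U i - K i)) \<le> (e / 2) * (1/2) ^ Suc i" for i
        using KU(5)[of i] by simp
    qed
    have "measure N ((\<Union>i. U i) - (\<Union>i. K i)) \<le> measure N (\<Union>i. U i - K i)"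
      by (intro finite_measure_mono) (auto, measurable)
    also have "\<dots> \<le> (\<Sum>i. measure N (U i - K i))"
      by (intro finite_measure_subadditive_countably summ) auto
    also have "\<dots> \<le> (\<Sum>i. (e / 2) * (1/2) ^ Suc i)"
      by (intro suminf_le sums_summable[OF sums] summ less_imp_le KU(5))
    also have "\<dots> = e / 2" using sums by (simp add: sums_iff)
    finally have *: "measure N ((\<Union>i. U i) - (\<Union>i. K i)) < e" using \<open>e > 0\<close> by simp
    have "(\<lambda>n. measure N ((\<Union>i. U i) - L n)) \<longlonglongrightarrow> measure N (\<Inter>n. (\<Union>i. U i) - L n)"
      by (intro finite_Lim_measure_decseq) (auto simp: decseq_def L_def intro: order_trans)
    also have "(\<Inter>n. (\<Union>i. U i) - L n) = (\<Union>i. U i) - (\<Union>i. K i)"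
      by (auto simp: L_def)
    finally have "\<forall>\<^sub>F n in sequentially. measure N ((\<Union>i. U i) - L n) < e"
      using * by (rule order_tendstoD)
    then obtain n where "measure N ((\<Union>i. U i) - L n) < e"
      by (auto simp: eventually_sequentially)
    moreover have "open (\<Union>i. U i)" using KU(2) by auto
    moreover have "L n \<subseteq> (\<Union>i. A i)" "(\<Union>i. A i) \<subseteq> (\<Union>i. U i)" using KU(3,4) unfolding L_def by blast+
    ultimately show ?case using cl[of n] by (intro exI[of _ "L n"] exI[of _ "\<Union>i. U i"]) simp
  qed
qed

lemma outer_regular_finite_borel_measure:
  fixes N :: "'a::metric_space measure"
  assumes "finite_measure N" and sets: "sets N = sets borel" and A: "A \<in> sets borel" and "e > 0"
  shows "\<exists>U. open U \<and> A \<subseteq> U \<and> emeasure N U \<le> emeasure N A + ennreal e"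
proof -
  interpret finite_measure N by fact
  obtain K U where KU: "closed K" "open U" "K \<subseteq> A" "A \<subseteq> U" "measure N (U - K) < e"
    using regular_finite_borel_measure[OF assms] by blast
  have "emeasure N U \<le> emeasure N (A \<union> (U - K))"
    using KU A by (intro emeasure_mono) (auto simp: sets)
  also have "\<dots> \<le> emeasure N A + emeasure N (U - K)"
    using KU A by (intro emeasure_subadditive) (auto simp: sets)
  also have "emeasure N (U - K) \<le> ennreal e"
    using KU by (simp add: emeasure_eq_measure ennreal_leI)
  finally show ?thesis using KU by (auto intro: add_left_mono)
qed

text \<open>Radii are powers of \<open>1/2\<close>, so a ball of least index among those missing a disjoint family always
  exists. Only the centers need to be covered, hence the dilation factor 2 rather than 5.\<close>
lemma vitali_selection:
  fixes A :: "'a::metric_space set" and n :: "'a \<Rightarrow> nat"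
  defines "B \<equiv> \<lambda>x. ball x ((1 / 2) ^ n x)"
  shows "\<exists>S\<subseteq>A. disjoint_family_on B S \<and> A \<subseteq> (\<Union>x\<in>S. ball x (2 * (1 / 2) ^ n x))"
proof -
  \<comment> \<open>The last clause is the invariant that survives unions of chains: a ball that
    meets the family meets a member of at least its own radius. Disjointness alone would give no
    control on the size of the ball that is hit.\<close>
  define \<A> where "\<A> = {S. S \<subseteq> A \<and> disjoint_family_on B S \<and>
     (\<forall>y\<in>A. (\<exists>x\<in>S. B y \<inter> B x \<noteq> {}) \<longrightarrow> (\<exists>x\<in>S. B y \<inter> B x \<noteq> {} \<and> n x \<le> n y))}"
  have "\<exists>S\<in>\<A>. \<forall>X\<in>\<A>. S \<subseteq> X \<longrightarrow> X = S"
  proof (rule subset_Zorn')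
    fix C assume C: "subset.chain \<A> C"
    then have sub: "C \<subseteq> \<A>" and ch: "\<And>X Y. X \<in> C \<Longrightarrow> Y \<in> C \<Longrightarrow> X \<subseteq> Y \<or> Y \<subseteq> X"
      by (auto simp: subset.chain_def)
    have "B x \<inter> B y = {}" if xy: "X \<in> C" "x \<in> X" "Y \<in> C" "y \<in> Y" "x \<noteq> y" for x y X Y
    proof -
      have "\<exists>Z\<in>C. x \<in> Z \<and> y \<in> Z" using ch[OF xy(1,3)] xy by blast
      then show ?thesis using sub xy(5) unfolding \<A>_def disjoint_family_on_def by blast
    qed
    then have "disjoint_family_on B (\<Union>C)" unfolding disjoint_family_on_def by blast
    moreover have "\<Union>C \<subseteq> A" using sub unfolding \<A>_def by blast
    moreover have "\<exists>x\<in>\<Union>C. B y \<inter> B x \<noteq> {} \<and> n x \<le> n y" if "y \<in> A" "x \<in> \<Union>C" "B y \<inter> B x \<noteq> {}" for x y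
    proof -
      obtain X where X: "X \<in> C" "x \<in> X" using \<open>x \<in> \<Union>C\<close> by blast
      then have "\<exists>x\<in>X. B y \<inter> B x \<noteq> {} \<and> n x \<le> n y"
        using sub that unfolding \<A>_def by blast
      then show ?thesis using X by blast
    qed
    ultimately show "\<Union>C \<in> \<A>" unfolding \<A>_def by blast
  qed
  then obtain S where S: "S \<in> \<A>" and max: "\<And>X. X \<in> \<A> \<Longrightarrow> S \<subseteq> X \<Longrightarrow> X = S" by blast
  have SA: "S \<subseteq> A" and dis: "disjoint_family_on B S"
    and hit: "\<And>y x. y \<in> A \<Longrightarrow> x \<in> S \<Longrightarrow> B y \<inter> B x \<noteq> {} \<Longrightarrow> \<exists>x\<in>S. B y \<inter> B x \<noteq> {} \<and> n x \<le> n y"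
    using S unfolding \<A>_def by blast+
  have meet: "\<exists>x\<in>S. B y \<inter> B x \<noteq> {}" if "y \<in> A" for y
  proof (rule ccontr)
    assume no: "\<not> ?thesis"
    define P where "P y \<longleftrightarrow> y \<in> A \<and> (\<forall>x\<in>S. B y \<inter> B x = {})" for y
    have "P y" using that no unfolding P_def by blast
    \<comment> \<open>Among the balls missing the family, one of least index, that is of largest
      radius, can be added without breaking the invariant.\<close>
    then obtain y0 where y0: "P y0" "\<And>y. P y \<Longrightarrow> n y0 \<le> n y"
      using ex_has_least_nat[of P y n] by blast
    have ne: "B z \<inter> B z \<noteq> {}" for z unfolding B_def by (simp add: not_le)
    have "insert y0 S \<in> \<A>"
      unfolding \<A>_def
    proof (intro CollectI conjI ballI impI)
      show "insert y0 S \<subseteq> A" using SA y0(1) unfolding P_def by blast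
      show "disjoint_family_on B (insert y0 S)"
        using dis y0(1) unfolding P_def disjoint_family_on_def by blast
      fix z assume z: "z \<in> A" "\<exists>x\<in>insert y0 S. B z \<inter> B x \<noteq> {}"
      show "\<exists>x\<in>insert y0 S. B z \<inter> B x \<noteq> {} \<and> n x \<le> n z"
      proof (cases "P z")
        case True
        then have "B z \<inter> B y0 \<noteq> {}" using z(2) unfolding P_def by blast
        then show ?thesis using y0(2)[OF True] by blast
      next
        case False
        then show ?thesis using hit[OF z(1)] z(1) unfolding P_def by blast
      qed
    qed
    then have "y0 \<in> S" using max[of "insert y0 S"] by blast
    then show False using y0(1) ne unfolding P_def by blast
  qed
  have "y \<in> (\<Union>x\<in>S. ball x (2 * (1 / 2) ^ n x))" if "y \<in> A" for y
  proof -
    obtain x' where "x' \<in> S" "B y \<inter> B x' \<noteq> {}" using meet \<open>y \<in> A\<close> by blast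
    then obtain x where x: "x \<in> S" "B y \<inter> B x \<noteq> {}" "n x \<le> n y"
      using hit \<open>y \<in> A\<close> by blast
    then obtain z where z: "dist y z < (1/2) ^ n y" "dist x z < (1/2) ^ n x"
      unfolding B_def by auto
    have "(1/2::real) ^ n y \<le> (1/2) ^ n x" using x(3) by (intro power_decreasing) auto
    then have "dist x y < 2 * (1 / 2) ^ n x"
      using z dist_triangle[of x y z] dist_commute[of y z] by linarith
    then show ?thesis using x(1) by auto
  qed
  then show ?thesis using SA dis by blast
qed

text \<open>Each ball contains a point of the countable dense set, and disjoint balls contain
  different ones.\<close>

lemma countable_disjoint_balls:
  fixes D :: "'a::metric_space set"
  assumes D: "countable D" "\<And>(x::'a) e. e > 0 \<Longrightarrow> \<exists>d\<in>D. dist d x < e"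
    and dis: "disjoint_family_on (\<lambda>x::'a. ball x (r x)) S" and r: "\<And>x. x \<in> S \<Longrightarrow> r x > 0"
  shows "countable S"
proof -
  have "\<forall>x\<in>S. \<exists>d\<in>D. d \<in> ball x (r x)" using D(2) r by (metis dist_commute mem_ball)
  then obtain g where g: "\<And>x. x \<in> S \<Longrightarrow> g x \<in> D \<and> g x \<in> ball x (r x)" by metis
  have "inj_on g S"
  proof (rule inj_onI, rule ccontr)
    fix x y assume xy: "x \<in> S" "y \<in> S" "g x = g y" "x \<noteq> y"
    then have "ball x (r x) \<inter> ball y (r y) = {}" using dis unfolding disjoint_family_on_def by blast
    moreover have "g x \<in> ball x (r x)" "g x \<in> ball y (r y)" using g[of x] g[of y] xy by auto
    ultimately show False by blast
  qed
  moreover have "countable (g ` S)"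
    using g by (intro countable_subset[OF _ D(1)]) auto
  ultimately show ?thesis by (rule countable_image_inj_on[rotated])
qed

section \<open>Measurability in separable metric spaces\<close>

locale separable_metric =
  fixes D :: "'a::metric_space set"
  assumes countable_D: "countable D" and dense_D: "\<And>(x::'a) e. e > 0 \<Longrightarrow> \<exists>d\<in>D. dist d x < e"
begin

text \<open>Separability writes the sublevel set as a countable union of products of two balls with
  a common dense center; without it the distance can fail to be measurable for the product
  sigma-algebra.\<close>

lemma measurable_dist_pair: "(\<lambda>p. dist (fst p) (snd p)) \<in> borel_measurable ((borel :: 'a measure) \<Otimes>\<^sub>M borel)"
proof (rule borel_measurableI_less)
  fix y :: real
  have "{p \<in> space ((borel :: 'a measure) \<Otimes>\<^sub>M borel). dist (fst p) (snd p) < y}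
      = (\<Union>d\<in>D. \<Union>q\<in>\<rat>. ball d q \<times> ball d (y - q))" (is "?L = ?R")
  proof (intro equalityI subsetI)
    fix p assume "p \<in> ?L"
    then obtain x z where p: "p = (x, z)" and xz: "dist x z < y" by (cases p) auto
    \<comment> \<open>The slack \<open>e\<close> is split: \<open>d\<close> is within
      \<open>e / 4\<close> of \<open>x\<close> and \<open>q\<close> lies between
      \<open>e / 4\<close> and \<open>e / 2\<close>, so both radii \<open>q\<close> and
      \<open>y - q\<close> are large enough.\<close>
    define e where "e = y - dist x z"
    have "e > 0" using xz by (simp add: e_def)
    obtain d where d: "d \<in> D" "dist d x < e / 4" using dense_D[of "e / 4" x] \<open>e > 0\<close> by auto
    obtain q where q: "q \<in> \<rat>" "e / 4 < q" "q < e / 2" using Rats_dense_in_real[of "e / 4" "e / 2"] \<open>e > 0\<close> by auto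
    have "dist d z < y - q" using d q dist_triangle[of d z x] by (simp add: e_def)
    then show "p \<in> ?R" using d q p by force
  next
    fix p assume "p \<in> ?R"
    then obtain d q where d: "dist d (fst p) < q" "dist d (snd p) < y - q" by (auto simp: mem_Times_iff)
    then show "p \<in> ?L"
      using dist_triangle[of "fst p" "snd p" d] by (simp add: space_pair_measure dist_commute)
  qed
  also have "?R \<in> sets (borel \<Otimes>\<^sub>M borel)"
    using countable_D countable_rat by (intro sets.countable_UN'' pair_measureI) auto
  finally show "{p \<in> space ((borel :: 'a measure) \<Otimes>\<^sub>M borel). dist (fst p) (snd p) < y} \<in> sets (borel \<Otimes>\<^sub>M borel)" .
qed

lemma measurable_dist [measurable]:
  fixes f g :: "'b \<Rightarrow> 'a"
  assumes [measurable]: "f \<in> measurable M borel" "g \<in> measurable M borel"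
  shows "(\<lambda>x. dist (f x) (g x)) \<in> borel_measurable M"
proof -
  have "(\<lambda>x. (f x, g x)) \<in> measurable M (borel \<Otimes>\<^sub>M borel)" by measurable
  from measurable_compose[OF this measurable_dist_pair] show ?thesis by simp
qed

lemma measurable_infdist [measurable]:
  assumes "f \<in> measurable M borel"
  shows "(\<lambda>x. infdist (f x :: 'a) F) \<in> borel_measurable M"
  by (rule measurable_compose[OF assms borel_measurable_continuous_onI]) (intro continuous_intros)

text \<open>A Lindelof argument: off the support every point lies in a null ball with center in
  \<open>D\<close> and rational radius, and there are only countably many of these.\<close>

lemma null_set_compl_support:
  fixes M :: "'a measure"
  assumes sets: "sets M = sets borel" and supp: "measure_support M = S"
  shows "emeasure M (- S) = 0"
proof -
  define I where "I = {p\<in>D \<times> (\<rat>::real set). emeasure M (ball (fst p) (snd p)) = 0}"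
  have "countable I" unfolding I_def
    using countable_D countable_rat by (intro countable_Collect countable_SIGMA) auto
  then have null: "(\<Union>p\<in>I. ball (fst p) (snd p)) \<in> null_sets M"
    by (intro null_sets_UN') (auto simp: I_def sets null_sets_def)
  have "- S \<subseteq> (\<Union>p\<in>I. ball (fst p) (snd p))"
  proof
    fix x assume "x \<in> - S"
    then obtain U where U: "open U" "x \<in> U" "emeasure M U = 0"
      using supp by (auto simp: measure_support_def not_less zero_less_iff_neq_zero)
    then obtain e where e: "e > 0" "ball x e \<subseteq> U" using open_contains_ball by blast
    obtain d where d: "d \<in> D" "dist d x < e / 4" using dense_D[of "e / 4" x] \<open>e > 0\<close> by auto
    obtain q where q: "q \<in> \<rat>" "e / 4 < q" "q < e / 2" using Rats_dense_in_real[of "e / 4" "e / 2"] \<open>e > 0\<close> by auto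
    have "ball d q \<subseteq> U"
    proof
      fix z assume "z \<in> ball d q"
      then have "dist x z < e" using d q dist_triangle[of x z d] by (simp add: dist_commute)
      then show "z \<in> U" using e by auto
    qed
    then have "emeasure M (ball d q) \<le> emeasure M U" using U sets by (intro emeasure_mono) auto
    then have "(d, q) \<in> I" using U d q by (simp add: I_def)
    moreover have "x \<in> ball d q" using d q by simp
    ultimately show "x \<in> (\<Union>p\<in>I. ball (fst p) (snd p))" by force
  qed
  then have "emeasure M (- S) \<le> emeasure M (\<Union>p\<in>I. ball (fst p) (snd p))"
    using null by (intro emeasure_mono) auto
  also have "\<dots> = 0" using null by (simp add: null_sets_def)
  finally show ?thesis by simp
qed

end

section \<open>Lebesgue points for doubling measures\<close>

text \<open>Integration over \<open>count_space S\<close> treats finite and infinite index sets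
  alike; the families selected by Vitali's argument may be either.\<close>

lemma emeasure_UN_le_count_space:
  assumes "countable S" "\<And>s. s \<in> S \<Longrightarrow> X s \<in> sets M"
  shows "emeasure M (\<Union>s\<in>S. X s) \<le> (\<integral>\<^sup>+s. emeasure M (X s) \<partial>count_space S)"
proof (cases "finite S")
  case True
  then show ?thesis
    using assms emeasure_subadditive_finite[of S X M]
    by (simp add: nn_integral_count_space_finite image_subset_iff)
next
  case False
  then have bij: "bij_betw (from_nat_into S) UNIV S"
    using assms(1) by (intro bij_betw_from_nat_into)
  then have S: "S = range (from_nat_into S)" by (simp add: bij_betw_def)
  have "emeasure M (\<Union>s\<in>S. X s) = emeasure M (\<Union>i. X (from_nat_into S i))"
    by (subst S) (simp add: image_image)
  also have "\<dots> \<le> (\<Sum>i. emeasure M (X (from_nat_into S i)))"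
    using assms bij by (intro emeasure_subadditive_countably) (auto simp: bij_betw_def)
  also have "\<dots> = (\<integral>\<^sup>+i. emeasure M (X (from_nat_into S i)) \<partial>count_space UNIV)"
    by (simp add: nn_integral_count_space_nat)
  also have "\<dots> = (\<integral>\<^sup>+s. emeasure M (X s) \<partial>count_space S)"
    by (rule nn_integral_bij_count_space[OF bij])
  finally show ?thesis .
qed

context separable_metric
begin

lemma ball_borel [measurable]: "ball (x :: 'a) r \<in> sets borel"
  by simp

text \<open>The measure is the integral over \<open>z\<close> of a function jointly measurable in
  the parameter and \<open>z\<close>; sigma-finiteness makes this measurable in the
  parameter.\<close>

lemma measurable_emeasure_ball:
  fixes N :: "'a measure"
  assumes "sigma_finite_measure N" and [measurable_cong]: "sets N = sets borel"
    and [measurable]: "a \<in> measurable K borel" "g \<in> borel_measurable K"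
  shows "(\<lambda>x. emeasure N (ball (a x) (g x))) \<in> borel_measurable K"
proof -
  interpret N: sigma_finite_measure N by fact
  have "emeasure N (ball y r) = (\<integral>\<^sup>+z. (if dist y z < r then 1 else 0) \<partial>N)" for y r
  proof -
    have "emeasure N (ball y r) = (\<integral>\<^sup>+z. indicator (ball y r) z \<partial>N)"
      by (intro nn_integral_indicator[symmetric]) (simp add: assms(2))
    also have "\<dots> = (\<integral>\<^sup>+z. (if dist y z < r then 1 else 0) \<partial>N)"
      by (intro nn_integral_cong) (simp add: indicator_def)
    finally show ?thesis .
  qed
  then have "(\<lambda>x. emeasure N (ball (a x) (g x))) = (\<lambda>x. \<integral>\<^sup>+z. (if dist (a x) z < g x then 1 else 0) \<partial>N)" by simp
  also have "\<dots> \<in> borel_measurable K" by measurable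
  finally show ?thesis .
qed

end

section \<open>Measures doubling at the points of a closed set\<close>

lemma sigma_finite_measure_balls:
  fixes N :: "'a::metric_space measure"
  assumes sets: "sets N = sets borel" and fin: "\<And>x r. emeasure N (ball x r) < \<infinity>"
  shows "sigma_finite_measure N"
proof
  fix x0 :: 'a
  show "\<exists>A. countable A \<and> A \<subseteq> sets N \<and> \<Union>A = space N \<and> (\<forall>a\<in>A. emeasure N a \<noteq> \<infinity>)"
  proof (intro exI[of _ "range (\<lambda>n. ball x0 (real n))"] conjI)
    show "\<Union>(range (\<lambda>n. ball x0 (real n))) = space N"
      using reals_Archimedean2 by (auto simp: Union_eq sets_eq_imp_space_eq[OF sets])
  qed (use fin in \<open>auto simp: sets less_top\<close>)
qed

locale doubling_on = separable_metric D for D :: "'a::metric_space set" +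
  fixes \<mu> :: "'a measure" and F :: "'a set" and c :: real
  assumes sets_mu [measurable_cong]: "sets \<mu> = sets borel"
    and closed_F: "closed F" and F_ne: "F \<noteq> {}" and null_compl: "emeasure \<mu> (- F) = 0"
    and c_ge_1: "c \<ge> 1"
    and pos: "\<And>x r. x \<in> F \<Longrightarrow> r > 0 \<Longrightarrow> 0 < emeasure \<mu> (ball x r)"
    and fin': "\<And>x r. x \<in> F \<Longrightarrow> emeasure \<mu> (ball x r) < \<infinity>"
    and dbl: "\<And>x r. x \<in> F \<Longrightarrow> r > 0 \<Longrightarrow> emeasure \<mu> (ball x (2 * r)) \<le> ennreal c * emeasure \<mu> (ball x r)"
begin

abbreviation "mu_ball x r \<equiv> emeasure \<mu> (ball x r)"

lemma space_mu [simp]: "space \<mu> = UNIV"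
  using sets_eq_imp_space_eq[OF sets_mu] by simp

lemma F_borel [measurable]: "F \<in> sets borel"
  using closed_F by simp

text \<open>Finiteness is assumed only at centers in \<open>F\<close>; any other ball sits in a
  larger one centered there.\<close>

lemma fin: "mu_ball x r < \<infinity>"
proof -
  obtain y where y: "y \<in> F" using F_ne by auto
  have "ball x r \<subseteq> ball y (dist y x + r)"
  proof
    fix z assume "z \<in> ball x r"
    then show "z \<in> ball y (dist y x + r)" using dist_triangle[of y z x] by simp
  qed
  then have "mu_ball x r \<le> mu_ball y (dist y x + r)"
    by (intro emeasure_mono) (auto simp: sets_mu)
  also have "\<dots> < \<infinity>" by (rule fin'[OF y])
  finally show ?thesis .
qed

lemma sigma_finite_mu: "sigma_finite_measure \<mu>"
  by (rule sigma_finite_measure_balls[OF sets_mu fin])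

sublocale mu: sigma_finite_measure \<mu> by (rule sigma_finite_mu)

lemma measurable_mu_ball [measurable]:
  "a \<in> measurable K borel \<Longrightarrow> g \<in> borel_measurable K \<Longrightarrow> (\<lambda>x. mu_ball (a x) (g x)) \<in> borel_measurable K"
  by (rule measurable_emeasure_ball[OF sigma_finite_mu sets_mu])

lemma mu_doubling_iterate:
  "x \<in> F \<Longrightarrow> r > 0 \<Longrightarrow> mu_ball x (2 ^ k * r) \<le> ennreal (c ^ k) * mu_ball x r"
  using dbl c_ge_1 by (intro doubling_iterate) auto

lemma AE_mu_in_F: "AE x in \<mu>. x \<in> F"
  using null_compl by (intro AE_I[of _ _ "- F"]) (auto simp: sets_mu)

text \<open>From the given balls a disjoint subfamily is chosen whose doubles still cover
  \<open>A\<close>. Doubling of \<open>\<mu>\<close> at centers in \<open>A \<subseteq> F\<close>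
  costs the factor \<open>c\<close>, and disjointness adds the \<open>N\<close>-measures up inside
  \<open>U\<close>.\<close>

lemma vitali_bound:
  assumes A: "A \<in> sets borel" "A \<subseteq> F" and N[measurable_cong]: "sets N = sets borel" and U: "open U"
    and ex: "\<And>x. x \<in> A \<Longrightarrow> \<exists>i. ball x ((1/2) ^ i) \<subseteq> U \<and> ennreal b * mu_ball x ((1/2) ^ i) \<le> emeasure N (ball x ((1/2) ^ i))"
  shows "ennreal b * emeasure \<mu> A \<le> ennreal c * emeasure N U"
proof -
  obtain n where n: "\<And>x. x \<in> A \<Longrightarrow> ball x ((1/2) ^ n x) \<subseteq> U"
    "\<And>x. x \<in> A \<Longrightarrow> ennreal b * mu_ball x ((1/2) ^ n x) \<le> emeasure N (ball x ((1/2) ^ n x))"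
    using ex by metis
  obtain S where S: "S \<subseteq> A" "disjoint_family_on (\<lambda>x. ball x ((1/2) ^ n x)) S"
    "A \<subseteq> (\<Union>x\<in>S. ball x (2 * (1 / 2) ^ n x))"
    using vitali_selection[of A n] by blast
  have cS: "countable S"
    by (rule countable_disjoint_balls[OF countable_D dense_D S(2)]) auto
  have "ennreal b * emeasure \<mu> A \<le> ennreal b * emeasure \<mu> (\<Union>x\<in>S. ball x (2 * (1 / 2) ^ n x))"
    using S(3) A cS by (intro mult_left_mono emeasure_mono) (auto simp: sets_mu intro!: sets.countable_UN')
  also have "\<dots> \<le> ennreal b * (\<integral>\<^sup>+x. mu_ball x (2 * (1 / 2) ^ n x) \<partial>count_space S)"
    by (intro mult_left_mono emeasure_UN_le_count_space cS) (auto simp: sets_mu)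
  also have "\<dots> \<le> ennreal b * (\<integral>\<^sup>+x. ennreal c * mu_ball x ((1 / 2) ^ n x) \<partial>count_space S)"
    using S(1) A(2) by (intro mult_left_mono nn_integral_mono dbl) auto
  also have "\<dots> = ennreal c * (\<integral>\<^sup>+x. ennreal b * mu_ball x ((1 / 2) ^ n x) \<partial>count_space S)"
    by (simp add: nn_integral_cmult mult.left_commute)
  also have "\<dots> \<le> ennreal c * (\<integral>\<^sup>+x. emeasure N (ball x ((1 / 2) ^ n x)) \<partial>count_space S)"
    using S(1) n(2) by (intro mult_left_mono nn_integral_mono) auto
  also have "\<dots> = ennreal c * emeasure N (\<Union>x\<in>S. ball x ((1 / 2) ^ n x))"
    using S(2) cS by (subst emeasure_UN_countable) (auto simp: N)
  also have "\<dots> \<le> ennreal c * emeasure N U"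
    using n(1) S(1) U by (intro mult_left_mono emeasure_mono) (auto simp: N)
  finally show ?thesis .
qed

text \<open>On the bad set \<open>A\<close> the measure \<open>N\<close> has density
  \<open>|f - a| < e\<close>, so \<open>N(A) \<le> e \<mu>(A)\<close>; the covering bound gives
  \<open>2 c e \<mu>(A) \<le> c N(U)\<close> with \<open>N(U)\<close> arbitrarily close to
  \<open>N(A)\<close>. Together \<open>2 \<mu>(A) \<le> \<mu>(A)\<close>: the factor 2 in the
  threshold forces \<open>A\<close> to be null.\<close>

lemma differentiation_bad_set_null:
  assumes f[measurable]: "f \<in> borel_measurable borel" and B0: "B0 = ball x0 R"
    and int: "(\<integral>\<^sup>+z\<in>B0. ennreal \<bar>f z\<bar> \<partial>\<mu>) < \<infinity>" and e: "e > 0"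
  shows "AE x in \<mu>. x \<in> F \<inter> B0 \<longrightarrow> \<bar>f x - a\<bar> < e \<longrightarrow>
    (\<exists>j. \<forall>i\<ge>j. (\<integral>\<^sup>+z\<in>ball x ((1/2) ^ i). ennreal \<bar>f z - a\<bar> * indicator B0 z \<partial>\<mu>) \<le> ennreal (2 * c * e) * mu_ball x ((1/2) ^ i))"
proof -
  have [measurable]: "B0 \<in> sets borel" using B0 by simp
  \<comment> \<open>The cut to \<open>B0\<close> makes \<open>N\<close> finite, as the outer
    approximation by open sets requires.\<close>
  define w where "w = (\<lambda>z. ennreal \<bar>f z - a\<bar> * indicator B0 z)"
  have w[measurable]: "w \<in> borel_measurable borel" unfolding w_def by measurable
  define N where "N = density \<mu> w"
  have setsN[measurable_cong]: "sets N = sets borel" by (simp add: N_def sets_mu)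
  have N_eq: "emeasure N X = (\<integral>\<^sup>+z\<in>X. w z \<partial>\<mu>)" if "X \<in> sets borel" for X
    using that unfolding N_def by (simp add: emeasure_density sets_mu)
  have "finite_measure N"
  proof
    have "emeasure N (space N) \<le> (\<integral>\<^sup>+z. ennreal \<bar>f z\<bar> * indicator B0 z + ennreal \<bar>a\<bar> * indicator B0 z \<partial>\<mu>)"
      unfolding N_def
      by (simp add: emeasure_density w_def, intro nn_integral_mono)
         (auto simp: indicator_def simp flip: ennreal_plus intro!: ennreal_leI)
    also have "\<dots> = (\<integral>\<^sup>+z\<in>B0. ennreal \<bar>f z\<bar> \<partial>\<mu>) + ennreal \<bar>a\<bar> * emeasure \<mu> B0"
      by (subst nn_integral_add) (auto simp: nn_integral_cmult sets_mu)
    also have "\<dots> < \<infinity>" using int fin B0 by (simp add: ennreal_mult_less_top)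
    finally show "emeasure N (space N) \<noteq> \<infinity>" by simp
  qed
  define Q where "Q x i \<longleftrightarrow> ennreal (2 * c * e) * mu_ball x ((1/2) ^ i) < (\<integral>\<^sup>+z. (if dist x z < (1/2)^i then w z else 0) \<partial>\<mu>)" for x i
  have int_ball: "(\<integral>\<^sup>+z. (if dist x z < (1/2)^i then w z else 0) \<partial>\<mu>) = emeasure N (ball x ((1/2) ^ i))" for x i
    by (subst N_eq) (auto intro!: nn_integral_cong simp: indicator_def)
  define A where "A = {x \<in> F \<inter> B0. \<bar>f x - a\<bar> < e \<and> (\<forall>j. \<exists>i\<ge>j. Q x i)}"
  have "Measurable.pred borel (\<lambda>x. Q x i)" for i unfolding Q_def by measurable
  then have A_meas[measurable]: "A \<in> sets borel" unfolding A_def by measurable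
  have A0: "emeasure \<mu> A < \<infinity>"
  proof -
    have "emeasure \<mu> A \<le> mu_ball x0 R"
      by (intro emeasure_mono) (auto simp: A_def B0 sets_mu)
    then show ?thesis using fin[of x0 R] by (rule le_less_trans)
  qed
  have N_A: "emeasure N A \<le> ennreal e * emeasure \<mu> A"
  proof -
    have "emeasure N A \<le> (\<integral>\<^sup>+z. ennreal e * indicator A z \<partial>\<mu>)"
      unfolding N_eq[OF A_meas]
    proof (rule nn_integral_mono, goal_cases)
      case (1 z)
      have "w z \<le> ennreal e" if "z \<in> A"
        using that by (simp add: A_def w_def indicator_def ennreal_leI)
      then show ?case by (cases "z \<in> A") auto
    qed
    also have "\<dots> = ennreal e * emeasure \<mu> A" by (simp add: nn_integral_cmult sets_mu)
    finally show ?thesis .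
  qed
  have le: "ennreal (2 * c * e) * emeasure \<mu> A \<le> ennreal c * (ennreal e * emeasure \<mu> A + ennreal h)" if "h > 0" for h
  proof -
    obtain U where U: "open U" "A \<subseteq> U" "emeasure N U \<le> emeasure N A + ennreal h"
      using outer_regular_finite_borel_measure[OF \<open>finite_measure N\<close> setsN A_meas \<open>h > 0\<close>] by blast
    have "ennreal (2 * c * e) * emeasure \<mu> A \<le> ennreal c * emeasure N U"
    proof (rule vitali_bound[OF A_meas _ setsN U(1)])
      fix x assume x: "x \<in> A"
      then obtain r where r: "r > 0" "ball x r \<subseteq> U" using U open_contains_ball by blast
      obtain j where "(1/2::real) ^ j < r" using real_arch_pow_inv[OF r(1), of "1/2"] by auto
      moreover obtain i where i: "i \<ge> j" "Q x i" using x unfolding A_def by blast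
      moreover have "(1/2::real) ^ i \<le> (1/2) ^ j" using i by (intro power_decreasing) auto
      ultimately have "(1/2) ^ i \<le> r" by linarith
      then have "ball x ((1/2) ^ i) \<subseteq> U" using r(2) by (meson order_trans subset_ball)
      then show "\<exists>i. ball x ((1/2) ^ i) \<subseteq> U \<and> ennreal (2 * c * e) * mu_ball x ((1/2) ^ i) \<le> emeasure N (ball x ((1/2) ^ i))"
        using i(2) unfolding Q_def int_ball by (auto intro: less_imp_le)
    qed (auto simp: A_def)
    also have "\<dots> \<le> ennreal c * (ennreal e * emeasure \<mu> A + ennreal h)"
      using U(3) N_A by (intro mult_left_mono order_trans[OF U(3)] add_right_mono) auto
    finally show ?thesis .
  qed
  obtain v where v: "emeasure \<mu> A = ennreal v" "v \<ge> 0" using A0 by (cases "emeasure \<mu> A") auto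
  have "v = 0"
  proof (rule ccontr)
    assume "v \<noteq> 0"
    then have "v > 0" using v by simp
    \<comment> \<open>The error \<open>h = e * v / 2\<close> keeps the right side strictly below the
      left.\<close>
    have "2 * c * e * v \<le> c * (e * v + e * v / 2)"
      using le[of "e * v / 2"] v e c_ge_1 \<open>v > 0\<close> by (simp flip: ennreal_mult ennreal_plus)
    then have "2 * (e * v) \<le> e * v + e * v / 2" using c_ge_1 by (simp add: mult.assoc)
    then show False using mult_pos_pos[OF e \<open>v > 0\<close>] by simp
  qed
  then have "A \<in> null_sets \<mu>" using v by (simp add: null_sets_def sets_mu)
  then have "AE x in \<mu>. x \<notin> A" by (rule AE_not_in)
  then show ?thesis
  proof eventually_elim
    case (elim x)
    have eq: "(\<integral>\<^sup>+z\<in>ball x ((1/2) ^ i). ennreal \<bar>f z - a\<bar> * indicator B0 z \<partial>\<mu>) = emeasure N (ball x ((1/2) ^ i))" for i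
      by (subst N_eq) (auto simp: w_def)
    show ?case
      using elim unfolding eq A_def Q_def int_ball by (auto simp: not_less)
  qed
qed

text \<open>The value \<open>f x\<close> is replaced by a nearby rational and the radius by a power
  of \<open>1 / 2\<close>; this leaves countably many exceptional null sets.\<close>

lemma lebesgue_points:
  assumes f[measurable]: "f \<in> borel_measurable borel"
    and loc: "\<And>x r. (\<integral>\<^sup>+z\<in>ball x r. ennreal \<bar>f z\<bar> \<partial>\<mu>) < \<infinity>"
  shows "AE x in \<mu>. x \<in> F \<longrightarrow> (\<forall>e>0. \<exists>s>0. \<forall>r. 0 < r \<and> r < s \<longrightarrow>
    (\<integral>\<^sup>+z\<in>ball x r. ennreal \<bar>f z - f x\<bar> \<partial>\<mu>) \<le> ennreal e * mu_ball x r)"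
proof -
  fix x0 :: 'a
  define P where "P x n a k \<longleftrightarrow> (x \<in> F \<inter> ball x0 (real n) \<longrightarrow> \<bar>f x - a\<bar> < 1 / real (Suc k) \<longrightarrow>
    (\<exists>j. \<forall>i\<ge>j. (\<integral>\<^sup>+z\<in>ball x ((1/2) ^ i). ennreal \<bar>f z - a\<bar> * indicator (ball x0 (real n)) z \<partial>\<mu>) \<le> ennreal (2 * c * (1 / real (Suc k))) * mu_ball x ((1/2) ^ i)))" for x n a k
  have "AE x in \<mu>. \<forall>n. \<forall>a\<in>\<rat>. \<forall>k. P x n a k"
    unfolding AE_all_countable AE_ball_countable[OF countable_rat] P_def
    by (intro allI ballI differentiation_bad_set_null f loc) auto
  then show ?thesis
  proof eventually_elim
    case (elim x)
    show ?case
    proof (intro impI allI)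
      fix e :: real assume x: "x \<in> F" and e: "e > 0"
      \<comment> \<open>\<open>2 * c\<close> is the threshold of the bad sets, the second
        \<open>c\<close> pays for enlarging the ball to dyadic radius, and 1 accounts for replacing
        \<open>f x\<close> by \<open>a\<close>.\<close>
      define L where "L = 2 * c * c + 1"
      have "L > 0" using c_ge_1 by (simp add: L_def add_pos_pos)
      obtain k where k: "1 / real (Suc k) < e / L"
        using nat_approx_posE[of "e / L"] e \<open>L > 0\<close> by auto
      define h where "h = 1 / real (Suc k)"
      have h: "h > 0" "h * L \<le> e"
        using k \<open>L > 0\<close> unfolding h_def[symmetric] by (simp_all add: pos_less_divide_eq h_def less_imp_le)
      obtain a where a: "a \<in> \<rat>" "f x - h < a" "a < f x + h"
        using Rats_dense_in_real[of "f x - h" "f x + h"] h by auto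
      obtain n where n: "dist x0 x < real n" using reals_Archimedean2 by blast
      have "P x n a k" using elim a by blast
      then obtain j where j: "\<And>i. i \<ge> j \<Longrightarrow> (\<integral>\<^sup>+z\<in>ball x ((1/2) ^ i). ennreal \<bar>f z - a\<bar> * indicator (ball x0 (real n)) z \<partial>\<mu>) \<le> ennreal (2 * c * h) * mu_ball x ((1/2) ^ i)"
        using x n a unfolding P_def h_def[symmetric] by (auto simp: abs_less_iff)
      \<comment> \<open>Keeps the ball inside \<open>ball x0 (real n)\<close>, where the truncated
        integral is the full one.\<close>
      obtain j' where j': "(1/2::real) ^ j' < real n - dist x0 x" using real_arch_pow_inv[of "real n - dist x0 x" "1/2"] n by auto
      show "\<exists>s>0. \<forall>r. 0 < r \<and> r < s \<longrightarrow> (\<integral>\<^sup>+z\<in>ball x r. ennreal \<bar>f z - f x\<bar> \<partial>\<mu>) \<le> ennreal e * mu_ball x r"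
      proof (intro exI[of _ "(1/2) ^ (max j j')"] conjI allI impI; (elim conjE)?)
        fix r :: real assume r: "0 < r" "r < (1/2) ^ max j j'"
        \<comment> \<open>The dyadic bracket is \<open>(1/2) ^ Suc i < r \<le> (1/2) ^ i\<close>; at
          \<open>i = 0\<close> the upper bound holds because \<open>r\<close> is below a power of
          \<open>1 / 2\<close>.\<close>
        define i where "i = (LEAST i. (1/2) ^ Suc i < r)"
        have "\<exists>i. (1/2::real) ^ Suc i < r"
        proof -
          obtain i where "(1/2::real) ^ i < r" using real_arch_pow_inv[OF r(1), of "1/2"] by auto
          moreover have "(1/2::real) ^ Suc i \<le> (1/2) ^ i" by (intro power_decreasing) auto
          ultimately show ?thesis by (intro exI[of _ i]) linarith
        qed
        then have i1: "(1/2) ^ Suc i < r" unfolding i_def by (rule LeastI_ex)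
        have i2: "r \<le> (1/2) ^ i"
        proof (cases i)
          case 0
          have "(1/2::real) ^ max j j' \<le> 1" by (intro power_le_one) auto
          then show ?thesis using r 0 by simp
        next
          case (Suc i')
          have "\<not> (1/2) ^ Suc i' < r" using not_less_Least[of i' "\<lambda>i. (1/2) ^ Suc i < r"] Suc by (simp add: i_def)
          then show ?thesis using Suc by simp
        qed
        have "(1/2::real) ^ Suc i < (1/2) ^ max j j'" using i1 r(2) by linarith
        then have "max j j' < Suc i" by (subst (asm) power_strict_decreasing_iff) auto
        then have i3: "i \<ge> j" "i \<ge> j'" by auto
        have i4: "(1/2::real) ^ i < real n - dist x0 x" 
          by (rule le_less_trans[OF power_decreasing[OF i3(2)] j']) auto
        have sub: "z \<in> ball x0 (real n)" if "z \<in> ball x r" for z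
          using that i2 i4 dist_triangle[of x0 z x] by simp
        have "(\<integral>\<^sup>+z\<in>ball x r. ennreal \<bar>f z - f x\<bar> \<partial>\<mu>) \<le> (\<integral>\<^sup>+z. ennreal \<bar>f z - a\<bar> * indicator (ball x0 (real n)) z * indicator (ball x ((1/2) ^ i)) z + ennreal h * indicator (ball x r) z \<partial>\<mu>)"
        proof (intro nn_integral_mono)
          fix z
          have "\<bar>f z - f x\<bar> \<le> \<bar>f z - a\<bar> + h" using a by linarith
          then have "ennreal \<bar>f z - f x\<bar> \<le> ennreal \<bar>f z - a\<bar> + ennreal h" 
            using h by (simp flip: ennreal_plus add: ennreal_leI)
          then show "ennreal \<bar>f z - f x\<bar> * indicator (ball x r) z \<le> ennreal \<bar>f z - a\<bar> * indicator (ball x0 (real n)) z * indicator (ball x ((1/2) ^ i)) z + ennreal h * indicator (ball x r) z"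
            using sub[of z] i2 by (cases "z \<in> ball x r") (auto simp: indicator_def)
        qed
        also have "\<dots> = (\<integral>\<^sup>+z\<in>ball x ((1/2) ^ i). ennreal \<bar>f z - a\<bar> * indicator (ball x0 (real n)) z \<partial>\<mu>) + ennreal h * mu_ball x r"
          by (subst nn_integral_add) (auto simp: nn_integral_cmult sets_mu)
        also have "\<dots> \<le> ennreal (2 * c * h) * mu_ball x ((1/2) ^ i) + ennreal h * mu_ball x r"
          by (intro add_right_mono j i3)
        also have "\<dots> \<le> ennreal (2 * c * h) * (ennreal c * mu_ball x r) + ennreal h * mu_ball x r"
        proof (intro add_right_mono mult_left_mono)
          have "mu_ball x ((1/2) ^ i) \<le> mu_ball x (2 * r)"
            using i1 by (intro emeasure_mono subset_ball) (auto simp: sets_mu)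
          also have "\<dots> \<le> ennreal c * mu_ball x r" using x r by (intro dbl)
          finally show "mu_ball x ((1/2) ^ i) \<le> ennreal c * mu_ball x r" .
        qed auto
        also have "\<dots> = ennreal (h * L) * mu_ball x r"
        proof -
          have "h * L = 2 * c * h * c + h" by (simp add: L_def algebra_simps)
          then show ?thesis using h c_ge_1 by (simp add: ennreal_mult ennreal_plus distrib_right mult.assoc)
        qed
        also have "\<dots> \<le> ennreal e * mu_ball x r"
          using h by (intro mult_right_mono ennreal_leI) auto
        finally show "(\<integral>\<^sup>+z\<in>ball x r. ennreal \<bar>f z - f x\<bar> \<partial>\<mu>) \<le> ennreal e * mu_ball x r" .
      qed auto
    qed
  qed
qed

end

section \<open>The averaging kernel\<close>

text \<open>Both measures are Borel here; a given measure on a larger sigma-algebra is replaced by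
  its Borel restriction before this setting is entered. One constant \<open>c\<close> serves both
  doubling conditions.\<close>

locale trace_setting = doubling_on D \<mu> F c
  for D :: "'a::metric_space set" and \<mu> :: "'a measure" and F :: "'a set" and c :: real +
  fixes m :: "'a measure"
  assumes sets_m [measurable_cong]: "sets m = sets borel"
    and m_pos: "\<And>x r. r > 0 \<Longrightarrow> 0 < emeasure m (ball x r)"
    and m_fin: "\<And>x r. emeasure m (ball x r) < \<infinity>"
    and m_dbl: "\<And>x r. r > 0 \<Longrightarrow> emeasure m (ball x (2 * r)) \<le> ennreal c * emeasure m (ball x r)"
    and m_F: "emeasure m F = 0"
begin

abbreviation "m_ball x r \<equiv> emeasure m (ball x r)"

lemma space_m [simp]: "space m = UNIV"
  using sets_eq_imp_space_eq[OF sets_m] by simp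

lemma sigma_finite_m: "sigma_finite_measure m"
  by (rule sigma_finite_measure_balls[OF sets_m m_fin])

sublocale m: sigma_finite_measure m by (rule sigma_finite_m)

sublocale m_mu: pair_sigma_finite m \<mu> ..

sublocale m_m: pair_sigma_finite m m ..

lemma measurable_m_ball [measurable]:
  "a \<in> measurable K borel \<Longrightarrow> g \<in> borel_measurable K \<Longrightarrow> (\<lambda>x. m_ball (a x) (g x)) \<in> borel_measurable K"
  by (rule measurable_emeasure_ball[OF sigma_finite_m sets_m])

lemma m_doubling_iterate:
  "r > 0 \<Longrightarrow> m_ball x (2 ^ k * r) \<le> ennreal (c ^ k) * m_ball x r"
  using m_dbl c_ge_1 by (intro doubling_iterate) auto

lemma AE_m_notin_F: "AE x in m. x \<notin> F"
  using m_F by (intro AE_I[of _ _ F]) (auto simp: sets_m)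

lemma infdist_pos: "x \<notin> F \<Longrightarrow> 0 < infdist x F"
  using closed_F F_ne infdist_nonneg[of x F] in_closed_iff_infdist_zero[of F x] by force

lemma infdist_pos_iff: "0 < infdist x F \<longleftrightarrow> x \<notin> F"
  using infdist_pos by auto

text \<open>The infimum need not be attained, since closed balls need not be compact. With
  \<open>d = infdist x F\<close>, the factor \<open>3 / 2\<close> leaves room for a ball of radius
  \<open>d / 2\<close> about the point found inside the ball of radius \<open>2 * d\<close> about
  \<open>x\<close>.\<close>

lemma near_point: "x \<notin> F \<Longrightarrow> \<exists>y\<in>F. dist x y < 3 / 2 * infdist x F"
proof -
  assume "x \<notin> F"
  then have "infdist x F < 3 / 2 * infdist x F" using infdist_pos[of x] by simp
  then have "(INF y\<in>F. dist x y) < 3 / 2 * infdist x F" by (simp add: infdist_notempty[OF F_ne])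
  then show ?thesis by (subst (asm) cINF_less_iff) (auto intro: F_ne bdd_belowI[of _ 0] simp: F_ne)
qed

lemma infdist_diff_le: "\<bar>infdist x F - infdist y F\<bar> \<le> dist x y"
  using infdist_triangle[of x F y] infdist_triangle[of y F x] by (simp add: dist_commute abs_le_iff)

section \<open>Volumes at the scale of the distance to F\<close>

text \<open>Radius 2 rather than 1: the ball must contain a ball centered in \<open>F\<close> of
  radius comparable to \<open>infdist x F\<close>, since \<open>\<mu>\<close> is doubling only at
  such centers.\<close>

definition vol :: "'a \<Rightarrow> ennreal"
  where "vol x = mu_ball x (2 * infdist x F)"

lemma measurable_vol [measurable]:
  assumes [measurable]: "g \<in> measurable K borel"
  shows "(\<lambda>x. vol (g x)) \<in> borel_measurable K"
  unfolding vol_def by measurable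

lemma ball_subsetI: "dist x y + r \<le> s \<Longrightarrow> ball y r \<subseteq> ball x s"
  for x y :: 'a
proof
  fix z assume "dist x y + r \<le> s" "z \<in> ball y r"
  then show "z \<in> ball x s" using dist_triangle[of x z y] by simp
qed

text \<open>With \<open>d = infdist x F\<close> and \<open>z\<close> a nearby point of
  \<open>F\<close>, the ball of radius \<open>16 * d\<close> about \<open>x\<close> lies in the one
  of radius \<open>32 * d\<close> about \<open>z\<close>, while the ball of radius
  \<open>d / 2\<close> about \<open>z\<close> lies in the one that defines \<open>vol x\<close>: six
  doublings in between.\<close>

lemma vol_ge: 
  assumes "x \<notin> F" and "ball y r \<subseteq> ball x (16 * infdist x F)"
  shows "mu_ball y r \<le> ennreal (c ^ 6) * vol x"
proof -
  define d where "d = infdist x F"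
  have "d > 0" using infdist_pos[OF assms(1)] by (simp add: d_def)
  obtain z where z: "z \<in> F" "dist x z < 3 / 2 * d" using near_point[OF assms(1)] by (auto simp: d_def)
  have "ball y r \<subseteq> ball z (2 ^ 6 * (d / 2))"
    by (rule order_trans[OF assms(2)[folded d_def]], rule ball_subsetI) (use z \<open>d > 0\<close> in \<open>simp add: dist_commute\<close>)
  then have "mu_ball y r \<le> mu_ball z (2 ^ 6 * (d / 2))"
    by (intro emeasure_mono) (auto simp: sets_mu)
  also have "\<dots> \<le> ennreal (c ^ 6) * mu_ball z (d / 2)"
    using z \<open>d > 0\<close> by (intro mu_doubling_iterate) auto
  also have "\<dots> \<le> ennreal (c ^ 6) * vol x"
    unfolding vol_def d_def[symmetric] using z \<open>d > 0\<close>
    by (intro mult_left_mono emeasure_mono ball_subsetI) (auto simp: sets_mu)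
  finally show ?thesis .
qed

lemma vol_pos: "x \<notin> F \<Longrightarrow> vol x > 0"
proof -
  assume x: "x \<notin> F"
  obtain z where z: "z \<in> F" "dist x z < 3 / 2 * infdist x F" using near_point[OF x] by auto
  have "0 < mu_ball z (infdist x F / 2)" using z infdist_pos[OF x] by (intro pos) auto
  also have "\<dots> \<le> vol x"
    unfolding vol_def using z by (intro emeasure_mono ball_subsetI) (auto simp: sets_mu)
  finally show ?thesis .
qed

lemma vol_fin: "vol x < \<infinity>"
  unfolding vol_def by (rule fin)

text \<open>Radius 4 instead of 3, so that the same kernel also dominates the difference of the averages at
  two points whose distance is at most \<open>d(x, F) / 4\<close>.\<close>
definition ker :: "'a \<Rightarrow> 'a \<Rightarrow> ennreal"
  where "ker x z = (if dist x z < 4 * infdist x F then inverse (vol x) else 0)"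

lemma measurable_ker [measurable]:
  assumes [measurable]: "f \<in> measurable K borel" "g \<in> measurable K borel"
  shows "(\<lambda>x. ker (f x) (g x)) \<in> borel_measurable K"
  unfolding ker_def by measurable

lemma ker_mass: 
  assumes "x \<notin> F"
  shows "(\<integral>\<^sup>+z. ker x z \<partial>\<mu>) \<le> ennreal (c ^ 6)"
proof -
  have "(\<integral>\<^sup>+z. ker x z \<partial>\<mu>) = (\<integral>\<^sup>+z. inverse (vol x) * indicator (ball x (4 * infdist x F)) z \<partial>\<mu>)"
    by (intro nn_integral_cong) (simp add: ker_def indicator_def)
  also have "\<dots> = inverse (vol x) * mu_ball x (4 * infdist x F)"
    by (rule nn_integral_cmult_indicator) (simp add: sets_mu)
  also have "\<dots> \<le> inverse (vol x) * (ennreal (c ^ 6) * vol x)"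
    using infdist_nonneg[of x F] by (intro mult_left_mono vol_ge assms subset_ball) auto
  also have "\<dots> = ennreal (c ^ 6)"
    using ennreal_divide_times[of 1 "vol x" "vol x"] vol_pos[OF assms] vol_fin[of x]
    by (simp add: ac_simps ennreal_divide_times divide_ennreal_def[symmetric])
       (metis ennreal_divide_self less_numeral_extra(3) mult.commute mult.right_neutral top.not_eq_extremum ennreal_times_divide divide_ennreal_def)
  finally show ?thesis .
qed

section \<open>The Lipschitz average of f\<close>

text \<open>The plateau up to \<open>2 * infdist x F\<close> bounds the weight below by
  \<open>vol x\<close>; support within \<open>3 * infdist x F\<close> leaves room below the radius 4
  of \<open>ker\<close>. For \<open>x \<in> F\<close> division by 0 makes it constantly 1, and such
  \<open>x\<close> are kept out of the estimates.\<close>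

definition phi :: "'a \<Rightarrow> 'a \<Rightarrow> real"
  where "phi x z = max 0 (min 1 (3 - dist x z / infdist x F))"

definition weight :: "'a \<Rightarrow> real"
  where "weight x = (\<integral>z. phi x z \<partial>\<mu>)"

definition E0 :: "('a \<Rightarrow> real) \<Rightarrow> 'a \<Rightarrow> real"
  where "E0 f x = (\<integral>z. phi x z * f z \<partial>\<mu>) / weight x"

text \<open>The class of functions on the whole space in which the estimates are carried out; a
  function on \<open>F\<close> enters it after extension by 0.\<close>

definition locint :: "('a \<Rightarrow> real) \<Rightarrow> bool"
  where "locint f \<longleftrightarrow> f \<in> borel_measurable borel \<and> (\<forall>x r. (\<integral>\<^sup>+z\<in>ball x r. ennreal \<bar>f z\<bar> \<partial>\<mu>) < \<infinity>)"

lemma locint_measurable [measurable_dest]: "locint f \<Longrightarrow> f \<in> borel_measurable borel"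
  by (simp add: locint_def)

lemma locint_const: "locint (\<lambda>_. a)"
  unfolding locint_def using fin by (auto simp: nn_integral_cmult_indicator sets_mu ennreal_mult_less_top)

lemma phi_measurable [measurable]:
  assumes [measurable]: "f \<in> measurable K borel" "g \<in> measurable K borel"
  shows "(\<lambda>x. phi (f x) (g x)) \<in> borel_measurable K"
  unfolding phi_def by measurable

lemma phi_bounds: "0 \<le> phi x z" "phi x z \<le> 1"
  by (auto simp: phi_def)

lemma phi_eq_0: "x \<notin> F \<Longrightarrow> 3 * infdist x F \<le> dist x z \<Longrightarrow> phi x z = 0"
  using infdist_pos[of x] by (simp add: phi_def field_simps)

lemma phi_eq_1: "x \<notin> F \<Longrightarrow> dist x z \<le> 2 * infdist x F \<Longrightarrow> phi x z = 1"
  using infdist_pos[of x] by (simp add: phi_def field_simps)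

lemma integrable_bounded_support:
  assumes f: "locint f" and [measurable]: "(g :: 'a \<Rightarrow> real) \<in> borel_measurable borel"
    and g: "\<And>z. \<bar>g z\<bar> \<le> 1" "\<And>z. r \<le> dist (x :: 'a) z \<Longrightarrow> g z = 0"
  shows "integrable \<mu> (\<lambda>z. g z * f z)"
proof (rule integrableI_bounded)
  note [measurable] = locint_measurable[OF f]
  show "(\<lambda>z. g z * f z) \<in> borel_measurable \<mu>" by measurable
  have "(\<integral>\<^sup>+z. ennreal (norm (g z * f z)) \<partial>\<mu>) \<le> (\<integral>\<^sup>+z\<in>ball x r. ennreal \<bar>f z\<bar> \<partial>\<mu>)"
  proof (rule nn_integral_mono, goal_cases)
    case (1 z)
    show ?case
      using g(1)[of z] g(2)[of z] 
      by (cases "dist x z < r") (auto simp: abs_mult intro!: ennreal_leI mult_left_le_one_le)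
  qed
  also have "\<dots> < \<infinity>" using f by (simp add: locint_def)
  finally show "(\<integral>\<^sup>+z. ennreal (norm (g z * f z)) \<partial>\<mu>) < \<infinity>" .
qed

lemma integrable_phi: "locint f \<Longrightarrow> x \<notin> F \<Longrightarrow> integrable \<mu> (\<lambda>z. phi x z * f z)"
  using phi_bounds[of x] phi_eq_0[of x]
  by (intro integrable_bounded_support[where x = x and r = "3 * infdist x F"]) auto

lemma vol_le_weight: 
  assumes x: "x \<notin> F" shows "vol x \<le> ennreal (weight x)"
proof -
  have i: "integrable \<mu> (\<lambda>z. phi x z)" using integrable_phi[OF locint_const[of 1] x] by simp
  have "vol x = (\<integral>\<^sup>+z. indicator (ball x (2 * infdist x F)) z \<partial>\<mu>)"
    unfolding vol_def by (simp add: sets_mu)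
  also have "\<dots> \<le> (\<integral>\<^sup>+z. ennreal (phi x z) \<partial>\<mu>)"
    using phi_eq_1[OF x] phi_bounds by (intro nn_integral_mono) (auto simp: indicator_def)
  also have "\<dots> = ennreal (weight x)"
    unfolding weight_def using phi_bounds by (intro nn_integral_eq_integral i) auto
  finally show ?thesis .
qed

lemma weight_pos: "x \<notin> F \<Longrightarrow> weight x > 0"
  using vol_le_weight[of x] vol_pos[of x] by (metis ennreal_0 ennreal_leI leD le_less_trans not_less order_less_le_trans)

text \<open>An average reproduces constants; all oscillation estimates start from this freedom in
  \<open>a\<close>.\<close>

lemma E0_diff:
  assumes f: "locint f" and x: "x \<notin> F"
  shows "E0 f x - a = (\<integral>z. phi x z * (f z - a) \<partial>\<mu>) / weight x"
    and "integrable \<mu> (\<lambda>z. phi x z * (f z - a))"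
proof -
  have i: "integrable \<mu> (\<lambda>z. phi x z * f z)" "integrable \<mu> (\<lambda>z. phi x z * a)"
    by (intro integrable_phi f x locint_const)+
  have "(\<integral>z. phi x z * (f z - a) \<partial>\<mu>) = (\<integral>z. phi x z * f z \<partial>\<mu>) - weight x * a"
    using i by (simp add: right_diff_distrib weight_def)
  then show "E0 f x - a = (\<integral>z. phi x z * (f z - a) \<partial>\<mu>) / weight x"
    using weight_pos[OF x] by (simp add: E0_def field_simps)
  show "integrable \<mu> (\<lambda>z. phi x z * (f z - a))"
    using i by (simp add: right_diff_distrib)
qed

lemma inverse_weight_le: "x \<notin> F \<Longrightarrow> ennreal (1 / weight x) \<le> inverse (vol x)"
  using ennreal_inverse_le_mult[of "vol x" 1 "ennreal (weight x)"] vol_le_weight[of x] weight_pos[of x]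
  by (simp add: inverse_ennreal inverse_eq_divide)

lemma E0_le:
  assumes f: "locint f" and x: "x \<notin> F"
  shows "ennreal \<bar>E0 f x - a\<bar> \<le> (\<integral>\<^sup>+z. ker x z * ennreal \<bar>f z - a\<bar> \<partial>\<mu>)"
proof -
  note [measurable] = locint_measurable[OF f]
  have "ennreal \<bar>E0 f x - a\<bar> = ennreal (1 / weight x) * ennreal (norm (\<integral>z. phi x z * (f z - a) \<partial>\<mu>))"
    using weight_pos[OF x] by (simp add: E0_diff[OF f x] abs_div flip: ennreal_mult)
  also have "\<dots> \<le> inverse (vol x) * (\<integral>\<^sup>+z. ennreal (norm (phi x z * (f z - a))) \<partial>\<mu>)"
    using E0_diff(2)[OF f x] by (intro mult_mono inverse_weight_le x integral_norm_bound_ennreal) auto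
  also have "\<dots> = (\<integral>\<^sup>+z. inverse (vol x) * ennreal (norm (phi x z * (f z - a))) \<partial>\<mu>)"
    by (simp add: nn_integral_cmult)
  also have "\<dots> \<le> (\<integral>\<^sup>+z. ker x z * ennreal \<bar>f z - a\<bar> \<partial>\<mu>)"
  proof (rule nn_integral_mono, goal_cases)
    case (1 z)
    have "norm (phi x z * (f z - a)) \<le> \<bar>f z - a\<bar>"
      using phi_bounds[of x z] by (auto simp: abs_mult intro: mult_left_le_one_le)
    moreover have "phi x z = 0" if "\<not> dist x z < 4 * infdist x F"
      using that infdist_pos[OF x] by (intro phi_eq_0 x) simp
    ultimately show ?case
      by (cases "dist x z < 4 * infdist x F") (auto simp: ker_def intro!: mult_left_mono ennreal_leI)
  qed
  finally show ?thesis .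
qed

text \<open>The distance to \<open>z\<close> and the scale \<open>infdist\<close> both vary by at
  most \<open>dist x y\<close>. With \<open>d = infdist x F\<close>,
  \<open>infdist y F \<ge> 3 / 4 * d\<close> and \<open>dist y z \<le> 17 / 4 * d\<close>, the two
  effects add up to \<open>1 + (17 / 4) / (3 / 4) = 20 / 3 \<le> 7\<close> times
  \<open>dist x y / d\<close>.\<close>

lemma phi_diff:
  assumes x: "x \<notin> F" and xy: "dist x y \<le> infdist x F / 4"
  shows "\<bar>phi y z - phi x z\<bar> \<le> (if dist x z < 4 * infdist x F then 7 * dist x y / infdist x F else 0)"
proof -
  define d e t where "d = infdist x F" and "e = infdist y F" and "t = dist x y"
  have d: "d > 0" using infdist_pos[OF x] by (simp add: d_def)
  have de: "\<bar>d - e\<bar> \<le> t" using infdist_diff_le[of x y] by (simp add: d_def e_def t_def)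
  have t: "t \<le> d / 4" "t \<ge> 0" using xy by (auto simp: t_def d_def)
  have e: "e \<ge> 3 / 4 * d" "e \<le> 5 / 4 * d" using de t by auto
  have y: "y \<notin> F" using e(1) d infdist_pos_iff[of y] by (simp add: e_def)
  show ?thesis
  proof (cases "dist x z < 4 * d")
    case False
    \<comment> \<open>\<open>4 - 1 / 4 = 3 * (5 / 4)\<close>: radius 4 is what makes
      \<open>phi y z\<close> vanish here as well.\<close>
    then have "3 * d \<le> dist x z" "3 * e \<le> dist y z"
      using d e t dist_triangle[of x z y] by (auto simp: t_def)
    then have "phi x z = 0" "phi y z = 0"
      using phi_eq_0[OF x] phi_eq_0[OF y] by (auto simp: d_def e_def)
    then show ?thesis using d t by (simp add: d_def t_def)
  next
    case True
    have tri: "\<bar>dist x z - dist y z\<bar> \<le> t"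
      using dist_triangle[of x z y] dist_triangle[of y z x] by (simp add: t_def dist_commute abs_le_iff)
    then have yz: "dist y z \<le> 17 / 4 * d" using True t by linarith
    have "\<bar>phi y z - phi x z\<bar> \<le> \<bar>dist y z / e - dist x z / d\<bar>"
    proof -
      have "\<bar>max 0 (min 1 (3 - u)) - max 0 (min 1 (3 - v))\<bar> \<le> \<bar>u - v\<bar>" for u v :: real
        by (auto simp: max_def min_def abs_real_def)
      then show ?thesis by (simp add: phi_def d_def[symmetric] e_def[symmetric])
    qed
    also have "dist y z / e - dist x z / d = (dist y z - dist x z) / d + dist y z * (d - e) / (d * e)"
      using d e by (simp add: field_simps)
    also have "\<bar>\<dots>\<bar> \<le> t / d + (17 / 4 * d) * t / (d * (3 / 4 * d))"
    proof (rule order_trans[OF abs_triangle_ineq add_mono])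
      show "\<bar>(dist y z - dist x z) / d\<bar> \<le> t / d" using tri d by (simp add: abs_divide abs_minus_commute divide_right_mono)
      have "\<bar>dist y z * (d - e) / (d * e)\<bar> = dist y z * \<bar>d - e\<bar> / (d * e)" using d e by (simp add: abs_mult)
      also have "\<dots> \<le> (17 / 4 * d) * t / (d * (3 / 4 * d))"
        using yz de d e t by (intro frac_le mult_mono) auto
      finally show "\<bar>dist y z * (d - e) / (d * e)\<bar> \<le> (17 / 4 * d) * t / (d * (3 / 4 * d))" .
    qed
    also have "\<dots> \<le> 7 * t / d" using d t by (simp add: field_simps)
    finally show ?thesis using True by (simp add: d_def t_def)
  qed
qed

lemma vol_le_vol:
  assumes x: "x \<notin> F" and xy: "dist x y \<le> infdist x F / 4"
  shows "y \<notin> F" "vol x \<le> ennreal (c ^ 6) * vol y"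
proof -
  have d: "infdist x F > 0" using infdist_pos[OF x] .
  have e: "infdist y F \<ge> 3 / 4 * infdist x F"
    using infdist_diff_le[of x y] xy by linarith
  show y: "y \<notin> F" using e d infdist_pos_iff[of y] by simp
  show "vol x \<le> ennreal (c ^ 6) * vol y"
    unfolding vol_def[of x] using xy e infdist_nonneg[of y F] by (intro vol_ge y ball_subsetI) (simp add: dist_commute)
qed

lemma E0_lip:
  assumes f: "locint f" and x: "x \<notin> F" and xy: "dist x y \<le> infdist x F / 4"
  shows "ennreal \<bar>E0 f y - E0 f x\<bar> \<le> ennreal (7 * c ^ 6 * (dist x y / infdist x F)) * (\<integral>\<^sup>+z. ker x z * ennreal \<bar>f z - E0 f x\<bar> \<partial>\<mu>)"
proof -
  note [measurable] = locint_measurable[OF f]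
  define a where "a = E0 f x"
  define q where "q = 7 * dist x y / infdist x F"
  have q: "q \<ge> 0" by (simp add: q_def infdist_nonneg)
  note y = vol_le_vol(1)[OF x xy]
  \<comment> \<open>Subtracting the value at \<open>x\<close> makes the \<open>x\<close>-average vanish, so only the kernel difference remains.\<close>
  have "(\<integral>z. phi x z * (f z - a) \<partial>\<mu>) = 0"
    using E0_diff(1)[OF f x, of a] weight_pos[OF x] by (simp add: a_def)
  then have eq: "(\<integral>z. phi y z * (f z - a) \<partial>\<mu>) = (\<integral>z. (phi y z - phi x z) * (f z - a) \<partial>\<mu>)"
    using E0_diff(2)[OF f x, of a] E0_diff(2)[OF f y, of a] by (simp add: left_diff_distrib)
  have int: "integrable \<mu> (\<lambda>z. (phi y z - phi x z) * (f z - a))"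
    using E0_diff(2)[OF f x, of a] E0_diff(2)[OF f y, of a] by (simp add: left_diff_distrib)
  have "ennreal \<bar>E0 f y - a\<bar> = ennreal (1 / weight y) * ennreal (norm (\<integral>z. (phi y z - phi x z) * (f z - a) \<partial>\<mu>))"
    using weight_pos[OF y] by (simp add: E0_diff[OF f y] abs_div eq flip: ennreal_mult)
  also have "\<dots> \<le> (ennreal (c ^ 6) * inverse (vol x)) * (\<integral>\<^sup>+z. ennreal (norm ((phi y z - phi x z) * (f z - a))) \<partial>\<mu>)"
  proof (intro mult_mono integral_norm_bound_ennreal int)
    have "inverse (vol y) \<le> ennreal (c ^ 6) * inverse (vol x)"
      using vol_le_vol(2)[OF x xy] c_ge_1 by (intro ennreal_inverse_le_mult) auto
    then show "ennreal (1 / weight y) \<le> ennreal (c ^ 6) * inverse (vol x)"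
      using inverse_weight_le[OF y] by (rule order_trans[rotated])
  qed auto
  also have "\<dots> = ennreal (c ^ 6) * (\<integral>\<^sup>+z. inverse (vol x) * ennreal (norm ((phi y z - phi x z) * (f z - a))) \<partial>\<mu>)"
    by (simp add: nn_integral_cmult mult.assoc)
  also have "\<dots> \<le> ennreal (c ^ 6) * (\<integral>\<^sup>+z. ennreal q * (ker x z * ennreal \<bar>f z - a\<bar>) \<partial>\<mu>)"
  proof (intro mult_left_mono nn_integral_mono)
    fix z
    have "\<bar>(phi y z - phi x z) * (f z - a)\<bar> \<le> (if dist x z < 4 * infdist x F then q else 0) * \<bar>f z - a\<bar>"
      unfolding abs_mult q_def by (intro mult_right_mono phi_diff x xy) auto
    then have "ennreal (norm ((phi y z - phi x z) * (f z - a))) \<le> (if dist x z < 4 * infdist x F then ennreal q * ennreal \<bar>f z - a\<bar> else 0)"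
      using q by (auto simp: ennreal_leI simp flip: ennreal_mult)
    then have "inverse (vol x) * ennreal (norm ((phi y z - phi x z) * (f z - a))) \<le> inverse (vol x) * (if dist x z < 4 * infdist x F then ennreal q * ennreal \<bar>f z - a\<bar> else 0)"
      by (intro mult_left_mono) auto
    also have "\<dots> = ennreal q * (ker x z * ennreal \<bar>f z - a\<bar>)" by (simp add: ker_def ac_simps)
    finally show "inverse (vol x) * ennreal (norm ((phi y z - phi x z) * (f z - a))) \<le> ennreal q * (ker x z * ennreal \<bar>f z - a\<bar>)" .
  qed auto
  also have "\<dots> = ennreal (c ^ 6 * q) * (\<integral>\<^sup>+z. ker x z * ennreal \<bar>f z - a\<bar> \<partial>\<mu>)"
    using q c_ge_1 by (simp add: nn_integral_cmult ennreal_mult mult.assoc)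
  also have "c ^ 6 * q = 7 * c ^ 6 * (dist x y / infdist x F)" by (simp add: q_def)
  finally show ?thesis by (simp add: a_def)
qed

lemma E0_pow:
  assumes f: "locint f" and x: "x \<notin> F" and p: "p \<ge> 1"
  shows "ennreal (\<bar>E0 f x - a\<bar> powr p) \<le> ennreal ((c ^ 6) powr p) * (\<integral>\<^sup>+z. ker x z * ennreal (\<bar>f z - a\<bar> powr p) \<partial>\<mu>)"
proof -
  note [measurable] = locint_measurable[OF f]
  show ?thesis
    using c_ge_1 by (intro jensen_powr p E0_le f x ker_mass) auto
qed

text \<open>Jensen is used twice: for the average of \<open>|f z - E0 f x|\<close> over
  \<open>z\<close>, and again because \<open>E0 f x\<close> is itself an average over
  \<open>w\<close>. The exponent 18 collects \<open>c ^ 6\<close> from the change of normalisation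
  between \<open>x\<close> and \<open>y\<close> and \<open>c ^ 6\<close> from each use of
  Jensen.\<close>

lemma E0_lip_pow:
  assumes f: "locint f" and x: "x \<notin> F" and xy: "dist x y \<le> infdist x F / 4" and p: "p \<ge> 1"
  shows "ennreal (\<bar>E0 f y - E0 f x\<bar> powr p) \<le> ennreal ((7 * c ^ 18 * (dist x y / infdist x F)) powr p) *
    (\<integral>\<^sup>+z. \<integral>\<^sup>+w. ker x z * ker x w * ennreal (\<bar>f w - f z\<bar> powr p) \<partial>\<mu> \<partial>\<mu>)"
proof -
  note [measurable] = locint_measurable[OF f]
  define b where "b = 7 * c ^ 6 * (dist x y / infdist x F)"
  have b0: "b \<ge> 0" using c_ge_1 by (simp add: b_def infdist_nonneg)
  define r where "r = \<bar>E0 f y - E0 f x\<bar>"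
  define X where "X = (\<integral>\<^sup>+z. ker x z * ennreal \<bar>f z - E0 f x\<bar> \<partial>\<mu>)"
  define Z where "Z = (\<integral>\<^sup>+z. \<integral>\<^sup>+w. ker x z * ker x w * ennreal (\<bar>f w - f z\<bar> powr p) \<partial>\<mu> \<partial>\<mu>)"
  have rX: "ennreal r \<le> ennreal b * X" using E0_lip[OF f x xy] by (simp add: r_def b_def X_def)
  have "ennreal (r powr p) \<le> ennreal (b powr p) * (ennreal ((c ^ 6) powr p) * (\<integral>\<^sup>+z. ker x z * ennreal (\<bar>f z - E0 f x\<bar> powr p) \<partial>\<mu>))"
  \<comment> \<open>\<open>b = 0\<close> means \<open>x = y\<close>; otherwise the inequality is
    divided by \<open>b\<close> so that Jensen applies to \<open>r / b\<close>.\<close>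
  proof (cases "b = 0")
    case True
    then have "r = 0" using rX by (auto simp: r_def)
    then show ?thesis by simp
  next
    case False
    then have b: "b > 0" using b0 by simp
    have "ennreal (r / b) = ennreal (1 / b) * ennreal r" using b by (simp add: r_def flip: ennreal_mult)
    also have "\<dots> \<le> ennreal (1 / b) * (ennreal b * X)" by (intro mult_left_mono rX) auto
    also have "\<dots> = X" using b by (simp add: mult.assoc[symmetric] flip: ennreal_mult)
    finally have "ennreal ((r / b) powr p) \<le> ennreal ((c ^ 6) powr p) * (\<integral>\<^sup>+z. ker x z * ennreal (\<bar>f z - E0 f x\<bar> powr p) \<partial>\<mu>)"
      unfolding X_def using c_ge_1 b by (intro jensen_powr p ker_mass x) (auto simp: r_def)
    then have "ennreal (b powr p) * ennreal ((r / b) powr p) \<le> ennreal (b powr p) * (ennreal ((c ^ 6) powr p) * (\<integral>\<^sup>+z. ker x z * ennreal (\<bar>f z - E0 f x\<bar> powr p) \<partial>\<mu>))"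
      by (intro mult_left_mono) auto
    moreover have "b powr p * (r / b) powr p = r powr p"
      using b by (simp add: powr_divide r_def)
    ultimately show ?thesis by (simp flip: ennreal_mult)
  qed
  also have "\<dots> \<le> ennreal (b powr p) * (ennreal ((c ^ 6) powr p) * (\<integral>\<^sup>+z. ker x z * (ennreal ((c ^ 6) powr p) * (\<integral>\<^sup>+w. ker x w * ennreal (\<bar>f w - f z\<bar> powr p) \<partial>\<mu>)) \<partial>\<mu>))"
    using E0_pow[OF f x p] by (intro mult_left_mono nn_integral_mono) (auto simp: abs_minus_commute)
  also have "\<dots> = ennreal (b powr p) * (ennreal ((c ^ 6) powr p) * (ennreal ((c ^ 6) powr p) * Z))"
    unfolding Z_def by (subst nn_integral_cmult[symmetric], measurable)
       (auto simp: nn_integral_cmult[symmetric] ac_simps intro!: arg_cong2[where f="(*)"] nn_integral_cong)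
  also have "\<dots> = ennreal ((7 * c ^ 18 * (dist x y / infdist x F)) powr p) * Z"
  proof -
    have "b powr p * (k powr p * k powr p) = (b * (k * k)) powr p" if "k \<ge> 0" for k
      using b0 that by (simp add: powr_mult)
    from this[of "c ^ 6"] have "b powr p * ((c ^ 6) powr p * (c ^ 6) powr p) = (b * (c ^ 6 * c ^ 6)) powr p"
      using c_ge_1 by simp
    also have "b * (c ^ 6 * c ^ 6) = 7 * c ^ 18 * (dist x y / infdist x F)"
      by (simp add: b_def flip: power_add)
    finally have "(7 * c ^ 18 * (dist x y / infdist x F)) powr p = b powr p * ((c ^ 6) powr p * (c ^ 6) powr p)" ..
    then show ?thesis by (simp add: ennreal_mult mult.assoc)
  qed
  finally show ?thesis by (simp add: r_def Z_def)
qed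

text \<open>Since the kernel average of \<open>|f - E0 f x|\<close> is finite, the local Lipschitz
  estimate makes \<open>E0 f\<close> continuous on the open complement of \<open>F\<close>.\<close>

lemma E0_measurable:
  assumes f: "locint f"
  shows "(\<lambda>x. if x \<in> F then 0 else E0 f x) \<in> borel_measurable borel"
proof -
  have "continuous_on (- F) (E0 f)"
  proof (subst continuous_on_def, intro ballI)
    fix x assume "x \<in> - F"
    then have x: "x \<notin> F" by simp
    note [measurable] = locint_measurable[OF f]
    define X where "X = (\<integral>\<^sup>+z. ker x z * ennreal \<bar>f z - E0 f x\<bar> \<partial>\<mu>)"
    have "X < \<infinity>"
    proof -
      have "X = (\<integral>\<^sup>+z. inverse (vol x) * ennreal (norm (indicator (ball x (4 * infdist x F)) z * (f z - E0 f x))) \<partial>\<mu>)"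
        unfolding X_def by (intro nn_integral_cong) (auto simp: ker_def indicator_def)
      also have "\<dots> = inverse (vol x) * (\<integral>\<^sup>+z. ennreal (norm (indicator (ball x (4 * infdist x F)) z * (f z - E0 f x))) \<partial>\<mu>)"
        by (intro nn_integral_cmult) measurable
      also have "\<dots> < \<infinity>"
      proof -
        have "integrable \<mu> (\<lambda>z. indicator (ball x (4 * infdist x F)) z * f z - indicator (ball x (4 * infdist x F)) z * E0 f x)"
          by (intro Bochner_Integration.integrable_diff integrable_bounded_support[where x = x and r = "4 * infdist x F"] f locint_const)
             (auto simp: indicator_def)
        then have "integrable \<mu> (\<lambda>z. indicator (ball x (4 * infdist x F)) z * (f z - E0 f x))"
          by (simp add: right_diff_distrib)
        moreover have "inverse (vol x) < top" using vol_pos[OF x] by (simp add: less_top[symmetric])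
        ultimately show ?thesis by (simp add: integrable_iff_bounded ennreal_mult_less_top)
      qed
      finally show ?thesis .
    qed
    then obtain X' where X': "X = ennreal X'" "X' \<ge> 0" by (cases X) auto
    define B where "B = 7 * c ^ 6 / infdist x F * X'"
    have ev: "\<forall>\<^sub>F y in at x within - F. dist (E0 f y) (E0 f x) \<le> B * dist y x"
    proof -
      have "\<forall>\<^sub>F y in at x within - F. dist y x < infdist x F / 4"
        using infdist_pos[OF x] tendstoD[OF tendsto_ident_at, of "infdist x F / 4" x "- F"] by simp
      then show ?thesis
      proof eventually_elim
        case (elim y)
        have "ennreal \<bar>E0 f y - E0 f x\<bar> \<le> ennreal (7 * c ^ 6 * (dist x y / infdist x F)) * X"
          unfolding X_def using elim by (intro E0_lip f x) (simp add: dist_commute)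
        also have "\<dots> = ennreal (B * dist y x)"
        proof -
          have "B * dist y x = 7 * c ^ 6 * (dist x y / infdist x F) * X'"
            by (simp add: B_def dist_commute)
          moreover have "0 \<le> 7 * c ^ 6 * (dist x y / infdist x F)" using c_ge_1 by (simp add: infdist_nonneg)
          ultimately show ?thesis using X' by (simp only: ennreal_mult)
        qed
        finally have le: "ennreal \<bar>E0 f y - E0 f x\<bar> \<le> ennreal (B * dist y x)" .
        have "B * dist y x \<ge> 0" using X' c_ge_1 by (simp add: B_def infdist_nonneg)
        with le show ?case by (simp add: dist_real_def)
      qed
    qed
    have "((\<lambda>y. B * dist y x) \<longlongrightarrow> B * dist x x) (at x within - F)"
      by (intro tendsto_intros)
    then have lim: "((\<lambda>y. B * dist y x) \<longlongrightarrow> 0) (at x within - F)" by simp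
    have "((\<lambda>y. dist (E0 f y) (E0 f x)) \<longlongrightarrow> 0) (at x within - F)"
      by (rule tendsto_sandwich[OF _ ev tendsto_const lim]) simp
    then show "(E0 f \<longlongrightarrow> E0 f x) (at x within - F)"
      by (rule tendsto_dist_iff[THEN iffD2])
  qed
  then have "(\<lambda>x. indicator (- F) x *\<^sub>R E0 f x) \<in> borel_measurable borel"
    by (intro borel_measurable_continuous_on_indicator) auto
  then show ?thesis by (rule measurable_cong[THEN iffD1, rotated]) (auto simp: indicator_def)
qed

end

section \<open>Kernel integrals over dyadic shells\<close>

lemma ennreal_mult_inverse_self: "0 < a \<Longrightarrow> a < \<infinity> \<Longrightarrow> a * inverse a = (1 :: ennreal)"
  using ennreal_divide_self[of a] by (simp add: divide_ennreal_def)

lemma dyadic_below: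
  fixes d r :: real
  assumes "0 < d" "d < r"
  shows "\<exists>j. r * (1/2) ^ j / 2 \<le> d \<and> d < r * (1/2) ^ j"
proof -
  define P where "P n \<longleftrightarrow> r * (1/2) ^ n \<le> d" for n
  obtain n where n: "(1/2::real) ^ n < d / r" using real_arch_pow_inv[of "d / r" "1/2"] assms by auto
  then have "P n" using assms by (simp add: P_def field_simps less_imp_le)
  then have L: "P (Least P)" by (rule LeastI)
  have "Least P \<noteq> 0" using L assms by (auto simp: P_def intro: ccontr)
  then obtain j where j: "Least P = Suc j" by (cases "Least P") auto
  have "\<not> P j" using not_less_Least[of j P] j by simp
  then show ?thesis using L j by (intro exI[of _ j]) (auto simp: P_def)
qed

lemma dyadic_above:
  fixes d r :: real
  assumes "0 < r" "r \<le> d"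
  shows "\<exists>j. r * 2 ^ j \<le> d \<and> d < r * 2 ^ Suc j"
proof -
  define P where "P n \<longleftrightarrow> d < r * 2 ^ n" for n
  obtain n where n: "d / r < 2 ^ n" using real_arch_pow[of 2 "d / r"] by auto
  then have "P n" using assms by (simp add: P_def field_simps)
  then have L: "P (Least P)" by (rule LeastI)
  have "Least P \<noteq> 0" using L assms by (auto simp: P_def intro: ccontr)
  then obtain j where j: "Least P = Suc j" by (cases "Least P") auto
  have "\<not> P j" using not_less_Least[of j P] j by simp
  then show ?thesis using L j by (intro exI[of _ j]) (auto simp: P_def)
qed

text \<open>The pieces \<open>Q j\<close> may overlap; covering is enough for an upper
  bound.\<close>

lemma nn_integral_le_suminf_cover:
  fixes g :: "'a \<Rightarrow> ennreal"
  assumes [measurable]: "g \<in> borel_measurable M" "\<And>j::nat. Measurable.pred M (Q j)"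
    and ex: "\<And>x. x \<in> space M \<Longrightarrow> P x \<Longrightarrow> \<exists>j. Q j x"
  shows "(\<integral>\<^sup>+x. (if P x then g x else 0) \<partial>M) \<le> (\<Sum>j. \<integral>\<^sup>+x. (if Q j x then g x else 0) \<partial>M)"
proof -
  have "(\<integral>\<^sup>+x. (if P x then g x else 0) \<partial>M) \<le> (\<integral>\<^sup>+x. (\<Sum>j. if Q j x then g x else 0) \<partial>M)"
  proof (rule nn_integral_mono)
    fix x assume x: "x \<in> space M"
    show "(if P x then g x else 0) \<le> (\<Sum>j. if Q j x then g x else 0)"
    proof (cases "P x")
      case True
      then obtain j where "Q j x" using ex x by blast
      then have "g x = (\<Sum>j\<in>{j}. if Q j x then g x else 0)" by simp
      also have "\<dots> \<le> (\<Sum>j. if Q j x then g x else 0)" by (intro sum_le_suminf summableI) auto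
      finally show ?thesis using True by simp
    qed simp
  qed
  also have "\<dots> = (\<Sum>j. \<integral>\<^sup>+x. (if Q j x then g x else 0) \<partial>M)"
    by (intro nn_integral_suminf) measurable
  finally show ?thesis .
qed

lemma suminf_ennreal_geometric:
  assumes "0 \<le> q" "q < 1" "a \<ge> 0"
  shows "(\<Sum>j. ennreal (a * q ^ j)) = ennreal (a / (1 - q))"
proof -
  have "(\<lambda>j. a * q ^ j) sums (a * (1 / (1 - q)))"
    using assms by (intro sums_mult geometric_sums) auto
  then show ?thesis
    using assms by (subst suminf_ennreal2) (auto simp: sums_iff)
qed

text \<open>The shape of the bound for the \<open>p\<close>-th power of the modulus of the extension
  at \<open>t\<close>: the \<open>j\<close>-th term belongs to the shell where
  \<open>infdist\<close> lies between \<open>4 * t * 2 ^ j\<close> and twice that, and the term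
  \<open>j = 0\<close> also absorbs the points closer to \<open>F\<close>.\<close>

abbreviation dyadic_sum :: "real \<Rightarrow> real \<Rightarrow> (real \<Rightarrow> ennreal) \<Rightarrow> real \<Rightarrow> ennreal"
  where "dyadic_sum p \<gamma> M t \<equiv> \<Sum>j. ennreal (((1/2) ^ j) powr p * (2 ^ j * t) powr \<gamma>) * M (64 * (2 ^ j * t))"

abbreviation Lp_pow :: "'a measure \<Rightarrow> real \<Rightarrow> ('a \<Rightarrow> real) \<Rightarrow> ennreal"
  where "Lp_pow N p f \<equiv> \<integral>\<^sup>+z. ennreal (\<bar>f z\<bar> powr p) \<partial>N"

text \<open>The \<open>p\<close>-th power of \<open>Lp_modulus\<close> over the whole space, with
  the division written as an inverse factor. Functions on \<open>F\<close> are covered by extending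
  them by 0, since \<open>\<mu>\<close> vanishes off \<open>F\<close>.\<close>

definition Modulus :: "'a::metric_space measure \<Rightarrow> ('a \<Rightarrow> real) \<Rightarrow> real \<Rightarrow> real \<Rightarrow> ennreal"
  where "Modulus N f p t = (\<integral>\<^sup>+x. (\<integral>\<^sup>+y. (if dist x y < t then ennreal (\<bar>f y - f x\<bar> powr p) else 0) \<partial>N)
     * inverse (emeasure N (ball x t)) \<partial>N)"

text \<open>When \<open>F\<close> is a single point its diameter is 0 and the comparability of \<open>m\<close> and \<open>\<mu>\<close> is vacuous;
  hence the proviso \<open>F \<noteq> {z}\<close>. In that case all oscillations over \<open>F\<close> vanish.\<close>
locale trace_codim = trace_setting D \<mu> F c m
  for D :: "'a::metric_space set" and \<mu> :: "'a measure" and F :: "'a set" and c :: real and m :: "'a measure" +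
  fixes \<gamma> G R :: real
  assumes gamma_pos: "\<gamma> > 0" and G_ge_1: "G \<ge> 1" and R_pos: "R > 0"
    and codim_up: "\<And>z r. z \<in> F \<Longrightarrow> F \<noteq> {z} \<Longrightarrow> 0 < r \<Longrightarrow> r \<le> R \<Longrightarrow>
      m_ball z r \<le> ennreal (G * r powr \<gamma>) * mu_ball z r"
    and codim_lo: "\<And>z r. z \<in> F \<Longrightarrow> F \<noteq> {z} \<Longrightarrow> 0 < r \<Longrightarrow> r \<le> R \<Longrightarrow>
      mu_ball z r \<le> ennreal (G * r powr (- \<gamma>)) * m_ball z r"
begin

sublocale mu_mu: pair_sigma_finite \<mu> \<mu> ..

lemma ker_eq_0: "\<not> dist x z < 4 * infdist x F \<Longrightarrow> ker x z = 0"
  by (simp add: ker_def)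

lemma ker_le:
  assumes "x \<notin> F" and "ball z s \<subseteq> ball x (16 * infdist x F)"
  shows "inverse (vol x) \<le> ennreal (c ^ 6) * inverse (mu_ball z s)"
  using vol_ge[OF assms] c_ge_1 by (intro ennreal_inverse_le_mult) auto

lemma inverse_mu_ball_le: "z \<in> F \<Longrightarrow> r > 0 \<Longrightarrow>
  inverse (mu_ball z r) \<le> ennreal (c ^ k) * inverse (mu_ball z (2 ^ k * r))"
  using mu_doubling_iterate[of z r k] c_ge_1 by (intro ennreal_inverse_le_mult) auto

lemma mu_ball_inverse: "z \<in> F \<Longrightarrow> r > 0 \<Longrightarrow> mu_ball z r * inverse (mu_ball z r) = 1"
  using pos[of z r] fin[of z r] by (intro ennreal_mult_inverse_self) auto

text \<open>The mass of the kernel in its first variable, near \<open>F\<close>; it appears when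
  Tonelli moves the \<open>m\<close>-integration inside. The mass in the second variable is bounded
  by \<open>ker_mass\<close>.\<close>

definition kernel_mass :: "real \<Rightarrow> 'a \<Rightarrow> ennreal"
  where "kernel_mass r z = (\<integral>\<^sup>+x. (if 0 < infdist x F \<and> infdist x F < r then ker x z else 0) \<partial>m)"

lemma measurable_kernel_mass [measurable]:
  assumes [measurable]: "g \<in> measurable K borel"
  shows "(\<lambda>x. kernel_mass r (g x)) \<in> borel_measurable K"
  unfolding kernel_mass_def by measurable

text \<open>On the shell of size \<open>s\<close> the kernel is at most a multiple of
  \<open>inverse (mu_ball z s)\<close> and lives on \<open>ball z (4 * s)\<close>, so the shell
  contributes a multiple of \<open>s powr \<gamma>\<close>. Successive shells halve
  \<open>s\<close>, and \<open>\<gamma> > 0\<close> makes the series converge geometrically.\<close>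

lemma kernel_mass_codim:
  "\<exists>K\<ge>0. \<forall>z\<in>F. \<forall>r. F \<noteq> {z} \<longrightarrow> 0 < r \<longrightarrow> r \<le> R \<longrightarrow> kernel_mass r z \<le> ennreal (K * r powr \<gamma>)"
proof -
  define q where "q = (1/2) powr \<gamma>"
  have q: "0 \<le> q" "q < 1" using gamma_pos powr_less_mono2[of \<gamma> "1/2" 1] by (auto simp: q_def)
  have qj: "((1/2) ^ j) powr \<gamma> = q ^ j" for j
    by (simp add: q_def powr_realpow[symmetric] powr_powr mult.commute)
  define K where "K = c ^ 8 * G / (1 - q)"
  have "K \<ge> 0" using c_ge_1 G_ge_1 q by (simp add: K_def)
  moreover have "kernel_mass r z \<le> ennreal (K * r powr \<gamma>)" if z: "z \<in> F" "F \<noteq> {z}" and r: "0 < r" "r \<le> R" for z r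
  proof -
    have "kernel_mass r z \<le> (\<Sum>j. \<integral>\<^sup>+x. (if r * (1/2) ^ j / 2 \<le> infdist x F \<and> infdist x F < r * (1/2) ^ j then ker x z else 0) \<partial>m)"
      unfolding kernel_mass_def
    proof (rule nn_integral_le_suminf_cover)
      show "\<exists>j. r * (1/2) ^ j / 2 \<le> infdist x F \<and> infdist x F < r * (1/2) ^ j"
        if "0 < infdist x F \<and> infdist x F < r" for x
        using that by (intro dyadic_below) auto
    qed measurable
    also have "\<dots> \<le> (\<Sum>j. ennreal (c ^ 8 * G * r powr \<gamma> * q ^ j))"
    proof (intro suminf_le summableI)
      fix j
      define s where "s = r * (1/2) ^ j"
      have s: "s > 0" "s \<le> R" 
        using r mult_mono[of r R "(1/2) ^ j" 1] by (auto simp: s_def power_le_one)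
      define I where "I = inverse (mu_ball z s)"
      have "(\<integral>\<^sup>+x. (if s / 2 \<le> infdist x F \<and> infdist x F < s then ker x z else 0) \<partial>m)
          \<le> (\<integral>\<^sup>+x. (ennreal (c ^ 6) * I) * indicator (ball z (4 * s)) x \<partial>m)"
      proof (rule nn_integral_mono, goal_cases)
        case (1 x)
        have "ker x z \<le> (ennreal (c ^ 6) * I) * indicator (ball z (4 * s)) x" if "s / 2 \<le> infdist x F" "infdist x F < s"
        proof (cases "dist x z < 4 * infdist x F")
          case True
          have "x \<notin> F" using that s infdist_pos_iff[of x] by simp
          then have "ker x z \<le> ennreal (c ^ 6) * I"
            unfolding I_def ker_def using True that by (simp, intro ker_le ball_subsetI) auto
          moreover have "x \<in> ball z (4 * s)" using True that by (simp add: dist_commute)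
          ultimately show ?thesis by simp
        qed (simp add: ker_def)
        then show ?case
          by simp
      qed
      also have "\<dots> = ennreal (c ^ 6) * I * m_ball z (2 ^ 2 * s)"
        by (simp add: nn_integral_cmult_indicator sets_m)
      also have "\<dots> \<le> ennreal (c ^ 6) * I * (ennreal (c ^ 2) * (ennreal (G * s powr \<gamma>) * mu_ball z s))"
        using codim_up[OF z s] by (intro mult_left_mono order_trans[OF m_doubling_iterate[OF s(1)]]) auto
      also have "\<dots> = ennreal (c ^ 6) * (ennreal (c ^ 2) * ennreal (G * s powr \<gamma>)) * (mu_ball z s * I)"
        by (simp add: ac_simps)
      also have "\<dots> = ennreal (c ^ 8 * G * s powr \<gamma>)"
        using mu_ball_inverse[OF z(1) s(1)] c_ge_1 G_ge_1
        by (simp add: I_def power_add[symmetric] mult.assoc[symmetric] flip: ennreal_mult)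
      also have "c ^ 8 * G * s powr \<gamma> = c ^ 8 * G * r powr \<gamma> * q ^ j"
        using r by (simp add: s_def powr_mult qj)
      finally show "(\<integral>\<^sup>+x. (if r * (1/2) ^ j / 2 \<le> infdist x F \<and> infdist x F < r * (1/2) ^ j then ker x z else 0) \<partial>m)
         \<le> ennreal (c ^ 8 * G * r powr \<gamma> * q ^ j)" by (simp add: s_def)
    qed
    also have "\<dots> = ennreal (K * r powr \<gamma>)"
      using q c_ge_1 G_ge_1 by (subst suminf_ennreal_geometric) (auto simp: K_def)
    finally show ?thesis .
  qed
  ultimately show ?thesis by blast
qed

text \<open>The form that the trace needs: it contains no power of the radius and so also covers a
  one-point \<open>F\<close>. There \<open>\<mu>\<close> is an atom at \<open>z\<close>, both
  \<open>vol x\<close> and \<open>mu_ball z r\<close> equal its mass, and the kernel at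
  \<open>z\<close> is constant off \<open>F\<close>.\<close>

lemma kernel_mass_ratio:
  "\<exists>H\<ge>0. \<forall>z\<in>F. \<forall>r. 0 < r \<longrightarrow> r \<le> R \<longrightarrow> kernel_mass r z \<le> ennreal H * (m_ball z r * inverse (mu_ball z r))"
proof -
  obtain K where K: "K \<ge> 0" "\<And>z r. z \<in> F \<Longrightarrow> F \<noteq> {z} \<Longrightarrow> 0 < r \<Longrightarrow> r \<le> R \<Longrightarrow> kernel_mass r z \<le> ennreal (K * r powr \<gamma>)"
    using kernel_mass_codim by blast
  \<comment> \<open>\<open>K * G\<close> comes from the codimension bounds, the summand 1 covers the
    one-point case.\<close>
  have "kernel_mass r z \<le> ennreal (K * G + 1) * (m_ball z r * inverse (mu_ball z r))"
    if z: "z \<in> F" and r: "0 < r" "r \<le> R" for z r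
  proof (cases "F = {z}")
    case False
    define I where "I = inverse (mu_ball z r)"
    have "ennreal (r powr \<gamma>) = ennreal (r powr \<gamma>) * (mu_ball z r * I)"
      using mu_ball_inverse[OF z r(1)] by (simp add: I_def)
    also have "\<dots> \<le> ennreal (r powr \<gamma>) * (ennreal (G * r powr (- \<gamma>)) * m_ball z r * I)"
      by (intro mult_left_mono mult_right_mono codim_lo z False r) auto
    also have "\<dots> = ennreal (r powr \<gamma> * (G * r powr (- \<gamma>))) * (m_ball z r * I)"
      using G_ge_1 by (simp add: ennreal_mult mult.assoc)
    also have "r powr \<gamma> * (G * r powr (- \<gamma>)) = G" using r by (simp add: powr_minus field_simps)
    finally have *: "ennreal (r powr \<gamma>) \<le> ennreal G * (m_ball z r * I)" .
    have "kernel_mass r z \<le> ennreal K * ennreal (r powr \<gamma>)" using K(2)[OF z False r] K(1) by (simp add: ennreal_mult)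
    also have "\<dots> \<le> ennreal K * (ennreal G * (m_ball z r * I))" by (intro mult_left_mono *) auto
    also have "\<dots> = ennreal (K * G) * (m_ball z r * I)"
      using K(1) G_ge_1 by (simp add: ennreal_mult mult.assoc)
    also have "\<dots> \<le> ennreal (K * G + 1) * (m_ball z r * I)"
      by (intro mult_right_mono ennreal_leI) auto
    finally show ?thesis by (simp add: I_def)
  next
    case True
    have "kernel_mass r z \<le> (\<integral>\<^sup>+x. inverse (mu_ball z r) * indicator (ball z r) x \<partial>m)"
      unfolding kernel_mass_def
    proof (rule nn_integral_mono, goal_cases)
      case (1 x)
      have "ker x z \<le> inverse (mu_ball z r) * indicator (ball z r) x" if "0 < infdist x F" "infdist x F < r"
      proof -
        have d: "infdist x F = dist x z" using True by (simp add: infdist_def)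
        have "mu_ball z r \<le> emeasure \<mu> ({z} \<union> - F)"
          using True F_borel by (intro emeasure_mono) (auto simp: sets_mu)
        also have "\<dots> \<le> emeasure \<mu> {z} + emeasure \<mu> (- F)"
          using F_borel by (intro emeasure_subadditive) (auto simp: sets_mu)
        also have "\<dots> = emeasure \<mu> {z}" using null_compl by simp
        also have "\<dots> \<le> vol x" unfolding vol_def d using that d by (intro emeasure_mono) (auto simp: sets_mu)
        finally have "inverse (vol x) \<le> inverse (mu_ball z r)"
          using ennreal_inverse_le_mult[of "mu_ball z r" 1 "vol x"] by simp
        moreover have "x \<in> ball z r" using that d by (simp add: dist_commute)
        ultimately show ?thesis by (simp add: ker_def)
      qed
      then show ?case
        by simp
    qed
    also have "\<dots> = 1 * (m_ball z r * inverse (mu_ball z r))"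
      by (subst nn_integral_cmult_indicator) (simp_all add: sets_m mult.commute)
    also have "\<dots> \<le> ennreal (K * G + 1) * (m_ball z r * inverse (mu_ball z r))"
      using K(1) G_ge_1 by (intro mult_right_mono) auto
    finally show ?thesis .
  qed
  moreover have "K * G + 1 \<ge> 0" using K(1) G_ge_1 by simp
  ultimately show ?thesis by blast
qed

text \<open>A one-point \<open>F\<close> has only one center, so finiteness suffices; otherwise the
  power bound at \<open>r = R\<close> is uniform.\<close>

lemma kernel_mass_bounded: "\<exists>L\<ge>0. \<forall>z\<in>F. kernel_mass R z \<le> ennreal L"
proof (cases "\<exists>z. F = {z}")
  case True
  then obtain z where z: "F = {z}" by blast
  obtain H where "kernel_mass R z \<le> ennreal H * (m_ball z R * inverse (mu_ball z R))"
    using kernel_mass_ratio z R_pos by blast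
  also have "\<dots> < \<infinity>"
  proof -
    have "inverse (mu_ball z R) < top" using pos[of z R] z R_pos by (simp add: less_top[symmetric])
    then show ?thesis using m_fin[of z R] by (simp add: ennreal_mult_less_top)
  qed
  finally obtain L where "kernel_mass R z = ennreal L" "L \<ge> 0" by (cases "kernel_mass R z") auto
  then show ?thesis using z by auto
next
  case False
  obtain K where K: "K \<ge> 0" "\<And>z r. z \<in> F \<Longrightarrow> F \<noteq> {z} \<Longrightarrow> 0 < r \<Longrightarrow> r \<le> R \<Longrightarrow> kernel_mass r z \<le> ennreal (K * r powr \<gamma>)"
    using kernel_mass_codim by blast
  show ?thesis
    using K(2)[OF _ _ R_pos order_refl] False K(1) by (intro exI[of _ "K * R powr \<gamma>"]) auto
qed

section \<open>Oscillations of f over shells\<close>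

definition local_osc :: "('a \<Rightarrow> real) \<Rightarrow> real \<Rightarrow> real \<Rightarrow> 'a \<Rightarrow> ennreal"
  where "local_osc f p s z = (\<integral>\<^sup>+w. (if dist z w < s then ennreal (\<bar>f w - f z\<bar> powr p) else 0) \<partial>\<mu>)"

lemma Modulus_mu: "Modulus \<mu> f p s = (\<integral>\<^sup>+z. local_osc f p s z * inverse (mu_ball z s) \<partial>\<mu>)"
  by (simp add: Modulus_def local_osc_def)

lemma measurable_local_osc [measurable]:
  assumes [measurable]: "f \<in> borel_measurable borel" "g \<in> measurable K borel" "s \<in> borel_measurable K"
  shows "(\<lambda>x. local_osc f p (s x) (g x)) \<in> borel_measurable K"
  unfolding local_osc_def by measurable

text \<open>Tonelli turns a kernel bound pointwise in \<open>z\<close> into a bound by the modulus.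
  The bound is asked for only if \<open>F \<noteq> {z}\<close>, because the oscillation over a
  one-point set is 0.\<close>

lemma integral_le_Modulus:
  assumes f: "locint f" and A[measurable]: "case_prod A \<in> borel_measurable (borel \<Otimes>\<^sub>M borel)"
    and le: "\<And>z. z \<in> F \<Longrightarrow> F \<noteq> {z} \<Longrightarrow> (\<integral>\<^sup>+x. A x z \<partial>m) \<le> ennreal K * inverse (mu_ball z s)"
  shows "(\<integral>\<^sup>+x. \<integral>\<^sup>+z. A x z * local_osc f p s z \<partial>\<mu> \<partial>m) \<le> ennreal K * Modulus \<mu> f p s"
proof -
  note [measurable] = locint_measurable[OF f]
  have "(\<integral>\<^sup>+x. \<integral>\<^sup>+z. A x z * local_osc f p s z \<partial>\<mu> \<partial>m) = (\<integral>\<^sup>+z. \<integral>\<^sup>+x. A x z * local_osc f p s z \<partial>m \<partial>\<mu>)"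
    by (rule m_mu.Fubini'[symmetric]) measurable
  also have "\<dots> = (\<integral>\<^sup>+z. (\<integral>\<^sup>+x. A x z \<partial>m) * local_osc f p s z \<partial>\<mu>)"
    by (intro nn_integral_cong nn_integral_multc) measurable
  also have "\<dots> \<le> (\<integral>\<^sup>+z. ennreal K * (local_osc f p s z * inverse (mu_ball z s)) \<partial>\<mu>)"
  proof (rule nn_integral_mono_AE, use AE_mu_in_F in eventually_elim)
    case (elim z)
    show ?case
    proof (cases "F = {z}")
      case True
      have "local_osc f p s z = (\<integral>\<^sup>+w. 0 \<partial>\<mu>)"
        unfolding local_osc_def using AE_mu_in_F by (intro nn_integral_cong_AE) (auto simp: True)
      then show ?thesis by simp
    next
      case False
      then show ?thesis using mult_right_mono[OF le[OF elim False], of "local_osc f p s z"] by (simp add: ac_simps)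
    qed
  qed
  also have "\<dots> = ennreal K * Modulus \<mu> f p s"
    unfolding Modulus_mu by (rule nn_integral_cmult) measurable
  finally show ?thesis .
qed

definition kernel_osc :: "('a \<Rightarrow> real) \<Rightarrow> real \<Rightarrow> 'a \<Rightarrow> ennreal"
  where "kernel_osc f p x = (\<integral>\<^sup>+z. \<integral>\<^sup>+w. ker x z * ker x w * ennreal (\<bar>f w - f z\<bar> powr p) \<partial>\<mu> \<partial>\<mu>)"

lemma measurable_kernel_osc [measurable]:
  assumes [measurable]: "f \<in> borel_measurable borel" "g \<in> measurable K borel"
  shows "(\<lambda>x. kernel_osc f p (g x)) \<in> borel_measurable K"
  unfolding kernel_osc_def by measurable

text \<open>Two points within \<open>4 * s\<close> of \<open>x\<close> are within
  \<open>8 * s\<close> of each other, so one kernel is bounded by \<open>inverse (vol x)\<close> and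
  the double average becomes a local oscillation at radius \<open>8 * s\<close>. The exponent 17 is
  6 + 6 for the two kernels, 2 for the \<open>m\<close>-ball of radius \<open>4 * s\<close> and 3
  for passing to the \<open>\<mu>\<close>-ball of radius \<open>8 * s\<close>.\<close>

lemma shell_bound:
  assumes f: "locint f" and s: "0 < s" "s \<le> R"
  shows "(\<integral>\<^sup>+x. (if s / 2 \<le> infdist x F \<and> infdist x F < s then kernel_osc f p x else 0) \<partial>m)
    \<le> ennreal (c ^ 17 * G * s powr \<gamma>) * Modulus \<mu> f p (8 * s)"
proof -
  note [measurable] = locint_measurable[OF f]
  define A where "A x z = (if s / 2 \<le> infdist x F \<and> infdist x F < s then ker x z * inverse (vol x) else 0)" for x z
  have "(\<integral>\<^sup>+x. (if s / 2 \<le> infdist x F \<and> infdist x F < s then kernel_osc f p x else 0) \<partial>m)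
    \<le> (\<integral>\<^sup>+x. \<integral>\<^sup>+z. A x z * local_osc f p (8 * s) z \<partial>\<mu> \<partial>m)"
  proof (rule nn_integral_mono, goal_cases)
    case (1 x)
    have "kernel_osc f p x \<le> (\<integral>\<^sup>+z. A x z * local_osc f p (8 * s) z \<partial>\<mu>)" if x: "s / 2 \<le> infdist x F" "infdist x F < s"
      unfolding kernel_osc_def
    proof (rule nn_integral_mono, goal_cases)
      case (1 z)
      have "(\<integral>\<^sup>+w. ker x z * ker x w * ennreal (\<bar>f w - f z\<bar> powr p) \<partial>\<mu>)
         \<le> (\<integral>\<^sup>+w. A x z * (if dist z w < 8 * s then ennreal (\<bar>f w - f z\<bar> powr p) else 0) \<partial>\<mu>)"
      proof (rule nn_integral_mono, goal_cases)
        case (1 w)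
        show ?case
        proof (cases "dist x z < 4 * infdist x F \<and> dist x w < 4 * infdist x F")
          case True
          then have "dist z w < 8 * s" using dist_triangle[of z w x] x by (simp add: dist_commute)
          then show ?thesis using True x by (simp add: A_def ker_def)
        qed (auto simp: ker_def)
      qed
      also have "\<dots> = A x z * local_osc f p (8 * s) z"
        unfolding local_osc_def by (rule nn_integral_cmult) measurable
      finally show ?case .
    qed
    then show ?case
      by simp
  qed
  also have "\<dots> \<le> ennreal (c ^ 17 * G * s powr \<gamma>) * Modulus \<mu> f p (8 * s)"
  proof (rule integral_le_Modulus[OF f])
    show "case_prod A \<in> borel_measurable (borel \<Otimes>\<^sub>M borel)" unfolding A_def by measurable
    fix z assume z: "z \<in> F" "F \<noteq> {z}"
    define I where "I = inverse (mu_ball z s)"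
    have "(\<integral>\<^sup>+x. A x z \<partial>m) \<le> (\<integral>\<^sup>+x. (ennreal (c ^ 6) * I * (ennreal (c ^ 6) * I)) * indicator (ball z (4 * s)) x \<partial>m)"
    proof (rule nn_integral_mono, goal_cases)
      case (1 x)
      show ?case
      proof (cases "s / 2 \<le> infdist x F \<and> infdist x F < s \<and> dist x z < 4 * infdist x F")
        case True
        then have "x \<notin> F" using s infdist_pos_iff[of x] by simp
        then have "inverse (vol x) \<le> ennreal (c ^ 6) * I"
          unfolding I_def using True by (intro ker_le ball_subsetI) auto
        then have "inverse (vol x) * inverse (vol x) \<le> ennreal (c ^ 6) * I * (ennreal (c ^ 6) * I)"
          by (intro mult_mono) auto
        moreover have "x \<in> ball z (4 * s)" using True by (simp add: dist_commute)
        ultimately show ?thesis using True by (simp add: A_def ker_def)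
      qed (auto simp: A_def ker_def)
    qed
    also have "\<dots> = ennreal (c ^ 6) * I * (ennreal (c ^ 6) * I) * m_ball z (2 ^ 2 * s)"
      by (simp add: nn_integral_cmult_indicator sets_m)
    also have "\<dots> \<le> ennreal (c ^ 6) * I * (ennreal (c ^ 6) * I) * (ennreal (c ^ 2) * (ennreal (G * s powr \<gamma>) * mu_ball z s))"
      using codim_up[OF z s] by (intro mult_left_mono order_trans[OF m_doubling_iterate[OF s(1)]]) auto
    also have "\<dots> = ennreal (c ^ 6) * (ennreal (c ^ 6) * (ennreal (c ^ 2) * ennreal (G * s powr \<gamma>))) * (mu_ball z s * I) * I"
      by (simp add: ac_simps)
    also have "\<dots> \<le> ennreal (c ^ 6) * (ennreal (c ^ 6) * (ennreal (c ^ 2) * ennreal (G * s powr \<gamma>))) * (ennreal (c ^ 3) * inverse (mu_ball z (8 * s)))"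
      using mu_ball_inverse[OF z(1) s(1)] inverse_mu_ball_le[OF z(1) s(1), of 3] by (simp add: I_def mult_left_mono)
    also have "\<dots> = ennreal (c ^ 17 * G * s powr \<gamma>) * inverse (mu_ball z (8 * s))"
    proof -
      have eq: "c ^ 17 * G * s powr \<gamma> = c ^ 6 * (c ^ 6 * (c ^ 2 * (G * s powr \<gamma>))) * c ^ 3"
      proof -
        have "c ^ 17 = c ^ 6 * c ^ 6 * c ^ 2 * c ^ 3" by (simp flip: power_add)
        then show ?thesis by (simp only: ac_simps)
      qed
      have "ennreal a * (ennreal a * (ennreal b * ennreal g)) * (ennreal e * X) = ennreal (a * (a * (b * g)) * e) * X"
        if "a \<ge> 0" "b \<ge> 0" "g \<ge> 0" "e \<ge> 0" for a b g e X
        using that by (simp add: ennreal_mult mult.assoc)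
      then show ?thesis unfolding eq using c_ge_1 G_ge_1 by simp
    qed
    finally show "(\<integral>\<^sup>+x. A x z \<partial>m) \<le> ennreal (c ^ 17 * G * s powr \<gamma>) * inverse (mu_ball z (8 * s))" .
  qed
  finally show ?thesis .
qed

end

section \<open>Moduli of the averaged function\<close>

context trace_codim
begin

text \<open>The value 0 on the \<open>m\<close>-null set \<open>F\<close> makes the function Borel
  on the whole space.\<close>

definition E1 :: "('a \<Rightarrow> real) \<Rightarrow> 'a \<Rightarrow> real"
  where "E1 f x = (if x \<in> F then 0 else E0 f x)"

lemma measurable_E1:
  assumes "locint f" "g \<in> measurable K borel"
  shows "(\<lambda>x. E1 f (g x)) \<in> borel_measurable K"
  using measurable_compose[OF assms(2) E0_measurable[OF assms(1)]] by (simp add: E1_def)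

text \<open>Points \<open>y \<in> F\<close>, an \<open>m\<close>-null set, are left out because the
  estimates for \<open>E0\<close> hold off \<open>F\<close>.\<close>

definition Osc :: "('a \<Rightarrow> real) \<Rightarrow> real \<Rightarrow> real \<Rightarrow> 'a \<Rightarrow> ennreal"
  where "Osc f p t x = (\<integral>\<^sup>+y. (if dist x y < t \<and> y \<notin> F then ennreal (\<bar>E1 f y - E1 f x\<bar> powr p) else 0) \<partial>m)"

lemma measurable_Osc:
  assumes "locint f" and [measurable]: "g \<in> measurable K borel"
  shows "(\<lambda>x. Osc f p t (g x)) \<in> borel_measurable K"
proof -
  note [measurable] = measurable_E1[OF assms(1)]
  show ?thesis unfolding Osc_def by measurable
qed

lemma m_ball_inverse: "r > 0 \<Longrightarrow> inverse (m_ball z r) * m_ball z r = 1"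
  using m_pos[of r z] m_fin[of z r] ennreal_mult_inverse_self[of "m_ball z r"] by (simp add: mult.commute)

text \<open>\<open>4 * t \<le> infdist x F\<close> puts the whole ball of radius \<open>t\<close>
  within the range of the Lipschitz estimate, and there the ratio
  \<open>dist x y / infdist x F\<close> is at most \<open>(1/2) ^ j\<close>.\<close>

lemma far_bound_pointwise:
  assumes f: "locint f" and p: "p \<ge> 1" and t: "t > 0" and x: "4 * t * 2 ^ j \<le> infdist x F"
  shows "inverse (m_ball x t) * Osc f p t x \<le> ennreal ((7 * c ^ 18) powr p * ((1/2) ^ j) powr p) * kernel_osc f p x"
proof -
  have "4 * t * 1 \<le> 4 * t * 2 ^ j" using t by (intro mult_left_mono) auto
  then have x4: "4 * t \<le> infdist x F" using x by simp
  have xF: "x \<notin> F" using x4 t infdist_pos_iff[of x] by simp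
  define a where "a = ennreal ((7 * c ^ 18) powr p * ((1/2) ^ j) powr p)"
  have "Osc f p t x \<le> (\<integral>\<^sup>+y. (a * kernel_osc f p x) * indicator (ball x t) y \<partial>m)"
    unfolding Osc_def
  proof (rule nn_integral_mono, goal_cases)
    case (1 y)
    have "ennreal (\<bar>E1 f y - E1 f x\<bar> powr p) \<le> a * kernel_osc f p x" if y: "dist x y < t" "y \<notin> F"
    proof -
      have "dist x y / infdist x F \<le> t / (4 * t * 2 ^ j)"
        using y x t by (intro frac_le) auto
      also have "\<dots> = (1/2) ^ j / 4" using t by (simp add: field_simps)
      also have "\<dots> \<le> (1/2) ^ j" by simp
      finally have le: "dist x y / infdist x F \<le> (1/2) ^ j" .
      have "ennreal (\<bar>E1 f y - E1 f x\<bar> powr p) \<le> ennreal ((7 * c ^ 18 * (dist x y / infdist x F)) powr p) * kernel_osc f p x"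
        using E0_lip_pow[OF f xF _ p, of y] y x4 xF by (simp add: E1_def kernel_osc_def)
      also have "\<dots> \<le> ennreal ((7 * c ^ 18 * (1/2) ^ j) powr p) * kernel_osc f p x"
        using le p c_ge_1 by (intro mult_right_mono ennreal_leI powr_mono2 mult_left_mono) (auto simp: infdist_nonneg)
      also have "(7 * c ^ 18 * (1/2) ^ j) powr p = (7 * c ^ 18) powr p * ((1/2) ^ j) powr p"
        using c_ge_1 by (simp add: powr_mult)
      finally show ?thesis by (simp add: a_def)
    qed
    then show ?case
      by simp
  qed
  also have "\<dots> = a * kernel_osc f p x * m_ball x t"
    by (simp add: nn_integral_cmult_indicator sets_m)
  finally have "inverse (m_ball x t) * Osc f p t x \<le> inverse (m_ball x t) * (a * kernel_osc f p x * m_ball x t)"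
    by (intro mult_left_mono) auto
  also have "\<dots> = a * kernel_osc f p x * (inverse (m_ball x t) * m_ball x t)" by (simp add: ac_simps)
  finally show ?thesis by (simp add: a_def m_ball_inverse[OF t])
qed

lemma far_bound:
  assumes p: "p \<ge> 1"
  shows "\<exists>C\<ge>0. \<forall>f t \<rho>. locint f \<longrightarrow> 0 < t \<longrightarrow> 2 * \<rho> \<le> R \<longrightarrow>
    (\<integral>\<^sup>+x. (if 4 * t \<le> infdist x F \<and> infdist x F < \<rho> then inverse (m_ball x t) * Osc f p t x else 0) \<partial>m)
    \<le> ennreal C * (dyadic_sum p \<gamma> (Modulus \<mu> f p) t)"
proof -
  define k where "k = (7 * c ^ 18) powr p"
  define C where "C = k * (c ^ 17 * G * 8 powr \<gamma>)"
  have k: "k \<ge> 0" by (simp add: k_def)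
  have C: "C \<ge> 0" using c_ge_1 G_ge_1 k by (simp add: C_def)
  moreover have "(\<integral>\<^sup>+x. (if 4 * t \<le> infdist x F \<and> infdist x F < \<rho> then inverse (m_ball x t) * Osc f p t x else 0) \<partial>m)
    \<le> ennreal C * (dyadic_sum p \<gamma> (Modulus \<mu> f p) t)"
    if f: "locint f" and t: "0 < t" and \<rho>: "2 * \<rho> \<le> R" for f t \<rho>
  proof -
    note [measurable] = locint_measurable[OF f] measurable_Osc[OF f]
    define Q where "Q j x \<longleftrightarrow> (4 * t * 2 ^ j \<le> infdist x F \<and> infdist x F < 4 * t * 2 ^ Suc j) \<and> infdist x F < \<rho>" for j x
    have [measurable]: "Measurable.pred m (Q j)" for j unfolding Q_def by measurable
    have "(\<integral>\<^sup>+x. (if 4 * t \<le> infdist x F \<and> infdist x F < \<rho> then inverse (m_ball x t) * Osc f p t x else 0) \<partial>m)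
      \<le> (\<Sum>j. \<integral>\<^sup>+x. (if Q j x then inverse (m_ball x t) * Osc f p t x else 0) \<partial>m)"
    proof (rule nn_integral_le_suminf_cover)
      show "\<exists>j. Q j x" if "4 * t \<le> infdist x F \<and> infdist x F < \<rho>" for x
        using that t dyadic_above[of "4 * t" "infdist x F"] unfolding Q_def by auto
    qed measurable
    also have "\<dots> \<le> (\<Sum>j. ennreal C * (ennreal (((1/2) ^ j) powr p * (2 ^ j * t) powr \<gamma>) * Modulus \<mu> f p (64 * (2 ^ j * t))))"
    proof (intro suminf_le summableI)
      fix j
      \<comment> \<open>The \<open>j\<close>-th shell is \<open>s / 2 \<le> infdist x F < s\<close>;
        \<open>shell_bound\<close> yields the modulus at
        \<open>8 * s = 64 * (2 ^ j * t)\<close>.\<close>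
      define s where "s = 8 * (2 ^ j * t)"
      define a where "a = ((1/2::real) ^ j) powr p"
      have s: "s > 0" using t by (simp add: s_def)
      show "(\<integral>\<^sup>+x. (if Q j x then inverse (m_ball x t) * Osc f p t x else 0) \<partial>m)
        \<le> ennreal C * (ennreal (((1/2) ^ j) powr p * (2 ^ j * t) powr \<gamma>) * Modulus \<mu> f p (64 * (2 ^ j * t)))"
      proof (cases "s \<le> R")
        \<comment> \<open>\<open>2 * \<rho> \<le> R\<close> excludes scales beyond \<open>R\<close>:
          such a shell does not meet \<open>infdist x F < \<rho>\<close>.\<close>
        case False
        have "s = 2 * (4 * t * 2 ^ j)" by (simp add: s_def)
        then have "\<not> Q j x" for x
          using False \<rho> unfolding Q_def by linarith
        then show ?thesis by simp
      next
        case True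
        have "(\<integral>\<^sup>+x. (if Q j x then inverse (m_ball x t) * Osc f p t x else 0) \<partial>m)
          \<le> (\<integral>\<^sup>+x. ennreal (k * a) * (if s / 2 \<le> infdist x F \<and> infdist x F < s then kernel_osc f p x else 0) \<partial>m)"
          using far_bound_pointwise[OF f p t, of j]
          by (intro nn_integral_mono) (auto simp: Q_def s_def k_def a_def ac_simps)
        also have "\<dots> = ennreal (k * a) * (\<integral>\<^sup>+x. (if s / 2 \<le> infdist x F \<and> infdist x F < s then kernel_osc f p x else 0) \<partial>m)"
          by (rule nn_integral_cmult) measurable
        also have "\<dots> \<le> ennreal (k * a) * (ennreal (c ^ 17 * G * s powr \<gamma>) * Modulus \<mu> f p (8 * s))"
          by (intro mult_left_mono shell_bound f s True) auto
        also have "\<dots> = ennreal (k * a * (c ^ 17 * G * s powr \<gamma>)) * Modulus \<mu> f p (8 * s)"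
          using c_ge_1 G_ge_1 k by (simp add: ennreal_mult a_def mult.assoc)
        also have "k * a * (c ^ 17 * G * s powr \<gamma>) = C * (a * (2 ^ j * t) powr \<gamma>)"
          using t by (simp add: C_def s_def powr_mult)
        also have "ennreal \<dots> * Modulus \<mu> f p (8 * s) = ennreal C * (ennreal (a * (2 ^ j * t) powr \<gamma>) * Modulus \<mu> f p (64 * (2 ^ j * t)))"
          using C by (simp add: ennreal_mult a_def mult.assoc s_def)
        finally show ?thesis by (simp add: a_def)
      qed
    qed
    also have "\<dots> = ennreal C * (dyadic_sum p \<gamma> (Modulus \<mu> f p) t)"
      by (rule ennreal_suminf_cmult)
    finally show ?thesis .
  qed
  ultimately show ?thesis by blast
qed

section \<open>Points close to F\<close>

lemma near_bound_pointwise: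
  assumes f: "locint f" and p: "p \<ge> 1" and t: "t > 0" "5 * t \<le> R" and x: "x \<notin> F" "infdist x F < 4 * t"
    and K: "K \<ge> 0" "\<And>z. z \<in> F \<Longrightarrow> F \<noteq> {z} \<Longrightarrow> kernel_mass (5 * t) z \<le> ennreal K"
  shows "Osc f p t x \<le> ennreal ((c ^ 6) powr p * (c ^ 6) powr p * K) * (\<integral>\<^sup>+z. ker x z * local_osc f p (64 * t) z \<partial>\<mu>)"
proof -
  note [measurable] = locint_measurable[OF f]
  define k where "k = ennreal ((c ^ 6) powr p)"
  define g where "g z w = ennreal (\<bar>f w - f z\<bar> powr p)" for z w
  have g_sym: "g z w = g w z" for z w by (simp add: g_def abs_minus_commute)
  have [measurable]: "(\<lambda>q. g (a q) (b q)) \<in> borel_measurable N" if [measurable]: "a \<in> measurable N borel" "b \<in> measurable N borel" for a b N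
    unfolding g_def by measurable
  define B where "B y w = (if 0 < infdist y F \<and> infdist y F < 5 * t then ker y w else 0)" for y w
  define q where "q w = (if dist x w < 21 * t then (\<integral>\<^sup>+z. ker x z * g w z \<partial>\<mu>) else 0)" for w
  have [measurable]: "(\<lambda>u. B (a u) (b u)) \<in> borel_measurable N" if [measurable]: "a \<in> measurable N borel" "b \<in> measurable N borel" for a b N
    unfolding B_def by measurable
  have [measurable]: "q \<in> borel_measurable borel" unfolding q_def by measurable
  have "Osc f p t x \<le> (\<integral>\<^sup>+y. k * (k * (\<integral>\<^sup>+w. B y w * q w \<partial>\<mu>)) \<partial>m)"
    unfolding Osc_def
  proof (rule nn_integral_mono, goal_cases)
    case (1 y)
    have "ennreal (\<bar>E1 f y - E1 f x\<bar> powr p) \<le> k * (k * (\<integral>\<^sup>+w. B y w * q w \<partial>\<mu>))" if y: "dist x y < t" "y \<notin> F"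
    proof -
      have "ennreal (\<bar>E1 f y - E1 f x\<bar> powr p) \<le> k * (\<integral>\<^sup>+w. ker y w * ennreal (\<bar>f w - E0 f x\<bar> powr p) \<partial>\<mu>)"
        using E0_pow[OF f y(2) p] y x by (simp add: E1_def k_def)
      also have "\<dots> \<le> k * (\<integral>\<^sup>+w. k * (B y w * q w) \<partial>\<mu>)"
      proof (intro mult_left_mono nn_integral_mono)
        fix w
        show "ker y w * ennreal (\<bar>f w - E0 f x\<bar> powr p) \<le> k * (B y w * q w)"
        proof (cases "dist y w < 4 * infdist y F")
          case True
          have dy: "infdist y F < 5 * t" using infdist_diff_le[of x y] x(2) y(1) by linarith
          then have "dist x w < 21 * t" using True y(1) dist_triangle[of x w y] by linarith
          moreover have "0 < infdist y F" using infdist_pos y(2) by simp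
          ultimately have "B y w * q w = ker y w * (\<integral>\<^sup>+z. ker x z * g w z \<partial>\<mu>)" using dy by (simp add: B_def q_def)
          moreover have "ennreal (\<bar>f w - E0 f x\<bar> powr p) \<le> k * (\<integral>\<^sup>+z. ker x z * g w z \<partial>\<mu>)"
            using E0_pow[OF f x(1) p, of "f w"] by (simp add: k_def g_def abs_minus_commute)
          then have "ker y w * ennreal (\<bar>f w - E0 f x\<bar> powr p) \<le> ker y w * (k * (\<integral>\<^sup>+z. ker x z * g w z \<partial>\<mu>))"
            by (intro mult_left_mono) auto
          ultimately show ?thesis by (simp only: mult.left_commute[of _ k])
        qed (simp add: ker_eq_0)
      qed auto
      also have "(\<integral>\<^sup>+w. k * (B y w * q w) \<partial>\<mu>) = k * (\<integral>\<^sup>+w. B y w * q w \<partial>\<mu>)"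
        by (rule nn_integral_cmult) measurable
      finally show ?thesis .
    qed
    then show ?case
      by simp
  qed
  also have "\<dots> = k * k * (\<integral>\<^sup>+y. \<integral>\<^sup>+w. B y w * q w \<partial>\<mu> \<partial>m)"
    by (simp add: nn_integral_cmult mult.assoc)
  also have "(\<integral>\<^sup>+y. \<integral>\<^sup>+w. B y w * q w \<partial>\<mu> \<partial>m) = (\<integral>\<^sup>+w. \<integral>\<^sup>+y. B y w * q w \<partial>m \<partial>\<mu>)"
    by (rule m_mu.Fubini'[symmetric]) measurable
  also have "\<dots> = (\<integral>\<^sup>+w. kernel_mass (5 * t) w * q w \<partial>\<mu>)"
    unfolding kernel_mass_def B_def by (intro nn_integral_cong nn_integral_multc) measurable
  also have "\<dots> \<le> (\<integral>\<^sup>+w. \<integral>\<^sup>+z. ennreal K * (if dist x w < 21 * t then ker x z * g w z else 0) \<partial>\<mu> \<partial>\<mu>)"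
  proof (rule nn_integral_mono_AE, use AE_mu_in_F in eventually_elim)
    case (elim w)
    have "kernel_mass (5 * t) w * q w = (\<integral>\<^sup>+z. kernel_mass (5 * t) w * (if dist x w < 21 * t then ker x z * g w z else 0) \<partial>\<mu>)"
      unfolding q_def by (cases "dist x w < 21 * t") (auto intro!: nn_integral_cmult[symmetric])
    also have "\<dots> \<le> (\<integral>\<^sup>+z. ennreal K * (if dist x w < 21 * t then ker x z * g w z else 0) \<partial>\<mu>)"
    proof (rule nn_integral_mono_AE, use AE_mu_in_F in eventually_elim)
      case z: (elim z)
      show ?case
      \<comment> \<open>The bound \<open>K\<close> is known only for \<open>F \<noteq> {w}\<close>;
        if \<open>F = {w}\<close>, then \<open>z = w\<close> and the integrand is 0.\<close>
      proof (cases "z = w")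
        case True
        then show ?thesis by (simp add: g_def)
      next
        case False
        then have "F \<noteq> {w}" using z by auto
        then show ?thesis by (intro mult_right_mono K(2) elim) auto
      qed
    qed
    finally show ?case .
  qed
  also have "\<dots> = (\<integral>\<^sup>+z. \<integral>\<^sup>+w. ennreal K * (if dist x w < 21 * t then ker x z * g w z else 0) \<partial>\<mu> \<partial>\<mu>)"
    by (rule mu_mu.Fubini') measurable
  also have "\<dots> \<le> (\<integral>\<^sup>+z. ennreal K * (ker x z * local_osc f p (64 * t) z) \<partial>\<mu>)"
  proof (rule nn_integral_mono, goal_cases)
    case (1 z)
    have "(\<integral>\<^sup>+w. ennreal K * (if dist x w < 21 * t then ker x z * g w z else 0) \<partial>\<mu>)
      \<le> (\<integral>\<^sup>+w. (ennreal K * ker x z) * (if dist z w < 64 * t then g z w else 0) \<partial>\<mu>)"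
    proof (rule nn_integral_mono, goal_cases)
      case (1 w)
      show ?case
      proof (cases "dist x w < 21 * t \<and> dist x z < 4 * infdist x F")
        case True
        then have "dist z w < 64 * t" using x(2) dist_triangle[of z w x] t by (simp add: dist_commute)
        then show ?thesis using True by (simp add: g_sym[of w z] mult.assoc)
      qed (auto simp: ker_eq_0)
    qed
    also have "\<dots> = (ennreal K * ker x z) * local_osc f p (64 * t) z"
      unfolding local_osc_def g_def by (rule nn_integral_cmult) measurable
    finally show ?case
      by (simp add: mult.assoc)
  qed
  also have "\<dots> = ennreal K * (\<integral>\<^sup>+z. ker x z * local_osc f p (64 * t) z \<partial>\<mu>)"
    by (rule nn_integral_cmult) measurable
  finally have "Osc f p t x \<le> k * k * (ennreal K * (\<integral>\<^sup>+z. ker x z * local_osc f p (64 * t) z \<partial>\<mu>))"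
    by (simp add: mult_left_mono)
  also have "\<dots> = ennreal ((c ^ 6) powr p * (c ^ 6) powr p * K) * (\<integral>\<^sup>+z. ker x z * local_osc f p (64 * t) z \<partial>\<mu>)"
    using K(1) by (simp add: k_def ennreal_mult mult.assoc)
  finally show ?thesis .
qed

text \<open>The remaining average over \<open>x\<close> is bounded after replacing
  \<open>m_ball x t\<close> by \<open>m_ball z t\<close>, possible since
  \<open>dist x z < 16 * t\<close>. The kernel masses at \<open>5 * t\<close> and
  \<open>4 * t\<close> supply two factors \<open>t powr \<gamma>\<close>, and normalising by
  \<open>m\<close> instead of \<open>\<mu>\<close> cancels one of them.\<close>

lemma near_bound:
  assumes p: "p \<ge> 1"
  shows "\<exists>C\<ge>0. \<forall>f t. locint f \<longrightarrow> 0 < t \<longrightarrow> 5 * t \<le> R \<longrightarrow>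
    (\<integral>\<^sup>+x. (if 0 < infdist x F \<and> infdist x F < 4 * t then inverse (m_ball x t) * Osc f p t x else 0) \<partial>m)
    \<le> ennreal (C * t powr \<gamma>) * Modulus \<mu> f p (64 * t)"
proof -
  obtain K where K: "K \<ge> 0" "\<And>z r. z \<in> F \<Longrightarrow> F \<noteq> {z} \<Longrightarrow> 0 < r \<Longrightarrow> r \<le> R \<Longrightarrow> kernel_mass r z \<le> ennreal (K * r powr \<gamma>)"
    using kernel_mass_codim by blast
  define k where "k = (c ^ 6) powr p * (c ^ 6) powr p"
  have k: "k \<ge> 0" by (simp add: k_def)
  define C where "C = k * (K * 5 powr \<gamma>) * (c ^ 5 * (G * c ^ 6) * (K * 4 powr \<gamma>))"
  have "C \<ge> 0" using c_ge_1 G_ge_1 K(1) k by (simp add: C_def)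
  moreover have "(\<integral>\<^sup>+x. (if 0 < infdist x F \<and> infdist x F < 4 * t then inverse (m_ball x t) * Osc f p t x else 0) \<partial>m)
    \<le> ennreal (C * t powr \<gamma>) * Modulus \<mu> f p (64 * t)"
    if f: "locint f" and t: "0 < t" "5 * t \<le> R" for f t
  proof -
    note [measurable] = locint_measurable[OF f]
    define K5 where "K5 = K * (5 * t) powr \<gamma>"
    have K5: "K5 \<ge> 0" using K(1) by (simp add: K5_def)
    define A where "A x z = (if 0 < infdist x F \<and> infdist x F < 4 * t then inverse (m_ball x t) * ker x z else 0)" for x z
    have [measurable]: "case_prod A \<in> borel_measurable (borel \<Otimes>\<^sub>M borel)" unfolding A_def by measurable
    have [measurable]: "(\<lambda>u. A (a u) (b u)) \<in> borel_measurable N" if [measurable]: "a \<in> measurable N borel" "b \<in> measurable N borel" for a b N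
      unfolding A_def by measurable
    have "(\<integral>\<^sup>+x. (if 0 < infdist x F \<and> infdist x F < 4 * t then inverse (m_ball x t) * Osc f p t x else 0) \<partial>m)
      \<le> (\<integral>\<^sup>+x. ennreal (k * K5) * (\<integral>\<^sup>+z. A x z * local_osc f p (64 * t) z \<partial>\<mu>) \<partial>m)"
    proof (rule nn_integral_mono, goal_cases)
      case (1 x)
      have "inverse (m_ball x t) * Osc f p t x \<le> ennreal (k * K5) * (\<integral>\<^sup>+z. A x z * local_osc f p (64 * t) z \<partial>\<mu>)"
        if x: "0 < infdist x F" "infdist x F < 4 * t"
      proof -
        have xF: "x \<notin> F" using x infdist_pos_iff by simp
        have "Osc f p t x \<le> ennreal (k * K5) * (\<integral>\<^sup>+z. ker x z * local_osc f p (64 * t) z \<partial>\<mu>)"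
          unfolding k_def using K(2) K5 t x xF by (intro near_bound_pointwise f p) (auto simp: K5_def)
        then have "inverse (m_ball x t) * Osc f p t x \<le> inverse (m_ball x t) * (ennreal (k * K5) * (\<integral>\<^sup>+z. ker x z * local_osc f p (64 * t) z \<partial>\<mu>))"
          by (intro mult_left_mono) auto
        also have "\<dots> = ennreal (k * K5) * (inverse (m_ball x t) * (\<integral>\<^sup>+z. ker x z * local_osc f p (64 * t) z \<partial>\<mu>))"
          by (rule mult.left_commute)
        also have "inverse (m_ball x t) * (\<integral>\<^sup>+z. ker x z * local_osc f p (64 * t) z \<partial>\<mu>) = (\<integral>\<^sup>+z. A x z * local_osc f p (64 * t) z \<partial>\<mu>)"
          using x by (subst nn_integral_cmult[symmetric]) (auto simp: A_def mult.assoc)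
        finally show ?thesis .
      qed
      then show ?case by simp
    qed
    also have "\<dots> = ennreal (k * K5) * (\<integral>\<^sup>+x. \<integral>\<^sup>+z. A x z * local_osc f p (64 * t) z \<partial>\<mu> \<partial>m)"
      by (rule nn_integral_cmult) measurable
    also have "\<dots> \<le> ennreal (k * K5) * (ennreal (c ^ 5 * (G * c ^ 6) * (K * 4 powr \<gamma>)) * Modulus \<mu> f p (64 * t))"
    proof (intro mult_left_mono integral_le_Modulus f)
      fix z assume z: "z \<in> F" "F \<noteq> {z}"
      have "(\<integral>\<^sup>+x. A x z \<partial>m) \<le> (\<integral>\<^sup>+x. (ennreal (c ^ 5) * inverse (m_ball z t)) * (if 0 < infdist x F \<and> infdist x F < 4 * t then ker x z else 0) \<partial>m)"
      proof (rule nn_integral_mono, goal_cases)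
        case (1 x)
        show ?case
        proof (cases "0 < infdist x F \<and> infdist x F < 4 * t \<and> dist x z < 4 * infdist x F")
          case True
          have "m_ball z t \<le> m_ball x (2 ^ 5 * t)"
            using True by (intro emeasure_mono ball_subsetI) (auto simp: sets_m)
          also have "\<dots> \<le> ennreal (c ^ 5) * m_ball x t" by (rule m_doubling_iterate[OF t(1)])
          finally have "inverse (m_ball x t) \<le> ennreal (c ^ 5) * inverse (m_ball z t)"
            using c_ge_1 by (intro ennreal_inverse_le_mult) auto
          then show ?thesis using True by (simp add: A_def mult_right_mono)
        qed (auto simp: A_def ker_eq_0)
      qed
      also have "\<dots> = ennreal (c ^ 5) * inverse (m_ball z t) * kernel_mass (4 * t) z"
        unfolding kernel_mass_def by (rule nn_integral_cmult) measurable
      also have "\<dots> \<le> ennreal (c ^ 5) * (ennreal (G * t powr (- \<gamma>)) * (ennreal (c ^ 6) * inverse (mu_ball z (2 ^ 6 * t)))) * ennreal (K * (4 * t) powr \<gamma>)"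
      proof (intro mult_mono)
        have "inverse (m_ball z t) \<le> ennreal (G * t powr (- \<gamma>)) * inverse (mu_ball z t)"
          using codim_lo[OF z t(1)] t G_ge_1 by (intro ennreal_inverse_le_mult) auto
        also have "\<dots> \<le> ennreal (G * t powr (- \<gamma>)) * (ennreal (c ^ 6) * inverse (mu_ball z (2 ^ 6 * t)))"
          by (intro mult_left_mono inverse_mu_ball_le z t) auto
        finally show "inverse (m_ball z t) \<le> ennreal (G * t powr (- \<gamma>)) * (ennreal (c ^ 6) * inverse (mu_ball z (2 ^ 6 * t)))" .
        show "kernel_mass (4 * t) z \<le> ennreal (K * (4 * t) powr \<gamma>)" using t by (intro K(2) z) auto
      qed auto
      also have "\<dots> = ennreal (c ^ 5 * (G * t powr (- \<gamma>) * c ^ 6) * (K * (4 * t) powr \<gamma>)) * inverse (mu_ball z (64 * t))"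
      proof -
        have "ennreal a * (ennreal b * (ennreal d * X)) * ennreal e = ennreal (a * (b * d) * e) * X"
          if "a \<ge> 0" "b \<ge> 0" "d \<ge> 0" "e \<ge> 0" for a b d e X
          using that by (simp add: ennreal_mult ac_simps)
        then show ?thesis using c_ge_1 G_ge_1 K(1) by simp
      qed
      also have "c ^ 5 * (G * t powr (- \<gamma>) * c ^ 6) * (K * (4 * t) powr \<gamma>) = c ^ 5 * (G * c ^ 6) * (K * 4 powr \<gamma>)"
        using t by (simp add: powr_mult powr_minus field_simps)
      finally show "(\<integral>\<^sup>+x. A x z \<partial>m) \<le> ennreal (c ^ 5 * (G * c ^ 6) * (K * 4 powr \<gamma>)) * inverse (mu_ball z (64 * t))" .
    qed auto
    also have "\<dots> = ennreal (k * K5 * (c ^ 5 * (G * c ^ 6) * (K * 4 powr \<gamma>))) * Modulus \<mu> f p (64 * t)"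
    proof -
      have "ennreal a * (ennreal b * X) = ennreal (a * b) * X" if "a \<ge> 0" "b \<ge> 0" for a b X
        using that by (simp add: ennreal_mult mult.assoc)
      then show ?thesis using c_ge_1 G_ge_1 K(1) k K5 by simp
    qed
    also have "k * K5 * (c ^ 5 * (G * c ^ 6) * (K * 4 powr \<gamma>)) = C * t powr \<gamma>"
      using t by (simp add: C_def K5_def powr_mult)
    finally show ?thesis .
  qed
  ultimately show ?thesis by blast
qed

section \<open>Size and trace of the averaged function\<close>

lemma Lp_bound:
  assumes p: "p \<ge> 1"
  shows "\<exists>C\<ge>0. \<forall>f. locint f \<longrightarrow> (\<integral>\<^sup>+x. (if 0 < infdist x F \<and> infdist x F < R then ennreal (\<bar>E1 f x\<bar> powr p) else 0) \<partial>m)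
     \<le> ennreal C * (Lp_pow \<mu> p f)"
proof -
  obtain L where L: "L \<ge> 0" "\<And>z. z \<in> F \<Longrightarrow> kernel_mass R z \<le> ennreal L" using kernel_mass_bounded by blast
  define k where "k = (c ^ 6) powr p"
  have "(\<integral>\<^sup>+x. (if 0 < infdist x F \<and> infdist x F < R then ennreal (\<bar>E1 f x\<bar> powr p) else 0) \<partial>m)
     \<le> ennreal (k * L) * (Lp_pow \<mu> p f)" if f: "locint f" for f
  proof -
    note [measurable] = locint_measurable[OF f]
    define A where "A x z = (if 0 < infdist x F \<and> infdist x F < R then ker x z else 0)" for x z
    have [measurable]: "(\<lambda>u. A (a u) (b u)) \<in> borel_measurable N" if [measurable]: "a \<in> measurable N borel" "b \<in> measurable N borel" for a b N
      unfolding A_def by measurable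
    have "(\<integral>\<^sup>+x. (if 0 < infdist x F \<and> infdist x F < R then ennreal (\<bar>E1 f x\<bar> powr p) else 0) \<partial>m)
      \<le> (\<integral>\<^sup>+x. ennreal k * (\<integral>\<^sup>+z. A x z * ennreal (\<bar>f z\<bar> powr p) \<partial>\<mu>) \<partial>m)"
      using E0_pow[OF f _ p, of _ 0] infdist_pos_iff
      by (intro nn_integral_mono) (auto simp: A_def E1_def k_def)
    also have "\<dots> = ennreal k * (\<integral>\<^sup>+x. \<integral>\<^sup>+z. A x z * ennreal (\<bar>f z\<bar> powr p) \<partial>\<mu> \<partial>m)"
      by (rule nn_integral_cmult) measurable
    also have "(\<integral>\<^sup>+x. \<integral>\<^sup>+z. A x z * ennreal (\<bar>f z\<bar> powr p) \<partial>\<mu> \<partial>m) = (\<integral>\<^sup>+z. \<integral>\<^sup>+x. A x z * ennreal (\<bar>f z\<bar> powr p) \<partial>m \<partial>\<mu>)"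
      by (rule m_mu.Fubini'[symmetric]) measurable
    also have "\<dots> = (\<integral>\<^sup>+z. kernel_mass R z * ennreal (\<bar>f z\<bar> powr p) \<partial>\<mu>)"
      unfolding kernel_mass_def A_def by (intro nn_integral_cong nn_integral_multc) measurable
    also have "\<dots> \<le> (\<integral>\<^sup>+z. ennreal L * ennreal (\<bar>f z\<bar> powr p) \<partial>\<mu>)"
      using AE_mu_in_F by (intro nn_integral_mono_AE) (auto elim!: eventually_mono intro!: mult_right_mono L(2))
    also have "\<dots> = ennreal L * (Lp_pow \<mu> p f)"
      by (rule nn_integral_cmult) measurable
    finally show ?thesis using L(1) by (simp add: ennreal_mult k_def mult.assoc mult_left_mono)
  qed
  moreover have "k * L \<ge> 0" using L(1) by (simp add: k_def)
  ultimately show ?thesis by blast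
qed

text \<open>Tonelli leaves \<open>kernel_mass r z\<close> for \<open>z\<close> within
  \<open>8 * r\<close> of \<open>t\<close>, which by doubling is bounded by a multiple of the ratio
  of the measures at \<open>t\<close>. The ratio is kept as it stands so that its
  \<open>\<mu>\<close>-part can cancel against the estimate at a Lebesgue point.\<close>

lemma trace_bound:
  "\<exists>C\<ge>0. \<forall>f t r. locint f \<longrightarrow> t \<in> F \<longrightarrow> 0 < r \<longrightarrow> r \<le> R \<longrightarrow>
    (\<integral>\<^sup>+x. (if dist t x < r \<and> x \<notin> F then ennreal \<bar>E1 f x - f t\<bar> else 0) \<partial>m)
    \<le> ennreal C * (m_ball t r * inverse (mu_ball t (8 * r))) * (\<integral>\<^sup>+z\<in>ball t (8 * r). ennreal \<bar>f z - f t\<bar> \<partial>\<mu>)"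
proof -
  obtain H where H: "H \<ge> 0" "\<And>z r. z \<in> F \<Longrightarrow> 0 < r \<Longrightarrow> r \<le> R \<Longrightarrow> kernel_mass r z \<le> ennreal H * (m_ball z r * inverse (mu_ball z r))"
    using kernel_mass_ratio by blast
  have "(\<integral>\<^sup>+x. (if dist t x < r \<and> x \<notin> F then ennreal \<bar>E1 f x - f t\<bar> else 0) \<partial>m)
    \<le> ennreal (H * (c ^ 4 * c ^ 4)) * (m_ball t r * inverse (mu_ball t (8 * r))) * (\<integral>\<^sup>+z\<in>ball t (8 * r). ennreal \<bar>f z - f t\<bar> \<partial>\<mu>)"
    if f: "locint f" and t: "t \<in> F" and r: "0 < r" "r \<le> R" for f t r
  proof -
    note [measurable] = locint_measurable[OF f]
    define A where "A x z = (if 0 < infdist x F \<and> infdist x F < r then ker x z else 0)" for x z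
    have [measurable]: "(\<lambda>u. A (a u) (b u)) \<in> borel_measurable N" if [measurable]: "a \<in> measurable N borel" "b \<in> measurable N borel" for a b N
      unfolding A_def by measurable
    define g where "g z = ennreal \<bar>f z - f t\<bar> * indicator (ball t (8 * r)) z" for z
    have [measurable]: "g \<in> borel_measurable borel" unfolding g_def by measurable
    define S where "S = m_ball t r * inverse (mu_ball t (8 * r))"
    have "(\<integral>\<^sup>+x. (if dist t x < r \<and> x \<notin> F then ennreal \<bar>E1 f x - f t\<bar> else 0) \<partial>m) \<le> (\<integral>\<^sup>+x. \<integral>\<^sup>+z. A x z * g z \<partial>\<mu> \<partial>m)"
    proof (rule nn_integral_mono, goal_cases)
      case (1 x)
      have "ennreal \<bar>E1 f x - f t\<bar> \<le> (\<integral>\<^sup>+z. A x z * g z \<partial>\<mu>)" if x: "dist t x < r" "x \<notin> F"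
      proof -
        have d: "infdist x F < r" "0 < infdist x F"
          using infdist_le[OF t, of x] x infdist_pos by (auto simp: dist_commute)
        have "ennreal \<bar>E1 f x - f t\<bar> \<le> (\<integral>\<^sup>+z. ker x z * ennreal \<bar>f z - f t\<bar> \<partial>\<mu>)"
          using E0_le[OF f x(2)] x(2) by (simp add: E1_def)
        also have "\<dots> \<le> (\<integral>\<^sup>+z. A x z * g z \<partial>\<mu>)"
        proof (rule nn_integral_mono, goal_cases)
          case (1 z)
          show ?case
          proof (cases "dist x z < 4 * infdist x F")
            case True
            then have "dist t z < 8 * r" using d x dist_triangle[of t z x] by linarith
            then show ?thesis using d by (simp add: A_def g_def)
          qed (simp add: ker_eq_0)
        qed
        finally show ?thesis .
      qed
      then show ?case by simp
    qed
    also have "\<dots> = (\<integral>\<^sup>+z. \<integral>\<^sup>+x. A x z * g z \<partial>m \<partial>\<mu>)"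
      by (rule m_mu.Fubini'[symmetric]) measurable
    also have "\<dots> = (\<integral>\<^sup>+z. kernel_mass r z * g z \<partial>\<mu>)"
      unfolding kernel_mass_def A_def by (intro nn_integral_cong nn_integral_multc) measurable
    also have "\<dots> \<le> (\<integral>\<^sup>+z. ennreal (H * (c ^ 4 * c ^ 4)) * S * g z \<partial>\<mu>)"
    proof (rule nn_integral_mono_AE, use AE_mu_in_F in eventually_elim)
      case z: (elim z)
      show ?case
      proof (cases "dist t z < 8 * r")
        case True
        have "m_ball z r \<le> m_ball t (2 ^ 4 * r)"
          using True r by (intro emeasure_mono ball_subsetI) (auto simp: sets_m)
        also have "\<dots> \<le> ennreal (c ^ 4) * m_ball t r" by (rule m_doubling_iterate[OF r(1)])
        finally have 1: "m_ball z r \<le> ennreal (c ^ 4) * m_ball t r" .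
        have "mu_ball t (8 * r) \<le> mu_ball z (2 ^ 4 * r)"
          using True r by (intro emeasure_mono ball_subsetI) (auto simp: sets_mu dist_commute)
        also have "\<dots> \<le> ennreal (c ^ 4) * mu_ball z r" by (rule mu_doubling_iterate[OF z r(1)])
        finally have 2: "inverse (mu_ball z r) \<le> ennreal (c ^ 4) * inverse (mu_ball t (8 * r))"
          using c_ge_1 by (intro ennreal_inverse_le_mult) auto
        have "kernel_mass r z \<le> ennreal H * ((ennreal (c ^ 4) * m_ball t r) * (ennreal (c ^ 4) * inverse (mu_ball t (8 * r))))"
          using 1 2 by (intro order_trans[OF H(2)[OF z r]] mult_mono) auto
        also have "\<dots> = ennreal (H * (c ^ 4 * c ^ 4)) * S"
        proof -
          have "ennreal a * ((ennreal b * X) * (ennreal b * Y)) = ennreal (a * (b * b)) * (X * Y)" if "a \<ge> 0" "b \<ge> 0" for a b X Y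
            using that by (simp add: ennreal_mult ac_simps)
          then show ?thesis unfolding S_def using H(1) c_ge_1 by simp
        qed
        finally show ?thesis by (intro mult_right_mono) auto
      qed (simp add: g_def)
    qed
    also have "\<dots> = ennreal (H * (c ^ 4 * c ^ 4)) * S * (\<integral>\<^sup>+z. g z \<partial>\<mu>)"
      by (rule nn_integral_cmult) measurable
    finally show ?thesis by (simp add: S_def g_def)
  qed
  moreover have "H * (c ^ 4 * c ^ 4) \<ge> 0" using H(1) c_ge_1 by simp
  ultimately show ?thesis by blast
qed

end

section \<open>The extension operator\<close>

lemma abs_diff_powr_le:
  fixes a b p :: real
  assumes "p \<ge> 0"
  shows "\<bar>a - b\<bar> powr p \<le> 2 powr p * (\<bar>a\<bar> powr p + \<bar>b\<bar> powr p)"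
proof -
  have "\<bar>a - b\<bar> powr p \<le> (\<bar>a\<bar> + \<bar>b\<bar>) powr p" using assms by (intro powr_mono2) auto
  also have "\<dots> \<le> 2 powr p * (\<bar>a\<bar> powr p + \<bar>b\<bar> powr p)" using assms by (intro powr_add_le) auto
  finally show ?thesis .
qed

context trace_codim
begin

text \<open>Kernel bounds are available up to scale \<open>R\<close> only. Vanishing from distance
  \<open>R / 4\<close> on keeps the shells in use below that scale; the plateau up to
  \<open>R / 8\<close> leaves the trace unchanged.\<close>

definition cut :: "'a \<Rightarrow> real"
  where "cut x = max 0 (min 1 (2 - infdist x F / (R / 8)))"

definition Ext :: "('a \<Rightarrow> real) \<Rightarrow> 'a \<Rightarrow> real"
  where "Ext f x = cut x * E1 f x"

lemma cut_bounds: "0 \<le> cut x" "cut x \<le> 1"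
  by (auto simp: cut_def)

lemma cut_eq_0: "R / 4 \<le> infdist x F \<Longrightarrow> cut x = 0"
  using R_pos by (simp add: cut_def field_simps)

lemma cut_eq_1: "infdist x F \<le> R / 8 \<Longrightarrow> cut x = 1"
  using R_pos by (simp add: cut_def field_simps)

lemma cut_lip: "\<bar>cut y - cut x\<bar> \<le> dist x y / (R / 8)"
proof -
  have "\<bar>max 0 (min 1 (2 - u)) - max 0 (min 1 (2 - v))\<bar> \<le> \<bar>u - v\<bar>" for u v :: real
    by (auto simp: max_def min_def abs_real_def)
  then have "\<bar>cut y - cut x\<bar> \<le> \<bar>infdist y F / (R / 8) - infdist x F / (R / 8)\<bar>" by (simp only: cut_def)
  also have "\<dots> = \<bar>infdist y F - infdist x F\<bar> / (R / 8)"
    using R_pos by (simp only: diff_divide_distrib[symmetric] abs_divide)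
  also have "\<dots> \<le> dist x y / (R / 8)"
    using infdist_diff_le[of y x] R_pos by (intro divide_right_mono) (auto simp: dist_commute)
  finally show ?thesis .
qed

lemma measurable_cut [measurable]:
  assumes [measurable]: "g \<in> measurable K borel"
  shows "(\<lambda>x. cut (g x)) \<in> borel_measurable K"
  unfolding cut_def by measurable

lemma measurable_Ext:
  assumes "locint f" and [measurable]: "g \<in> measurable K borel"
  shows "(\<lambda>x. Ext f (g x)) \<in> borel_measurable K"
proof -
  note [measurable] = measurable_E1[OF assms(1)]
  show ?thesis unfolding Ext_def by measurable
qed

text \<open>After Tonelli this rests on the comparability of the \<open>m\<close>-measures of balls
  of radius \<open>t\<close> about points at distance less than \<open>t\<close>.\<close>

lemma average_bound:
  assumes [measurable]: "v \<in> borel_measurable borel" and t: "t > 0"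
  shows "(\<integral>\<^sup>+x. (\<integral>\<^sup>+y. (if dist x y < t then v y else 0) \<partial>m) * inverse (m_ball x t) \<partial>m) \<le> ennreal c * (\<integral>\<^sup>+y. v y \<partial>m)"
proof -
  have "(\<integral>\<^sup>+x. (\<integral>\<^sup>+y. (if dist x y < t then v y else 0) \<partial>m) * inverse (m_ball x t) \<partial>m)
     = (\<integral>\<^sup>+x. \<integral>\<^sup>+y. (if dist x y < t then v y else 0) * inverse (m_ball x t) \<partial>m \<partial>m)"
    by (intro nn_integral_cong nn_integral_multc[symmetric]) measurable
  also have "\<dots> = (\<integral>\<^sup>+y. \<integral>\<^sup>+x. (if dist x y < t then v y else 0) * inverse (m_ball x t) \<partial>m \<partial>m)"
    by (rule m_m.Fubini'[symmetric]) measurable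
  also have "\<dots> \<le> (\<integral>\<^sup>+y. ennreal c * v y \<partial>m)"
  proof (rule nn_integral_mono, goal_cases)
    case (1 y)
    have "(\<integral>\<^sup>+x. (if dist x y < t then v y else 0) * inverse (m_ball x t) \<partial>m)
       \<le> (\<integral>\<^sup>+x. (v y * (ennreal c * inverse (m_ball y t))) * indicator (ball y t) x \<partial>m)"
    proof (rule nn_integral_mono, goal_cases)
      case (1 x)
      show ?case
      proof (cases "dist x y < t")
        case True
        have "m_ball y t \<le> m_ball x (2 * t)"
          using True by (intro emeasure_mono ball_subsetI) (auto simp: sets_m)
        also have "\<dots> \<le> ennreal c * m_ball x t" by (rule m_dbl[OF t])
        finally have "inverse (m_ball x t) \<le> ennreal c * inverse (m_ball y t)"
          using c_ge_1 by (intro ennreal_inverse_le_mult) auto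
        then show ?thesis using True by (simp add: dist_commute mult_left_mono)
      qed simp
    qed
    also have "\<dots> = v y * (ennreal c * (inverse (m_ball y t) * m_ball y t))"
      by (subst nn_integral_cmult_indicator) (simp_all add: sets_m mult.assoc)
    finally show ?case
      by (simp only: m_ball_inverse[OF t] mult.right_neutral mult.commute[of "v y"])
  qed
  also have "\<dots> = ennreal c * (\<integral>\<^sup>+y. v y \<partial>m)" by (rule nn_integral_cmult) measurable
  finally show ?thesis .
qed

lemma Lp_Ext:
  assumes p: "p \<ge> 1"
  shows "\<exists>C\<ge>0. \<forall>f. locint f \<longrightarrow> (Lp_pow m p (Ext f)) \<le> ennreal C * (Lp_pow \<mu> p f)"
proof -
  have "(Lp_pow m p (Ext f)) \<le> (\<integral>\<^sup>+x. (if 0 < infdist x F \<and> infdist x F < R then ennreal (\<bar>E1 f x\<bar> powr p) else 0) \<partial>m)" for f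
  proof (rule nn_integral_mono_AE, use AE_m_notin_F in eventually_elim)
    case (elim x)
    show ?case
    proof (cases "infdist x F < R")
      case True
      have "\<bar>Ext f x\<bar> powr p \<le> \<bar>E1 f x\<bar> powr p"
        using cut_bounds[of x] p by (intro powr_mono2) (auto simp: Ext_def abs_mult intro: mult_left_le_one_le)
      then show ?thesis using True infdist_pos[OF elim] by (simp add: ennreal_leI)
    next
      case False
      then have "cut x = 0" using R_pos by (intro cut_eq_0) simp
      then show ?thesis by (simp add: Ext_def)
    qed
  qed
  then show ?thesis using Lp_bound[OF p] by (meson order_trans)
qed

text \<open>Used for \<open>t \<ge> R / 8\<close>, where size alone suffices. In
  \<open>c + 1\<close> the summand 1 comes from the value at the center, \<open>c\<close> from the
  averages.\<close>

lemma Modulus_Ext_large: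
  assumes p: "p \<ge> 1" and f: "locint f" and t: "t > 0"
  shows "Modulus m (Ext f) p t \<le> ennreal (2 powr p * (c + 1)) * (Lp_pow m p (Ext f))"
proof -
  note [measurable] = measurable_Ext[OF f]
  define v where "v x = ennreal (\<bar>Ext f x\<bar> powr p)" for x
  have [measurable]: "(\<lambda>x. v (a x)) \<in> borel_measurable N" if [measurable]: "a \<in> measurable N borel" for a N
    unfolding v_def by measurable
  have "Modulus m (Ext f) p t \<le> (\<integral>\<^sup>+x. ennreal (2 powr p) * ((\<integral>\<^sup>+y. (if dist x y < t then v y else 0) \<partial>m) * inverse (m_ball x t) + v x) \<partial>m)"
    unfolding Modulus_def
  proof (rule nn_integral_mono, goal_cases)
    case (1 x)
    have "(\<integral>\<^sup>+y. (if dist x y < t then ennreal (\<bar>Ext f y - Ext f x\<bar> powr p) else 0) \<partial>m)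
       \<le> (\<integral>\<^sup>+y. ennreal (2 powr p) * ((if dist x y < t then v y else 0) + v x * indicator (ball x t) y) \<partial>m)"
    proof (rule nn_integral_mono, goal_cases)
      case (1 y)
      have "ennreal (\<bar>Ext f y - Ext f x\<bar> powr p) \<le> ennreal (2 powr p * (\<bar>Ext f y\<bar> powr p + \<bar>Ext f x\<bar> powr p))"
        using p by (intro ennreal_leI abs_diff_powr_le) auto
      also have "\<dots> = ennreal (2 powr p) * (v y + v x)" by (simp add: v_def ennreal_mult)
      finally show ?case
        by (cases "dist x y < t") auto
    qed
    also have "\<dots> = ennreal (2 powr p) * ((\<integral>\<^sup>+y. (if dist x y < t then v y else 0) \<partial>m) + v x * m_ball x t)"
      by (simp add: nn_integral_cmult nn_integral_add nn_integral_cmult_indicator sets_m)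
    finally have "(\<integral>\<^sup>+y. (if dist x y < t then ennreal (\<bar>Ext f y - Ext f x\<bar> powr p) else 0) \<partial>m) * inverse (m_ball x t)
      \<le> ennreal (2 powr p) * ((\<integral>\<^sup>+y. (if dist x y < t then v y else 0) \<partial>m) + v x * m_ball x t) * inverse (m_ball x t)"
      by (intro mult_right_mono) auto
    also have "\<dots> = ennreal (2 powr p) * ((\<integral>\<^sup>+y. (if dist x y < t then v y else 0) \<partial>m) * inverse (m_ball x t) + v x * (inverse (m_ball x t) * m_ball x t))"
      by (simp add: distrib_right distrib_left ac_simps)
    finally show ?case
      by (simp add: m_ball_inverse[OF t])
  qed
  also have "\<dots> = ennreal (2 powr p) * ((\<integral>\<^sup>+x. (\<integral>\<^sup>+y. (if dist x y < t then v y else 0) \<partial>m) * inverse (m_ball x t) \<partial>m) + (\<integral>\<^sup>+x. v x \<partial>m))"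
    by (subst nn_integral_cmult, measurable) (subst nn_integral_add, auto)
  also have "\<dots> \<le> ennreal (2 powr p) * (ennreal c * (\<integral>\<^sup>+x. v x \<partial>m) + (\<integral>\<^sup>+x. v x \<partial>m))"
    by (intro mult_left_mono add_right_mono average_bound t) auto
  also have "\<dots> = ennreal (2 powr p * (c + 1)) * (\<integral>\<^sup>+x. v x \<partial>m)"
    using c_ge_1 by (simp add: ennreal_mult ennreal_plus distrib_right mult.assoc del: ennreal_plus_if)
  finally show ?thesis by (simp add: v_def)
qed

text \<open>The difference of the products is split so that the oscillation of \<open>E1\<close>
  carries the factor \<open>cut x\<close>, hence is confined to \<open>infdist x F < R / 4\<close>,
  and \<open>E1 f y\<close> carries the difference of the cutoffs, at most \<open>t / r\<close> for
  \<open>r = R / 8\<close>. The second part gives \<open>t powr p\<close> times the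
  \<open>p\<close>-th power of the \<open>L^p\<close> norm.\<close>

lemma Modulus_Ext_small:
  assumes p: "p \<ge> 1"
  shows "\<exists>C\<ge>0. \<forall>f t. locint f \<longrightarrow> 0 < t \<longrightarrow> t < R / 8 \<longrightarrow> Modulus m (Ext f) p t \<le>
    ennreal C * ((dyadic_sum p \<gamma> (Modulus \<mu> f p) t)
      + ennreal (t powr p) * (Lp_pow \<mu> p f))"
proof -
  obtain C1 where C1: "C1 \<ge> 0" "\<And>f t \<rho>. locint f \<Longrightarrow> 0 < t \<Longrightarrow> 2 * \<rho> \<le> R \<Longrightarrow>
    (\<integral>\<^sup>+x. (if 4 * t \<le> infdist x F \<and> infdist x F < \<rho> then inverse (m_ball x t) * Osc f p t x else 0) \<partial>m)
    \<le> ennreal C1 * (dyadic_sum p \<gamma> (Modulus \<mu> f p) t)"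
    using far_bound[OF p] by blast
  obtain C2 where C2: "C2 \<ge> 0" "\<And>f t. locint f \<Longrightarrow> 0 < t \<Longrightarrow> 5 * t \<le> R \<Longrightarrow>
    (\<integral>\<^sup>+x. (if 0 < infdist x F \<and> infdist x F < 4 * t then inverse (m_ball x t) * Osc f p t x else 0) \<partial>m)
    \<le> ennreal (C2 * t powr \<gamma>) * Modulus \<mu> f p (64 * t)"
    using near_bound[OF p] by blast
  obtain C3 where C3: "C3 \<ge> 0" "\<And>f. locint f \<Longrightarrow> (\<integral>\<^sup>+x. (if 0 < infdist x F \<and> infdist x F < R then ennreal (\<bar>E1 f x\<bar> powr p) else 0) \<partial>m)
     \<le> ennreal C3 * (Lp_pow \<mu> p f)"
    using Lp_bound[OF p] by blast
  define r where "r = R / 8"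
  have r: "r > 0" using R_pos by (simp add: r_def)
  define C where "C = 2 powr p * (C1 + C2 + (1 / r) powr p * (c * C3))"
  have C0: "0 \<le> C1 + C2" "0 \<le> (1 / r) powr p * (c * C3)" using C1 C2 C3 c_ge_1 by auto
  have "C \<ge> 0" using C0 by (simp add: C_def)
  moreover have "Modulus m (Ext f) p t \<le> ennreal C * ((dyadic_sum p \<gamma> (Modulus \<mu> f p) t)
      + ennreal (t powr p) * (Lp_pow \<mu> p f))"
    if f: "locint f" and t: "0 < t" "t < r" for f t
  proof -
    note [measurable] = locint_measurable[OF f] measurable_E1[OF f] measurable_Ext[OF f] measurable_Osc[OF f]
    define S where "S = (dyadic_sum p \<gamma> (Modulus \<mu> f p) t)"
    define N where "N = (Lp_pow \<mu> p f)"
    define v where "v y = (if 0 < infdist y F \<and> infdist y F < R then ennreal (\<bar>E1 f y\<bar> powr p) else 0)" for y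
    have [measurable]: "(\<lambda>x. v (a x)) \<in> borel_measurable N" if [measurable]: "a \<in> measurable N borel" for a N
      unfolding v_def by measurable
    define b where "b = ennreal ((t / r) powr p)"
    define g where "g x = inverse (m_ball x t) * Osc f p t x" for x
    have [measurable]: "g \<in> borel_measurable borel" unfolding g_def by measurable
    define A where "A x = (\<integral>\<^sup>+y. (if dist x y < t then v y else 0) \<partial>m) * inverse (m_ball x t)" for x
    have [measurable]: "A \<in> borel_measurable borel" unfolding A_def by measurable
    have "Modulus m (Ext f) p t \<le> (\<integral>\<^sup>+x. ennreal (2 powr p) * (((if 4 * t \<le> infdist x F \<and> infdist x F < 2 * r then g x else 0)
       + (if 0 < infdist x F \<and> infdist x F < 4 * t then g x else 0)) + b * A x) \<partial>m)"
      unfolding Modulus_def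
    proof (rule nn_integral_mono_AE, use AE_m_notin_F in eventually_elim)
      case (elim x)
      \<comment> \<open>Records where \<open>cut x\<close> can be nonzero, since
        \<open>2 * r = R / 4\<close>.\<close>
      define e where "e = (if infdist x F < 2 * r then 1 else 0 :: ennreal)"
      have "(\<integral>\<^sup>+y. (if dist x y < t then ennreal (\<bar>Ext f y - Ext f x\<bar> powr p) else 0) \<partial>m)
         \<le> (\<integral>\<^sup>+y. ennreal (2 powr p) * (e * (if dist x y < t \<and> y \<notin> F then ennreal (\<bar>E1 f y - E1 f x\<bar> powr p) else 0)
            + b * (if dist x y < t then v y else 0)) \<partial>m)"
      proof (rule nn_integral_mono_AE, use AE_m_notin_F in eventually_elim)
        case y: (elim y)
        have "ennreal (\<bar>Ext f y - Ext f x\<bar> powr p) \<le> ennreal (2 powr p) * (e * ennreal (\<bar>E1 f y - E1 f x\<bar> powr p) + b * v y)"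
          if d: "dist x y < t"
        proof -
          have eq: "Ext f y - Ext f x = cut x * (E1 f y - E1 f x) - (cut x - cut y) * E1 f y"
            by (simp add: Ext_def algebra_simps)
          have "ennreal (\<bar>Ext f y - Ext f x\<bar> powr p) \<le> ennreal (2 powr p * (\<bar>cut x * (E1 f y - E1 f x)\<bar> powr p + \<bar>(cut x - cut y) * E1 f y\<bar> powr p))"
            unfolding eq using p by (intro ennreal_leI abs_diff_powr_le) auto
          also have "\<dots> = ennreal (2 powr p) * (ennreal (\<bar>cut x * (E1 f y - E1 f x)\<bar> powr p) + ennreal (\<bar>(cut x - cut y) * E1 f y\<bar> powr p))"
            by (simp add: ennreal_mult)
          also have "\<dots> \<le> ennreal (2 powr p) * (e * ennreal (\<bar>E1 f y - E1 f x\<bar> powr p) + b * v y)"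
          proof (intro mult_left_mono add_mono)
            show "ennreal (\<bar>cut x * (E1 f y - E1 f x)\<bar> powr p) \<le> e * ennreal (\<bar>E1 f y - E1 f x\<bar> powr p)"
            proof (cases "infdist x F < 2 * r")
              case True
              have "\<bar>cut x * (E1 f y - E1 f x)\<bar> powr p \<le> \<bar>E1 f y - E1 f x\<bar> powr p"
                using cut_bounds[of x] p by (intro powr_mono2) (auto simp: abs_mult intro: mult_left_le_one_le)
              then show ?thesis using True by (simp add: e_def ennreal_leI)
            next
              case False
              then have "cut x = 0" by (intro cut_eq_0) (simp add: r_def)
              then show ?thesis by simp
            qed
            show "ennreal (\<bar>(cut x - cut y) * E1 f y\<bar> powr p) \<le> b * v y"
            proof (cases "infdist y F < R")
              case True
              have "\<bar>cut x - cut y\<bar> \<le> t / r"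
                using cut_lip[of x y] divide_right_mono[of "dist x y" t r] d r by (simp add: r_def dist_commute)
              then have "\<bar>(cut x - cut y) * E1 f y\<bar> \<le> t / r * \<bar>E1 f y\<bar>"
                unfolding abs_mult by (intro mult_right_mono) auto
              then have "\<bar>(cut x - cut y) * E1 f y\<bar> powr p \<le> (t / r * \<bar>E1 f y\<bar>) powr p"
                using p by (intro powr_mono2) auto
              also have "\<dots> = (t / r) powr p * \<bar>E1 f y\<bar> powr p" using t r powr_mult[of "t / r" "\<bar>E1 f y\<bar>" p] by simp
              finally show ?thesis
                using True infdist_pos[OF y] by (simp add: b_def v_def ennreal_mult[symmetric] ennreal_leI)
            next
              case False
              \<comment> \<open>Because \<open>t < R / 8\<close>, both cutoffs vanish when
                \<open>y\<close> is at distance at least \<open>R\<close> from \<open>F\<close>;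
                this justifies the truncation in \<open>v\<close>.\<close>
              then have "R / 4 \<le> infdist y F" "R / 4 \<le> infdist x F"
                using infdist_diff_le[of x y] d t R_pos by (auto simp: r_def)
              then have "cut x = 0" "cut y = 0" by (auto intro: cut_eq_0)
              then show ?thesis by simp
            qed
          qed auto
          finally show ?thesis .
        qed
        then show ?case using y by simp
      qed
      also have "\<dots> = ennreal (2 powr p) * (e * Osc f p t x + b * (\<integral>\<^sup>+y. (if dist x y < t then v y else 0) \<partial>m))"
        unfolding Osc_def by (simp add: nn_integral_cmult nn_integral_add)
      finally have "(\<integral>\<^sup>+y. (if dist x y < t then ennreal (\<bar>Ext f y - Ext f x\<bar> powr p) else 0) \<partial>m) * inverse (m_ball x t)
        \<le> ennreal (2 powr p) * (e * Osc f p t x + b * (\<integral>\<^sup>+y. (if dist x y < t then v y else 0) \<partial>m)) * inverse (m_ball x t)"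
        by (intro mult_right_mono) auto
      also have "\<dots> = ennreal (2 powr p) * (e * g x + b * A x)"
        by (simp add: A_def g_def distrib_right distrib_left ac_simps)
      also have "\<dots> \<le> ennreal (2 powr p) * (((if 4 * t \<le> infdist x F \<and> infdist x F < 2 * r then g x else 0)
       + (if 0 < infdist x F \<and> infdist x F < 4 * t then g x else 0)) + b * A x)"
        using infdist_pos[OF elim] by (intro mult_left_mono add_right_mono) (auto simp: e_def)
      finally show ?case .
    qed
    also have "\<dots> = ennreal (2 powr p) * ((\<integral>\<^sup>+x. (if 4 * t \<le> infdist x F \<and> infdist x F < 2 * r then g x else 0) \<partial>m)
       + (\<integral>\<^sup>+x. (if 0 < infdist x F \<and> infdist x F < 4 * t then g x else 0) \<partial>m) + b * (\<integral>\<^sup>+x. A x \<partial>m))"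
      by (simp add: nn_integral_cmult nn_integral_add)
    also have "\<dots> \<le> ennreal (2 powr p) * (ennreal C1 * S + ennreal C2 * S + b * (ennreal (c * C3) * N))"
    proof (intro mult_left_mono add_mono)
      show "(\<integral>\<^sup>+x. (if 4 * t \<le> infdist x F \<and> infdist x F < 2 * r then g x else 0) \<partial>m) \<le> ennreal C1 * S"
        unfolding S_def g_def using R_pos by (intro C1 f t) (simp add: r_def)
      have "(\<integral>\<^sup>+x. (if 0 < infdist x F \<and> infdist x F < 4 * t then g x else 0) \<partial>m) \<le> ennreal (C2 * t powr \<gamma>) * Modulus \<mu> f p (64 * t)"
        unfolding g_def using t by (intro C2 f) (auto simp: r_def)
      \<comment> \<open>The near part is a multiple of the term \<open>j = 0\<close> of the dyadic
        sum.\<close>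
      also have "\<dots> = ennreal C2 * (\<Sum>j\<in>{0}. ennreal (((1/2) ^ j) powr p * (2 ^ j * t) powr \<gamma>) * Modulus \<mu> f p (64 * (2 ^ j * t)))"
        using C2(1) by (simp add: ennreal_mult mult.assoc)
      also have "\<dots> \<le> ennreal C2 * S"
        unfolding S_def by (intro mult_left_mono sum_le_suminf summableI) auto
      finally show "(\<integral>\<^sup>+x. (if 0 < infdist x F \<and> infdist x F < 4 * t then g x else 0) \<partial>m) \<le> ennreal C2 * S" .
      have "(\<integral>\<^sup>+x. A x \<partial>m) \<le> ennreal c * (\<integral>\<^sup>+y. v y \<partial>m)"
        unfolding A_def by (intro average_bound t) auto
      also have "\<dots> \<le> ennreal c * (ennreal C3 * N)"
        unfolding v_def N_def by (intro mult_left_mono C3 f) auto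
      finally show "(\<integral>\<^sup>+x. A x \<partial>m) \<le> ennreal (c * C3) * N"
        using c_ge_1 C3(1) by (simp add: ennreal_mult mult.assoc)
    qed auto
    also have "\<dots> \<le> ennreal C * (S + ennreal (t powr p) * N)"
    proof -
      have b: "b = ennreal ((1 / r) powr p) * ennreal (t powr p)"
        using t r powr_mult[of "1 / r" t p] by (simp add: b_def flip: ennreal_mult)
      define d where "d = (1 / r) powr p * (c * C3)"
      have d: "d \<ge> 0" using C0(2) by (simp add: d_def)
      have "ennreal C1 * S + ennreal C2 * S + b * (ennreal (c * C3) * N) = ennreal (C1 + C2) * S + ennreal d * (ennreal (t powr p) * N)"
      proof (rule arg_cong2[where f = "(+)"])
        show "ennreal C1 * S + ennreal C2 * S = ennreal (C1 + C2) * S"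
          using C1(1) C2(1) by (simp add: ennreal_plus distrib_right del: ennreal_plus_if)
        show "b * (ennreal (c * C3) * N) = ennreal d * (ennreal (t powr p) * N)"
          using C3(1) c_ge_1 by (simp add: b d_def ennreal_mult ac_simps)
      qed
      also have "\<dots> \<le> ennreal (C1 + C2 + d) * S + ennreal (C1 + C2 + d) * (ennreal (t powr p) * N)"
        using C0(1) d by (intro add_mono[of "_ * S"] mult_right_mono ennreal_leI) simp_all
      also have "\<dots> = ennreal (C1 + C2 + d) * (S + ennreal (t powr p) * N)" by (simp add: distrib_left)
      finally have "ennreal (2 powr p) * (ennreal C1 * S + ennreal C2 * S + b * (ennreal (c * C3) * N)) \<le> ennreal (2 powr p) * (ennreal (C1 + C2 + d) * (S + ennreal (t powr p) * N))"
        by (intro mult_left_mono) auto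
      also have "\<dots> = ennreal C * (S + ennreal (t powr p) * N)"
        using C0 d by (simp add: C_def d_def ennreal_mult mult.assoc)
      finally show ?thesis .
    qed
    finally show ?thesis by (simp add: S_def N_def)
  qed
  ultimately show ?thesis unfolding r_def by blast
qed

end

section \<open>From moduli to Besov seminorms\<close>

text \<open>The Besov seminorm as a functional of the \<open>p\<close>-th power of the \<open>L\<^sup>p\<close> modulus.\<close>
definition besov_of :: "real \<Rightarrow> real \<Rightarrow> ennreal \<Rightarrow> (real \<Rightarrow> ennreal) \<Rightarrow> ennreal"
  where "besov_of \<alpha> p q M =
     (if q = \<infinity> then SUP t\<in>{0<..}. ennreal (t powr (-\<alpha>)) * ennreal_rpow (M t) (1 / p)
      else ennreal_rpow
        (\<integral>\<^sup>+t\<in>{0<..}. ennreal_rpow (ennreal (t powr (-\<alpha>)) * ennreal_rpow (M t) (1 / p)) (enn2real q)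
                         * ennreal (1 / t) \<partial>lborel)
        (1 / enn2real q))"

lemma nn_integral_dt_over_t_scale:
  fixes g :: "real \<Rightarrow> ennreal"
  assumes [measurable]: "g \<in> borel_measurable borel" and "a > 0"
  shows "(\<integral>\<^sup>+t\<in>{0<..}. g (a * t) * ennreal (1 / t) \<partial>lborel) = (\<integral>\<^sup>+t\<in>{0<..}. g t * ennreal (1 / t) \<partial>lborel)"
proof -
  have "(\<integral>\<^sup>+t\<in>{0<..}. g t * ennreal (1 / t) \<partial>lborel)
    = ennreal a * (\<integral>\<^sup>+t. g (0 + a * t) * ennreal (1 / (0 + a * t)) * indicator {0<..} (0 + a * t) \<partial>lborel)"
    using \<open>a > 0\<close> by (subst nn_integral_real_affine[where c = a and t = 0]) auto
  also have "\<dots> = (\<integral>\<^sup>+t. ennreal a * (g (0 + a * t) * ennreal (1 / (0 + a * t)) * indicator {0<..} (0 + a * t)) \<partial>lborel)"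
    by (rule nn_integral_cmult[symmetric]) measurable
  also have "\<dots> = (\<integral>\<^sup>+t\<in>{0<..}. g (a * t) * ennreal (1 / t) \<partial>lborel)"
  proof (rule nn_integral_cong)
    fix t
    have "ennreal a * ennreal (1 / (a * t)) = ennreal (1 / t)" if "t > 0"
      using \<open>a > 0\<close> that by (simp flip: ennreal_mult)
    then have "ennreal a * (g (a * t) * ennreal (1 / (a * t))) = g (a * t) * ennreal (1 / t)" if "t > 0"
      using that by (subst mult.left_commute) simp
    then show "ennreal a * (g (0 + a * t) * ennreal (1 / (0 + a * t)) * indicator {0<..} (0 + a * t)) = g (a * t) * ennreal (1 / t) * indicator {0<..} t"
      using \<open>a > 0\<close> by (cases "t > 0") (auto simp: zero_less_mult_iff)
  qed
  finally show ?thesis ..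
qed

text \<open>The weight carried by the \<open>L^p\<close> term of the estimate: a positive power for
  small \<open>t\<close>, where the cutoff is Lipschitz, and a negative one for large
  \<open>t\<close>, where only size counts.\<close>

lemma nn_integral_weight_finite:
  assumes "a > 0" "b > 0" "r > 0"
  shows "\<exists>W\<ge>0. (\<integral>\<^sup>+t\<in>{0<..}. ennreal (if t < r then t powr a else t powr (-b)) * ennreal (1 / t) \<partial>lborel) \<le> ennreal W"
proof -
  have "(\<integral>\<^sup>+t\<in>{0<..}. ennreal (if t < r then t powr a else t powr (-b)) * ennreal (1 / t) \<partial>lborel)
    \<le> (\<integral>\<^sup>+t. ennreal (t powr (a - 1)) * indicator {0..r} t + ennreal (t powr (- b - 1)) * indicator {r..} t \<partial>lborel)"
  proof (rule nn_integral_mono, goal_cases)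
    case (1 t)
    have "t powr a * (1 / t) = t powr (a - 1)" "t powr (-b) * (1 / t) = t powr (- b - 1)" if "t > 0"
      using that by (simp_all add: powr_diff)
    then show ?case
      by (cases "t > 0"; cases "t < r") (auto simp: ennreal_mult[symmetric])
  qed
  also have "\<dots> = (\<integral>\<^sup>+t. ennreal (t powr (a - 1)) * indicator {0..r} t \<partial>lborel) + (\<integral>\<^sup>+t. ennreal (t powr (- b - 1)) * indicator {r..} t \<partial>lborel)"
    by (rule nn_integral_add) measurable
  also have "(\<integral>\<^sup>+t. ennreal (t powr (a - 1)) * indicator {0..r} t \<partial>lborel) = ennreal (r powr (a - 1 + 1) / (a - 1 + 1))"
    using assms by (intro nn_integral_has_integral_lebesgue' has_integral_powr_from_0) auto
  also have "(\<integral>\<^sup>+t. ennreal (t powr (- b - 1)) * indicator {r..} t \<partial>lborel) = ennreal (- (r powr (- b - 1 + 1)) / (- b - 1 + 1))"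
    using assms by (intro nn_integral_has_integral_lebesgue' has_integral_powr_to_inf) auto
  also have "ennreal (r powr (a - 1 + 1) / (a - 1 + 1)) + ennreal (- (r powr (- b - 1 + 1)) / (- b - 1 + 1)) = ennreal (r powr a / a + r powr (- b) / b)"
    using assms by simp
  finally show ?thesis using assms by (intro exI[of _ "r powr a / a + r powr (- b) / b"]) auto
qed

text \<open>With \<open>b = 2 ^ j\<close> the exponents balance through
  \<open>\<gamma> - p = - \<eta> * p - \<beta> * p\<close>; the decay
  \<open>b powr (- \<eta> * p)\<close> is displayed as two equal factors.\<close>

lemma besov_exponent_identity:
  fixes b t p \<gamma> \<beta> :: real
  assumes "b > 0" "t > 0" "p > 0"
  defines "\<eta> \<equiv> 1 - (\<beta> + \<gamma> / p)"
  shows "t powr (- (\<beta> + \<gamma> / p) * p) * ((1 / b) powr p * (b * t) powr \<gamma>)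
    = 64 powr (\<beta> * p) * ((b powr (- \<eta> / 2)) powr p * ((b powr (- \<eta> / 2)) powr p * (64 * (b * t)) powr (- \<beta> * p)))"
proof -
  have "t powr (- (\<beta> + \<gamma> / p) * p) * ((1 / b) powr p * (b * t) powr \<gamma>) = t powr (- \<beta> * p) * b powr (\<gamma> - p)"
  proof -
    have e: "- (\<beta> + \<gamma> / p) * p = - \<beta> * p - \<gamma>" using assms(3) by (simp add: field_simps)
    show ?thesis unfolding e powr_diff using assms(1-3) by (simp add: powr_mult powr_divide)
  qed
  also have "\<gamma> - p = (- \<eta> / 2) * p + (- \<eta> / 2) * p + (- \<beta> * p)"
    using assms by (simp add: \<eta>_def field_simps)
  also have "t powr (- \<beta> * p) * b powr ((- \<eta> / 2) * p + (- \<eta> / 2) * p + (- \<beta> * p)) =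
    64 powr (\<beta> * p) * ((b powr (- \<eta> / 2)) powr p * ((b powr (- \<eta> / 2)) powr p * (64 * (b * t)) powr (- \<beta> * p)))"
  proof -
    have "64 powr (\<beta> * p) * 64 powr (- \<beta> * p) = (1 :: real)" by (simp flip: powr_add)
    then show ?thesis using assms(1-3) unfolding powr_add powr_powr by (simp add: powr_mult ac_simps)
  qed
  finally show ?thesis .
qed

text \<open>With \<open>\<theta> = 2\<close> to the power \<open>-\<eta>/2\<close> and \<open>\<eta> = 1 - \<alpha>\<close>, half of the geometric decay is spent on
  summing over \<open>j\<close> and the other half on dominating each term by one quantity \<open>X\<close>; this replaces
  Minkowski's inequality in \<open>L\<^sup>q\<close>.\<close>
lemma besov_of_le:
  fixes p \<beta> \<gamma> r C :: real and q :: ennreal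
  assumes p: "p \<ge> 1" and q: "q \<ge> 1" and \<beta>: "0 < \<beta>" "\<beta> < 1 - \<gamma> / p" and \<gamma>: "\<gamma> > 0" and r: "r > 0" and C: "C \<ge> 0"
  shows "\<exists>K\<ge>0. \<forall>U M N. M \<in> borel_measurable borel \<longrightarrow>
    (\<forall>t. 0 < t \<longrightarrow> t < r \<longrightarrow> U t \<le> ennreal C * ((dyadic_sum p \<gamma> M t) + ennreal (t powr p) * N)) \<longrightarrow>
    (\<forall>t\<ge>r. U t \<le> ennreal C * N) \<longrightarrow>
    besov_of (\<beta> + \<gamma> / p) p q U \<le> ennreal K * (besov_of \<beta> p q M + ennreal_rpow N (1 / p))"
proof -
  define \<alpha> where "\<alpha> = \<beta> + \<gamma> / p"
  define \<eta> where "\<eta> = 1 - \<alpha>"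
  have \<alpha>: "\<alpha> > 0" "\<eta> > 0" "\<alpha> < 1" using \<beta> \<gamma> p by (auto simp: \<alpha>_def \<eta>_def intro!: add_pos_pos)
  define \<theta> :: real where "\<theta> = 2 powr (- \<eta> / 2)"
  have \<theta>: "0 < \<theta>" "\<theta> < 1" using \<alpha> powr_less_mono[of "- \<eta> / 2" 0 2] by (auto simp: \<theta>_def)
  have \<theta>j: "\<theta> ^ j = (2 ^ j) powr (- \<eta> / 2)" for j
    by (simp add: \<theta>_def powr_realpow[symmetric] powr_powr mult.commute)
  have \<theta>p: "(\<theta> ^ j) powr a = (\<theta> powr a) ^ j" for j a
    using \<theta> by (simp add: powr_realpow[symmetric] powr_powr mult.commute)
  have \<theta>a: "0 \<le> \<theta> powr a" "\<theta> powr a < 1" if "a > 0" for a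
    using \<theta> that powr_less_mono2[of a \<theta> 1] by auto
  have geo: "(\<Sum>j. ennreal ((\<theta> ^ j) powr a)) = ennreal (1 / (1 - \<theta> powr a))" if "a > 0" for a
  proof -
    have "(\<Sum>j. ennreal (1 * (\<theta> powr a) ^ j)) = ennreal (1 / (1 - \<theta> powr a))"
      by (intro suminf_ennreal_geometric \<theta>a that) auto
    then show ?thesis by (simp only: \<theta>p mult_1)
  qed
  define g where "g M t = ennreal (t powr (- \<beta>)) * ennreal_rpow (M t) (1 / p)" for M t
  define a where "a U t = ennreal (t powr (- \<alpha>)) * ennreal_rpow (U t) (1 / p)" for U t
  have gp: "ennreal_rpow (g M t) p = ennreal (t powr (- \<beta> * p)) * M t" for M t
    using p by (simp add: g_def ennreal_rpow_mult ennreal_rpow_rpow ennreal_rpow_ennreal powr_powr)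
  have ap: "ennreal_rpow (a U t) p = ennreal (t powr (- \<alpha> * p)) * U t" for U t
    using p by (simp add: a_def ennreal_rpow_mult ennreal_rpow_rpow ennreal_rpow_ennreal powr_powr)
  define K1 where "K1 = 64 powr (\<beta> * p) * (1 / (1 - \<theta> powr p))"
  have K1: "K1 \<ge> 0" using \<theta>a[of p] p by (simp add: K1_def)
  define K where "K = 2 powr (1 / p) * C powr (1 / p) * (K1 powr (1 / p) + 1)"
  have K: "K \<ge> 0" by (simp add: K_def)

  \<comment> \<open>\<open>X\<close> stands for any common bound of the damped terms at
    \<open>t\<close>: the Besov seminorm itself for \<open>q = \<infinity>\<close>, the
    \<open>q\<close>-th root of a sum of \<open>q\<close>-th powers otherwise.\<close>
  have small: "a U t \<le> ennreal K * (X + ennreal (t powr \<eta>) * ennreal_rpow N (1 / p))"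
    if t: "0 < t" "t < r" and
      U: "U t \<le> ennreal C * ((dyadic_sum p \<gamma> M t) + ennreal (t powr p) * N)"
      and X: "\<And>j. ennreal (\<theta> ^ j) * g M (64 * (2 ^ j * t)) \<le> X" for U M N t X
  proof -
    define S where "S = (dyadic_sum p \<gamma> M t)"
    have "ennreal (t powr (- \<alpha> * p)) * S = (\<Sum>j. ennreal (t powr (- \<alpha> * p)) * (ennreal (((1/2) ^ j) powr p * (2 ^ j * t) powr \<gamma>) * M (64 * (2 ^ j * t))))"
      unfolding S_def by (rule ennreal_suminf_cmult[symmetric])
    also have "\<dots> = (\<Sum>j. ennreal (64 powr (\<beta> * p)) * (ennreal ((\<theta> ^ j) powr p) * ennreal_rpow (ennreal (\<theta> ^ j) * g M (64 * (2 ^ j * t))) p))"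
    proof (rule suminf_cong)
      fix j
      have "ennreal (t powr (- \<alpha> * p)) * (ennreal (((1/2) ^ j) powr p * (2 ^ j * t) powr \<gamma>) * M (64 * (2 ^ j * t)))
        = ennreal (t powr (- \<alpha> * p) * ((1 / 2 ^ j) powr p * (2 ^ j * t) powr \<gamma>)) * M (64 * (2 ^ j * t))"
        by (simp add: ennreal_mult mult.assoc power_one_over)
      also have "t powr (- \<alpha> * p) * ((1 / 2 ^ j) powr p * (2 ^ j * t) powr \<gamma>)
        = 64 powr (\<beta> * p) * ((\<theta> ^ j) powr p * ((\<theta> ^ j) powr p * (64 * (2 ^ j * t)) powr (- \<beta> * p)))"
        unfolding \<theta>j \<eta>_def \<alpha>_def using t p by (intro besov_exponent_identity) auto
      also have "ennreal \<dots> * M (64 * (2 ^ j * t)) = ennreal (64 powr (\<beta> * p)) * (ennreal ((\<theta> ^ j) powr p) * ennreal_rpow (ennreal (\<theta> ^ j) * g M (64 * (2 ^ j * t))) p)"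
      proof -
        have "ennreal_rpow (ennreal (\<theta> ^ j) * g M (64 * (2 ^ j * t))) p
          = ennreal_rpow (ennreal (\<theta> ^ j)) p * ennreal_rpow (g M (64 * (2 ^ j * t))) p"
          using p by (intro ennreal_rpow_mult) auto
        also have "ennreal_rpow (ennreal (\<theta> ^ j)) p = ennreal ((\<theta> ^ j) powr p)"
          using \<theta> by (intro ennreal_rpow_ennreal) auto
        finally have e: "ennreal_rpow (ennreal (\<theta> ^ j) * g M (64 * (2 ^ j * t))) p
          = ennreal ((\<theta> ^ j) powr p) * (ennreal ((64 * (2 ^ j * t)) powr (- \<beta> * p)) * M (64 * (2 ^ j * t)))"
          by (simp only: gp)
        have em: "ennreal (a * (b * (b * d))) * X = ennreal a * (ennreal b * (ennreal b * (ennreal d * X)))"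
          if "a \<ge> 0" "b \<ge> 0" "d \<ge> 0" for a b d X
          using that by (simp add: ennreal_mult mult.assoc)
        show ?thesis unfolding e by (rule em) auto
      qed
      finally show "ennreal (t powr (- \<alpha> * p)) * (ennreal (((1/2) ^ j) powr p * (2 ^ j * t) powr \<gamma>) * M (64 * (2 ^ j * t)))
        = ennreal (64 powr (\<beta> * p)) * (ennreal ((\<theta> ^ j) powr p) * ennreal_rpow (ennreal (\<theta> ^ j) * g M (64 * (2 ^ j * t))) p)" .
    qed
    also have "\<dots> \<le> (\<Sum>j. ennreal (64 powr (\<beta> * p)) * (ennreal ((\<theta> ^ j) powr p) * ennreal_rpow X p))"
      using p by (intro suminf_le summableI mult_left_mono ennreal_rpow_mono X) auto
    also have "\<dots> = ennreal (64 powr (\<beta> * p)) * ((\<Sum>j. ennreal ((\<theta> ^ j) powr p)) * ennreal_rpow X p)"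
      by simp
    also have "(\<Sum>j. ennreal ((\<theta> ^ j) powr p)) = ennreal (1 / (1 - \<theta> powr p))"
      by (rule geo) (use p in simp)
    also have "ennreal (64 powr (\<beta> * p)) * (\<dots> * ennreal_rpow X p) = ennreal K1 * ennreal_rpow X p"
      using \<theta>a[of p] p by (simp add: K1_def ennreal_mult[symmetric] mult.assoc[symmetric])
    finally have 1: "ennreal (t powr (- \<alpha> * p)) * S \<le> ennreal K1 * ennreal_rpow X p" .
    have "ennreal_rpow (a U t) p \<le> ennreal (t powr (- \<alpha> * p)) * (ennreal C * (S + ennreal (t powr p) * N))"
      unfolding ap S_def by (intro mult_left_mono U) auto
    also have "\<dots> = ennreal C * (ennreal (t powr (- \<alpha> * p)) * S + ennreal (t powr (- \<alpha> * p)) * ennreal (t powr p) * N)"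
      by (simp add: distrib_left ac_simps)
    also have "ennreal (t powr (- \<alpha> * p)) * ennreal (t powr p) = ennreal (t powr (\<eta> * p))"
      using t by (simp add: ennreal_mult[symmetric] powr_add[symmetric] \<eta>_def algebra_simps)
    also have "ennreal C * (ennreal (t powr (- \<alpha> * p)) * S + ennreal (t powr (\<eta> * p)) * N) \<le> ennreal C * (ennreal K1 * ennreal_rpow X p + ennreal (t powr (\<eta> * p)) * N)"
      by (intro mult_left_mono add_right_mono 1) auto
    finally have "ennreal_rpow (ennreal_rpow (a U t) p) (1 / p) \<le> ennreal_rpow (ennreal C * (ennreal K1 * ennreal_rpow X p + ennreal (t powr (\<eta> * p)) * N)) (1 / p)"
      using p by (intro ennreal_rpow_mono) auto
    then have "a U t \<le> ennreal (C powr (1 / p)) * ennreal_rpow (ennreal K1 * ennreal_rpow X p + ennreal (t powr (\<eta> * p)) * N) (1 / p)"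
      using p C by (simp add: ennreal_rpow_rpow ennreal_rpow_mult ennreal_rpow_ennreal)
    also have "\<dots> \<le> ennreal (C powr (1 / p)) * (ennreal (2 powr (1 / p)) * (ennreal_rpow (ennreal K1 * ennreal_rpow X p) (1 / p) + ennreal_rpow (ennreal (t powr (\<eta> * p)) * N) (1 / p)))"
      using p by (intro mult_left_mono ennreal_rpow_add_le) auto
    also have "ennreal_rpow (ennreal K1 * ennreal_rpow X p) (1 / p) = ennreal (K1 powr (1 / p)) * X"
      using p K1 by (simp add: ennreal_rpow_rpow ennreal_rpow_mult ennreal_rpow_ennreal)
    also have "ennreal_rpow (ennreal (t powr (\<eta> * p)) * N) (1 / p) = ennreal (t powr \<eta>) * ennreal_rpow N (1 / p)"
      using p by (simp add: ennreal_rpow_mult ennreal_rpow_ennreal powr_powr)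
    also have "ennreal (C powr (1 / p)) * (ennreal (2 powr (1 / p)) * (ennreal (K1 powr (1 / p)) * X + ennreal (t powr \<eta>) * ennreal_rpow N (1 / p)))
      \<le> ennreal (C powr (1 / p)) * (ennreal (2 powr (1 / p)) * (ennreal (K1 powr (1 / p) + 1) * X + ennreal (K1 powr (1 / p) + 1) * (ennreal (t powr \<eta>) * ennreal_rpow N (1 / p))))"
    proof -
      have "Y \<le> ennreal (K1 powr (1 / p) + 1) * Y" for Y
        using mult_right_mono[of 1 "ennreal (K1 powr (1 / p) + 1)" Y] by simp
      then show ?thesis by (intro mult_left_mono add_mono mult_right_mono ennreal_leI) auto
    qed
    also have "\<dots> = ennreal K * (X + ennreal (t powr \<eta>) * ennreal_rpow N (1 / p))"
    proof -
      define k where "k = K1 powr (1 / p) + 1"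
      have "k \<ge> 0" by (simp add: k_def)
      then show ?thesis unfolding K_def k_def[symmetric] by (simp add: ennreal_mult distrib_left ac_simps)
    qed
    finally show ?thesis .
  qed

  have large: "a U t \<le> ennreal K * (ennreal (t powr (- \<alpha>)) * ennreal_rpow N (1 / p))" if U: "U t \<le> ennreal C * N" for U N t
  proof -
    have "a U t \<le> ennreal (t powr (- \<alpha>)) * ennreal_rpow (ennreal C * N) (1 / p)"
      unfolding a_def using p U by (intro mult_left_mono ennreal_rpow_mono) auto
    also have "\<dots> = ennreal (C powr (1 / p)) * (ennreal (t powr (- \<alpha>)) * ennreal_rpow N (1 / p))"
      using p C by (simp add: ennreal_rpow_mult ennreal_rpow_ennreal ac_simps)
    also have "\<dots> \<le> ennreal K * (ennreal (t powr (- \<alpha>)) * ennreal_rpow N (1 / p))"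
    proof (intro mult_right_mono ennreal_leI)
      have "1 * (C powr (1 / p) * 1) \<le> 2 powr (1 / p) * (C powr (1 / p) * (K1 powr (1 / p) + 1))"
        using p by (intro mult_mono) (auto simp: ge_one_powr_ge_zero)
      then show "C powr (1 / p) \<le> K" by (simp add: K_def mult.assoc)
    qed auto
    finally show ?thesis .
  qed

  show ?thesis
  proof (cases "q = \<infinity>")
    case True
    define L where "L = K * (1 + r powr \<eta> + r powr (- \<alpha>))"
    have L: "K \<le> L" "K * r powr \<eta> \<le> L" "K * r powr (- \<alpha>) \<le> L" 
      using K by (auto simp: L_def intro!: mult_left_mono) (simp_all add: distrib_left)
    have "L \<ge> 0" using K L(1) by simp
    moreover have "besov_of \<alpha> p q U \<le> ennreal L * (besov_of \<beta> p q M + ennreal_rpow N (1 / p))"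
      if U1: "\<And>t. 0 < t \<Longrightarrow> t < r \<Longrightarrow> U t \<le> ennreal C * ((dyadic_sum p \<gamma> M t) + ennreal (t powr p) * N)"
        and U2: "\<And>t. t \<ge> r \<Longrightarrow> U t \<le> ennreal C * N" for U M N
    proof -
      define B where "B = besov_of \<beta> p q M"
      have Bg: "g M t \<le> B" if "t > 0" for t
        using that SUP_upper[of t "{0<..}" "g M"] by (simp add: B_def besov_of_def True g_def)
      have "a U t \<le> ennreal L * (B + ennreal_rpow N (1 / p))" if t: "t > 0" for t
      proof (cases "t < r")
        case True
        have "ennreal (\<theta> ^ j) * g M (64 * (2 ^ j * t)) \<le> 1 * B" for j
          using \<theta> t by (intro mult_mono Bg) (auto simp: power_le_one)
        then have "a U t \<le> ennreal K * (B + ennreal (t powr \<eta>) * ennreal_rpow N (1 / p))"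
          using t True U1 by (intro small) auto
        also have "\<dots> = ennreal K * B + ennreal (K * t powr \<eta>) * ennreal_rpow N (1 / p)"
          using K by (simp add: distrib_left ennreal_mult mult.assoc)
        also have "\<dots> \<le> ennreal L * B + ennreal L * ennreal_rpow N (1 / p)"
        proof (intro add_mono[of "_ * B"] mult_right_mono ennreal_leI L)
          have "K * t powr \<eta> \<le> K * r powr \<eta>" using K t True \<alpha> by (intro mult_left_mono powr_mono2) auto
          then show "K * t powr \<eta> \<le> L" using L(2) by simp
        qed auto
        finally show ?thesis by (simp add: distrib_left)
      next
        case False
        then have "a U t \<le> ennreal K * (ennreal (t powr (- \<alpha>)) * ennreal_rpow N (1 / p))" by (intro large U2) auto
        also have "\<dots> = ennreal (K * t powr (- \<alpha>)) * ennreal_rpow N (1 / p)"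
          using K by (simp add: ennreal_mult mult.assoc)
        also have "\<dots> \<le> ennreal L * ennreal_rpow N (1 / p)"
        proof (intro mult_right_mono ennreal_leI)
          have "K * t powr (- \<alpha>) \<le> K * r powr (- \<alpha>)" using K r False \<alpha> by (intro mult_left_mono powr_mono2') auto
          then show "K * t powr (- \<alpha>) \<le> L" using L(3) by simp
        qed auto
        also have "\<dots> \<le> ennreal L * (B + ennreal_rpow N (1 / p))" by (intro mult_left_mono) auto
        finally show ?thesis .
      qed
      then have "(SUP t\<in>{0<..}. a U t) \<le> ennreal L * (B + ennreal_rpow N (1 / p))"
        by (intro SUP_least) auto
      then show ?thesis by (simp add: B_def besov_of_def[of \<alpha>] True a_def)
    qed
    ultimately show ?thesis unfolding \<alpha>_def by blast
  next
    case False
    define q' where "q' = enn2real q"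
    have "q = ennreal q'" using False by (simp add: q'_def less_top)
    then have q': "q' \<ge> 1" using q by (metis ennreal_1 ennreal_le_iff2 not_one_le_zero linorder_not_le order_less_imp_le zero_less_one)
    obtain W where W: "W \<ge> 0" "(\<integral>\<^sup>+t\<in>{0<..}. ennreal (if t < r then t powr (\<eta> * q') else t powr (-(\<alpha> * q'))) * ennreal (1 / t) \<partial>lborel) \<le> ennreal W"
      using nn_integral_weight_finite[of "\<eta> * q'" "\<alpha> * q'" r] \<alpha> q' r by auto
    define K2 where "K2 = 1 / (1 - \<theta> powr q')"
    have K2: "K2 \<ge> 0" using \<theta>a[of q'] q' by (simp add: K2_def)
    define k where "k = K powr q' * 2 powr q'"
    define L where "L = k powr (1 / q') * (2 powr (1 / q') * (K2 powr (1 / q') + W powr (1 / q')))"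
    have k: "k \<ge> 0" by (simp add: k_def)
    have "L \<ge> 0" by (simp add: L_def)
    moreover have "besov_of \<alpha> p q U \<le> ennreal L * (besov_of \<beta> p q M + ennreal_rpow N (1 / p))"
      if [measurable]: "M \<in> borel_measurable borel"
        and U1: "\<And>t. 0 < t \<Longrightarrow> t < r \<Longrightarrow> U t \<le> ennreal C * ((dyadic_sum p \<gamma> M t) + ennreal (t powr p) * N)"
        and U2: "\<And>t. t \<ge> r \<Longrightarrow> U t \<le> ennreal C * N" for U M N
    proof -
      have [measurable]: "g M \<in> borel_measurable borel" unfolding g_def by measurable
      define G where "G t = ennreal_rpow (g M t) q'" for t
      have [measurable]: "G \<in> borel_measurable borel" unfolding G_def by measurable
      define I where "I = (\<integral>\<^sup>+t\<in>{0<..}. G t * ennreal (1 / t) \<partial>lborel)"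
      have BI: "besov_of \<beta> p q M = ennreal_rpow I (1 / q')"
        using False by (simp add: besov_of_def I_def G_def g_def q'_def)
      \<comment> \<open>\<open>T t\<close> dominates the \<open>q'\<close>-th power of every damped
        term, and its integral is computable: \<open>dt / t\<close> is invariant under dilation, so
        each term integrates to a multiple of the same \<open>I\<close>.\<close>
      define T where "T t = (\<Sum>j. ennreal ((\<theta> ^ j) powr q') * G (64 * 2 ^ j * t))" for t
      have [measurable]: "T \<in> borel_measurable borel" unfolding T_def by measurable
      define N' where "N' = ennreal_rpow N (1 / p)"
      \<comment> \<open>The factor of the \<open>L^p\<close> term, raised to the power
        \<open>q'\<close>: \<open>t powr \<eta>\<close> below \<open>r\<close> and
        \<open>t powr (- \<alpha>)\<close> above.\<close>
      define w where "w t = ennreal (if t < r then t powr (\<eta> * q') else t powr (-(\<alpha> * q')))" for t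
      have [measurable]: "w \<in> borel_measurable borel" unfolding w_def by measurable
      have pw: "ennreal_rpow (a U t) q' \<le> ennreal k * (T t + w t * ennreal_rpow N' q')" if t: "t > 0" for t
      proof (cases "t < r")
        case True
        have X: "ennreal (\<theta> ^ j) * g M (64 * (2 ^ j * t)) \<le> ennreal_rpow (T t) (1 / q')" for j
        proof -
          have "ennreal_rpow (ennreal (\<theta> ^ j) * g M (64 * (2 ^ j * t))) q' = (\<Sum>j\<in>{j}. ennreal ((\<theta> ^ j) powr q') * G (64 * 2 ^ j * t))"
            using q' \<theta> by (simp add: ennreal_rpow_mult ennreal_rpow_ennreal G_def mult.assoc)
          also have "\<dots> \<le> T t" unfolding T_def by (intro sum_le_suminf summableI) auto
          finally have "ennreal_rpow (ennreal_rpow (ennreal (\<theta> ^ j) * g M (64 * (2 ^ j * t))) q') (1 / q') \<le> ennreal_rpow (T t) (1 / q')"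
            using q' by (intro ennreal_rpow_mono) auto
          then show ?thesis using q' by (simp add: ennreal_rpow_rpow)
        qed
        have "a U t \<le> ennreal K * (ennreal_rpow (T t) (1 / q') + ennreal (t powr \<eta>) * N')"
          unfolding N'_def by (rule small[where U = U and M = M and N = N, OF t True U1[OF t True] X])
        then have "ennreal_rpow (a U t) q' \<le> ennreal_rpow (ennreal K * (ennreal_rpow (T t) (1 / q') + ennreal (t powr \<eta>) * N')) q'"
          using q' by (intro ennreal_rpow_mono) auto
        also have "\<dots> = ennreal (K powr q') * ennreal_rpow (ennreal_rpow (T t) (1 / q') + ennreal (t powr \<eta>) * N') q'"
          using q' K by (simp add: ennreal_rpow_mult ennreal_rpow_ennreal)
        also have "\<dots> \<le> ennreal (K powr q') * (ennreal (2 powr q') * (ennreal_rpow (ennreal_rpow (T t) (1 / q')) q' + ennreal_rpow (ennreal (t powr \<eta>) * N') q'))"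
          using q' by (intro mult_left_mono ennreal_rpow_add_le) auto
        also have "\<dots> = ennreal k * (T t + w t * ennreal_rpow N' q')"
          using q' True by (simp add: k_def w_def ennreal_rpow_rpow ennreal_rpow_mult ennreal_rpow_ennreal powr_powr ennreal_mult mult.assoc)
        finally show ?thesis .
      next
        case ge: False
        have "a U t \<le> ennreal K * (ennreal (t powr (- \<alpha>)) * N')"
          unfolding N'_def using ge by (intro large U2) auto
        then have "ennreal_rpow (a U t) q' \<le> ennreal_rpow (ennreal K * (ennreal (t powr (- \<alpha>)) * N')) q'"
          using q' by (intro ennreal_rpow_mono) auto
        also have "\<dots> = ennreal (K powr q') * (w t * ennreal_rpow N' q')"
          using q' K ge by (simp add: ennreal_rpow_mult ennreal_rpow_ennreal w_def powr_powr)
        also have "\<dots> \<le> ennreal k * (T t + w t * ennreal_rpow N' q')"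
        proof (intro mult_mono ennreal_leI)
          have "K powr q' * 1 \<le> K powr q' * 2 powr q'"
            using q' by (intro mult_left_mono) (auto simp: ge_one_powr_ge_zero)
          then show "K powr q' \<le> k" by (simp add: k_def)
        qed auto
        finally show ?thesis .
      qed
      have IT: "(\<integral>\<^sup>+t\<in>{0<..}. T t * ennreal (1 / t) \<partial>lborel) = ennreal K2 * I"
      proof -
        have "(\<integral>\<^sup>+t\<in>{0<..}. T t * ennreal (1 / t) \<partial>lborel)
          = (\<integral>\<^sup>+t. (\<Sum>j. ennreal ((\<theta> ^ j) powr q') * (G (64 * 2 ^ j * t) * ennreal (1 / t) * indicator {0<..} t)) \<partial>lborel)"
          unfolding T_def by (simp add: ennreal_suminf_multc[symmetric] mult.assoc)
        also have "\<dots> = (\<Sum>j. \<integral>\<^sup>+t. ennreal ((\<theta> ^ j) powr q') * (G (64 * 2 ^ j * t) * ennreal (1 / t) * indicator {0<..} t) \<partial>lborel)"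
          by (rule nn_integral_suminf) measurable
        also have "\<dots> = (\<Sum>j. ennreal ((\<theta> ^ j) powr q') * (\<integral>\<^sup>+t\<in>{0<..}. G (64 * 2 ^ j * t) * ennreal (1 / t) \<partial>lborel))"
          by (intro suminf_cong nn_integral_cmult) measurable
        also have "\<dots> = (\<Sum>j. ennreal ((\<theta> ^ j) powr q') * I)"
          unfolding I_def by (intro suminf_cong arg_cong2[where f = "(*)"] refl nn_integral_dt_over_t_scale) auto
        also have "\<dots> = (\<Sum>j. ennreal ((\<theta> ^ j) powr q')) * I"
          by (rule ennreal_suminf_multc)
        also have "(\<Sum>j. ennreal ((\<theta> ^ j) powr q')) = ennreal K2"
          unfolding K2_def by (rule geo) (use q' in simp)
        finally show ?thesis .
      qed
      have "(\<integral>\<^sup>+t\<in>{0<..}. ennreal_rpow (a U t) q' * ennreal (1 / t) \<partial>lborel)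
        \<le> (\<integral>\<^sup>+t. ennreal k * (T t * ennreal (1 / t) * indicator {0<..} t + ennreal_rpow N' q' * (w t * ennreal (1 / t) * indicator {0<..} t)) \<partial>lborel)"
      proof (rule nn_integral_mono, goal_cases)
        case (1 t)
        show ?case
        proof (cases "t > 0")
          case True
          have "ennreal_rpow (a U t) q' * ennreal (1 / t) \<le> ennreal k * (T t + w t * ennreal_rpow N' q') * ennreal (1 / t)"
            by (intro mult_right_mono pw True) auto
          then show ?thesis using True by (simp add: distrib_left distrib_right ac_simps)
        qed simp
      qed
      also have "\<dots> = ennreal k * ((\<integral>\<^sup>+t\<in>{0<..}. T t * ennreal (1 / t) \<partial>lborel) + ennreal_rpow N' q' * (\<integral>\<^sup>+t\<in>{0<..}. w t * ennreal (1 / t) \<partial>lborel))"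
        by (simp add: nn_integral_cmult nn_integral_add)
      also have "\<dots> \<le> ennreal k * (ennreal K2 * I + ennreal_rpow N' q' * ennreal W)"
        unfolding IT using W(2) by (intro mult_left_mono add_left_mono) (auto simp: w_def)
      finally have "besov_of \<alpha> p q U \<le> ennreal_rpow (ennreal k * (ennreal K2 * I + ennreal_rpow N' q' * ennreal W)) (1 / q')"
        using False q' by (auto simp: besov_of_def[of \<alpha>] a_def q'_def intro!: ennreal_rpow_mono)
      also have "\<dots> = ennreal (k powr (1 / q')) * ennreal_rpow (ennreal K2 * I + ennreal_rpow N' q' * ennreal W) (1 / q')"
        using q' k by (simp add: ennreal_rpow_mult ennreal_rpow_ennreal)
      also have "\<dots> \<le> ennreal (k powr (1 / q')) * (ennreal (2 powr (1 / q')) * (ennreal_rpow (ennreal K2 * I) (1 / q') + ennreal_rpow (ennreal_rpow N' q' * ennreal W) (1 / q')))"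
        using q' by (intro mult_left_mono ennreal_rpow_add_le) auto
      also have "ennreal_rpow (ennreal K2 * I) (1 / q') = ennreal (K2 powr (1 / q')) * besov_of \<beta> p q M"
        unfolding BI using q' K2 by (simp add: ennreal_rpow_mult ennreal_rpow_ennreal)
      also have "ennreal_rpow (ennreal_rpow N' q' * ennreal W) (1 / q') = ennreal (W powr (1 / q')) * N'"
        using q' W(1) by (simp add: ennreal_rpow_mult ennreal_rpow_ennreal ennreal_rpow_rpow mult.commute)
      also have "ennreal (k powr (1 / q')) * (ennreal (2 powr (1 / q')) * (ennreal (K2 powr (1 / q')) * besov_of \<beta> p q M + ennreal (W powr (1 / q')) * N'))
        \<le> ennreal (k powr (1 / q')) * (ennreal (2 powr (1 / q')) * (ennreal (K2 powr (1 / q') + W powr (1 / q')) * besov_of \<beta> p q M + ennreal (K2 powr (1 / q') + W powr (1 / q')) * N'))"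
        by (intro mult_left_mono add_mono[of "_ * besov_of \<beta> p q M"] mult_right_mono ennreal_leI) auto
      also have "\<dots> = ennreal L * (besov_of \<beta> p q M + N')"
      proof -
        define k' where "k' = K2 powr (1 / q') + W powr (1 / q')"
        have "k' \<ge> 0" by (simp add: k'_def)
        then show ?thesis unfolding L_def k'_def[symmetric] by (simp add: ennreal_mult distrib_left mult.assoc)
      qed
      finally show ?thesis by (simp add: N'_def)
    qed
    ultimately show ?thesis unfolding \<alpha>_def by blast
  qed
qed

section \<open>Traces and norm bounds\<close>

context trace_codim
begin

lemma measurable_Modulus_mu:
  assumes f: "locint f"
  shows "Modulus \<mu> f p \<in> borel_measurable borel"
proof -
  note [measurable] = locint_measurable[OF f]
  show ?thesis unfolding Modulus_def by measurable
qed

text \<open>Linearity holds at every point: off \<open>F\<close> the integrals converge, on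
  \<open>F\<close> the value is 0.\<close>

lemma Ext_linear:
  assumes "locint f" "locint g"
  shows "Ext (\<lambda>z. a * f z + b * g z) x = a * Ext f x + b * Ext g x"
proof (cases "x \<in> F")
  case False
  have i: "integrable \<mu> (\<lambda>z. phi x z * f z)" "integrable \<mu> (\<lambda>z. phi x z * g z)"
    using assms False by (auto intro: integrable_phi)
  have "(\<integral>z. phi x z * (a * f z + b * g z) \<partial>\<mu>) = (\<integral>z. a * (phi x z * f z) + b * (phi x z * g z) \<partial>\<mu>)"
    by (intro Bochner_Integration.integral_cong) (auto simp: algebra_simps)
  also have "\<dots> = a * (\<integral>z. phi x z * f z \<partial>\<mu>) + b * (\<integral>z. phi x z * g z \<partial>\<mu>)"
    using i by simp
  finally show ?thesis
    using False by (simp add: Ext_def E1_def E0_def add_divide_distrib algebra_simps)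
qed (simp add: Ext_def E1_def)

lemma Ext_cong_AE:
  assumes "locint f" "locint g" and ae: "AE z in \<mu>. f z = g z"
  shows "Ext f = Ext g"
proof -
  note [measurable] = locint_measurable[OF assms(1)] locint_measurable[OF assms(2)]
  have "(\<integral>z. phi x z * f z \<partial>\<mu>) = (\<integral>z. phi x z * g z \<partial>\<mu>)" for x
    using ae by (intro integral_cong_AE) auto
  then show ?thesis by (simp add: fun_eq_iff Ext_def E1_def E0_def)
qed

text \<open>At a Lebesgue point of \<open>f\<close> the measure \<open>mu_ball t (8 * r)\<close>
  cancels against its inverse in the trace estimate. The resulting smallness of the mean of
  \<open>|Ext f - f t|\<close> is stronger than convergence of the averages.\<close>

lemma Ext_ball_average:
  assumes f: "locint f"
  shows "AE t in \<mu>. t \<in> F \<longrightarrow> (\<forall>e>0. \<exists>s>0. \<forall>r. 0 < r \<and> r < s \<longrightarrow>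
    (\<integral>\<^sup>+x\<in>ball t r. ennreal \<bar>Ext f x - f t\<bar> \<partial>m) \<le> ennreal e * m_ball t r)"
proof -
  obtain C where C: "C \<ge> 0" "\<And>f t r. locint f \<Longrightarrow> t \<in> F \<Longrightarrow> 0 < r \<Longrightarrow> r \<le> R \<Longrightarrow>
    (\<integral>\<^sup>+x. (if dist t x < r \<and> x \<notin> F then ennreal \<bar>E1 f x - f t\<bar> else 0) \<partial>m)
    \<le> ennreal C * (m_ball t r * inverse (mu_ball t (8 * r))) * (\<integral>\<^sup>+z\<in>ball t (8 * r). ennreal \<bar>f z - f t\<bar> \<partial>\<mu>)"
    using trace_bound by blast
  have "AE t in \<mu>. t \<in> F \<longrightarrow> (\<forall>e>0. \<exists>s>0. \<forall>r. 0 < r \<and> r < s \<longrightarrow>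
    (\<integral>\<^sup>+z\<in>ball t r. ennreal \<bar>f z - f t\<bar> \<partial>\<mu>) \<le> ennreal e * mu_ball t r)"
    using f by (intro lebesgue_points) (auto simp: locint_def)
  then show ?thesis
  proof eventually_elim
    case (elim t)
    show ?case
    proof (intro impI allI)
      fix e :: real assume t: "t \<in> F" and e: "e > 0"
      \<comment> \<open>The summand 1 guards against \<open>C = 0\<close>.\<close>
      define e' where "e' = e / (C + 1)"
      have e': "e' > 0" "C * e' \<le> e" using e C(1) by (auto simp: e'_def field_simps)
      obtain s where s: "s > 0" "\<And>r. 0 < r \<Longrightarrow> r < s \<Longrightarrow> (\<integral>\<^sup>+z\<in>ball t r. ennreal \<bar>f z - f t\<bar> \<partial>\<mu>) \<le> ennreal e' * mu_ball t r"
        using elim t e'(1) by blast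
      show "\<exists>s>0. \<forall>r. 0 < r \<and> r < s \<longrightarrow> (\<integral>\<^sup>+x\<in>ball t r. ennreal \<bar>Ext f x - f t\<bar> \<partial>m) \<le> ennreal e * m_ball t r"
      \<comment> \<open>The radius \<open>8 * r\<close> must stay below \<open>s\<close>, and
        \<open>r < R / 8\<close> keeps the cutoff equal to 1.\<close>
      proof (intro exI[of _ "min (s / 8) (R / 8)"] conjI allI impI; (elim conjE)?)
        show "min (s / 8) (R / 8) > 0" using s R_pos by simp
        fix r assume r: "0 < r" "r < min (s / 8) (R / 8)"
        have "(\<integral>\<^sup>+x\<in>ball t r. ennreal \<bar>Ext f x - f t\<bar> \<partial>m) \<le> (\<integral>\<^sup>+x. (if dist t x < r \<and> x \<notin> F then ennreal \<bar>E1 f x - f t\<bar> else 0) \<partial>m)"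
        proof (rule nn_integral_mono_AE, use AE_m_notin_F in eventually_elim)
          case (elim x)
          have "cut x = 1" if "dist t x < r"
            using infdist_le[OF t, of x] that r by (intro cut_eq_1) (simp add: dist_commute)
          then show ?case using elim by (simp add: Ext_def indicator_def)
        qed
        also have "\<dots> \<le> ennreal C * (m_ball t r * inverse (mu_ball t (8 * r))) * (\<integral>\<^sup>+z\<in>ball t (8 * r). ennreal \<bar>f z - f t\<bar> \<partial>\<mu>)"
          using r R_pos by (intro C f t) auto
        also have "\<dots> \<le> ennreal C * (m_ball t r * inverse (mu_ball t (8 * r))) * (ennreal e' * mu_ball t (8 * r))"
          using r by (intro mult_left_mono s) auto
        also have "\<dots> = ennreal C * ennreal e' * m_ball t r * (mu_ball t (8 * r) * inverse (mu_ball t (8 * r)))"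
          by (simp add: ac_simps)
        also have "\<dots> = ennreal (C * e') * m_ball t r"
          using mu_ball_inverse[OF t, of "8 * r"] r C(1) by (simp add: ennreal_mult')
        also have "\<dots> \<le> ennreal e * m_ball t r"
          using e' by (intro mult_right_mono ennreal_leI) auto
        finally show "(\<integral>\<^sup>+x\<in>ball t r. ennreal \<bar>Ext f x - f t\<bar> \<partial>m) \<le> ennreal e * m_ball t r" .
      qed
    qed
  qed
qed

section \<open>Functions on F and their extension by zero\<close>

text \<open>Membership in \<open>L1_loc\<close> speaks of balls centered in \<open>F\<close> only.
  Measurability on the whole space is recovered as a limit along growing balls about one point of
  \<open>F\<close>, integrability by inclusion in such a ball.\<close>

lemma locint_indicator:
  assumes f: "f \<in> L1_loc F \<mu>"
  shows "locint (\<lambda>z. indicator F z * f z)"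
proof -
  obtain y where y: "y \<in> F" using F_ne by auto
  define g where "g r z = indicator (ball y r \<inter> F) z * f z" for r z
  have g: "integrable \<mu> (g r)" if "r > 0" for r
    using f y that by (auto simp: L1_loc_def set_integrable_def g_def[abs_def])
  have [measurable]: "(\<lambda>z. indicator F z * f z) \<in> borel_measurable borel"
  proof (rule borel_measurable_LIMSEQ_real)
    show "g (real (Suc n)) \<in> borel_measurable borel" for n
      using borel_measurable_integrable[OF g[of "real (Suc n)"]] by (simp add: measurable_cong_sets[OF sets_mu refl])
    fix z
    obtain N where N: "dist y z < real N" using reals_Archimedean2 by blast
    have "g (real (Suc n)) z = indicator F z * f z" if "n \<ge> N" for n
      using N that by (simp add: g_def indicator_def)
    then show "(\<lambda>n. g (real (Suc n)) z) \<longlonglongrightarrow> indicator F z * f z"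
      by (intro tendsto_eventually eventually_sequentiallyI[of N])
  qed
  have "(\<integral>\<^sup>+z\<in>ball x r. ennreal \<bar>indicator F z * f z\<bar> \<partial>\<mu>) < \<infinity>" for x r
  proof -
    define r' where "r' = max 1 (dist y x + r)"
    have "(\<integral>\<^sup>+z\<in>ball x r. ennreal \<bar>indicator F z * f z\<bar> \<partial>\<mu>) \<le> (\<integral>\<^sup>+z. ennreal (norm (g r' z)) \<partial>\<mu>)"
    proof (rule nn_integral_mono, goal_cases)
      case (1 z)
      have "z \<in> ball y r'" if "z \<in> ball x r"
        using that dist_triangle[of y z x] by (simp add: r'_def)
      then show ?case
        by (auto simp: g_def indicator_def)
    qed
    also have "\<dots> < \<infinity>" using g[of r'] by (simp add: r'_def integrable_iff_bounded)
    finally show ?thesis .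
  qed
  then show ?thesis by (simp add: locint_def)
qed

lemma Lp_enorm_F:
  "Lp_enorm F \<mu> p f = ennreal_rpow (Lp_pow \<mu> p (\<lambda>z. indicator F z * f z)) (1 / p)"
  unfolding Lp_enorm_def
  by (intro arg_cong2[where f = ennreal_rpow] nn_integral_cong) (auto simp: indicator_def)

text \<open>Since \<open>\<mu>\<close> vanishes off \<open>F\<close>, restricted balls have the
  measure of full balls and the added values 0 are not seen by the integrals.\<close>

lemma Lp_modulus_F:
  "Lp_modulus F \<mu> p f t = ennreal_rpow (Modulus \<mu> (\<lambda>z. indicator F z * f z) p t) (1 / p)"
proof -
  have ball: "emeasure \<mu> (ball x t \<inter> F) = mu_ball x t" for x
    using AE_mu_in_F F_borel by (intro emeasure_eq_AE) (auto simp: sets_mu elim!: eventually_mono)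
  have inner: "(\<integral>\<^sup>+y\<in>ball x t \<inter> F. ennreal (\<bar>f y - f x\<bar> powr p) \<partial>\<mu>)
    = (\<integral>\<^sup>+y. (if dist x y < t then ennreal (\<bar>indicator F y * f y - indicator F x * f x\<bar> powr p) else 0) \<partial>\<mu>)"
    if "x \<in> F" for x
    using that AE_mu_in_F
    by (intro nn_integral_cong_AE) (auto simp: indicator_def elim!: eventually_mono)
  show ?thesis
    unfolding Lp_modulus_def Modulus_def ball divide_ennreal_def
    using AE_mu_in_F
    by (intro arg_cong2[where f = ennreal_rpow] nn_integral_cong_AE refl) (auto simp: inner elim!: eventually_mono)
qed

lemma besov_norm_F:
  "besov_norm F \<mu> \<beta> p q f = ennreal_rpow (Lp_pow \<mu> p (\<lambda>z. indicator F z * f z)) (1 / p)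
     + besov_of \<beta> p q (Modulus \<mu> (\<lambda>z. indicator F z * f z) p)"
  by (simp add: besov_norm_def besov_seminorm_def besov_of_def Lp_enorm_F Lp_modulus_F)

section \<open>Norm bounds for the extension\<close>

lemma besov_bound:
  assumes p: "p \<ge> 1" and q: "q \<ge> 1" and \<beta>: "0 < \<beta>" "\<beta> < 1 - \<gamma> / p"
  shows "\<exists>K\<ge>0. \<forall>f. locint f \<longrightarrow>
    ennreal_rpow (Lp_pow m p (Ext f)) (1 / p) + besov_of (\<beta> + \<gamma> / p) p q (Modulus m (Ext f) p)
    \<le> ennreal K * (ennreal_rpow (Lp_pow \<mu> p f) (1 / p) + besov_of \<beta> p q (Modulus \<mu> f p))"
proof -
  obtain C1 where C1: "C1 \<ge> 0" "\<And>f. locint f \<Longrightarrow> (Lp_pow m p (Ext f)) \<le> ennreal C1 * (Lp_pow \<mu> p f)"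
    using Lp_Ext[OF p] by blast
  obtain C2 where C2: "C2 \<ge> 0" "\<And>f t. locint f \<Longrightarrow> 0 < t \<Longrightarrow> t < R / 8 \<Longrightarrow> Modulus m (Ext f) p t \<le>
    ennreal C2 * ((dyadic_sum p \<gamma> (Modulus \<mu> f p) t)
      + ennreal (t powr p) * (Lp_pow \<mu> p f))"
    using Modulus_Ext_small[OF p] by blast
  define C3 where "C3 = 2 powr p * (c + 1) * C1"
  \<comment> \<open>One constant for both regimes \<open>t < R / 8\<close> and
    \<open>t \<ge> R / 8\<close>, as \<open>besov_of_le\<close> expects.\<close>
  define C where "C = max C2 C3"
  have "C3 \<ge> 0" using C1(1) c_ge_1 by (simp add: C3_def)
  have C: "C \<ge> 0" "ennreal C2 \<le> ennreal C" "ennreal C3 \<le> ennreal C"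
    using C2(1) by (auto simp: C_def intro: ennreal_leI)
  obtain K where K: "K \<ge> 0" "\<And>U M N. M \<in> borel_measurable borel \<Longrightarrow>
    (\<And>t. 0 < t \<Longrightarrow> t < R / 8 \<Longrightarrow> U t \<le> ennreal C * ((dyadic_sum p \<gamma> M t) + ennreal (t powr p) * N)) \<Longrightarrow>
    (\<And>t. t \<ge> R / 8 \<Longrightarrow> U t \<le> ennreal C * N) \<Longrightarrow>
    besov_of (\<beta> + \<gamma> / p) p q U \<le> ennreal K * (besov_of \<beta> p q M + ennreal_rpow N (1 / p))"
    using besov_of_le[OF p q \<beta> gamma_pos _ C(1), of "R / 8"] R_pos by auto
  define L where "L = C1 powr (1 / p) + K"
  have "L \<ge> 0" using K(1) by (simp add: L_def)
  moreover have "ennreal_rpow (Lp_pow m p (Ext f)) (1 / p) + besov_of (\<beta> + \<gamma> / p) p q (Modulus m (Ext f) p)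
    \<le> ennreal L * (ennreal_rpow (Lp_pow \<mu> p f) (1 / p) + besov_of \<beta> p q (Modulus \<mu> f p))"
    if f: "locint f" for f
  proof -
    define N where "N = (Lp_pow \<mu> p f)"
    define B where "B = besov_of \<beta> p q (Modulus \<mu> f p)"
    have 1: "ennreal_rpow (Lp_pow m p (Ext f)) (1 / p) \<le> ennreal (C1 powr (1 / p)) * ennreal_rpow N (1 / p)"
      using ennreal_rpow_mono[OF C1(2)[OF f], of "1 / p"] p C1(1)
      by (simp add: ennreal_rpow_mult ennreal_rpow_ennreal N_def)
    have 2: "besov_of (\<beta> + \<gamma> / p) p q (Modulus m (Ext f) p) \<le> ennreal K * (B + ennreal_rpow N (1 / p))"
      unfolding B_def
    proof (rule K(2)[OF measurable_Modulus_mu[OF f]])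
      fix t assume t: "0 < t" "t < R / 8"
      show "Modulus m (Ext f) p t \<le> ennreal C * ((dyadic_sum p \<gamma> (Modulus \<mu> f p) t) + ennreal (t powr p) * N)"
        unfolding N_def by (rule order_trans[OF C2(2)[OF f t]]) (intro mult_right_mono C, simp)
    next
      fix t assume t: "R / 8 \<le> t"
      have "Modulus m (Ext f) p t \<le> ennreal (2 powr p * (c + 1)) * (Lp_pow m p (Ext f))"
        using t R_pos by (intro Modulus_Ext_large p f) auto
      also have "\<dots> \<le> ennreal (2 powr p * (c + 1)) * (ennreal C1 * N)"
        unfolding N_def by (intro mult_left_mono C1 f) auto
      also have "\<dots> = ennreal C3 * N"
        using C1(1) c_ge_1 by (simp add: C3_def ennreal_mult mult.assoc)
      also have "\<dots> \<le> ennreal C * N" by (intro mult_right_mono C) simp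
      finally show "Modulus m (Ext f) p t \<le> ennreal C * N" .
    qed
    have "ennreal_rpow (Lp_pow m p (Ext f)) (1 / p) + besov_of (\<beta> + \<gamma> / p) p q (Modulus m (Ext f) p)
      \<le> ennreal (C1 powr (1 / p)) * ennreal_rpow N (1 / p) + ennreal K * (B + ennreal_rpow N (1 / p))"
      by (intro add_mono 1 2)
    also have "\<dots> \<le> ennreal (C1 powr (1 / p)) * (ennreal_rpow N (1 / p) + B) + ennreal K * (ennreal_rpow N (1 / p) + B)"
      unfolding add.commute[of B] by (intro add_right_mono mult_left_mono) simp_all
    also have "\<dots> = ennreal L * (ennreal_rpow N (1 / p) + B)"
      using K(1) by (simp add: L_def ennreal_plus distrib_right del: ennreal_plus_if)
    finally show ?thesis by (simp add: N_def B_def)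
  qed
  ultimately show ?thesis by blast
qed

end

text \<open>Small mean deviation from \<open>v\<close> gives both parts at once: integrability of
  \<open>u\<close> on small balls, since constants are integrable there, and convergence of the
  averages.\<close>

lemma has_ball_average_limitI:
  fixes m :: "'a::metric_space measure"
  assumes op: "\<And>S. open S \<Longrightarrow> S \<in> sets m"
    and fin: "\<And>r. r > 0 \<Longrightarrow> 0 < emeasure m (ball t r)" "\<And>r. emeasure m (ball t r) < \<infinity>"
    and [measurable]: "u \<in> borel_measurable m"
    and lim: "\<And>e. e > 0 \<Longrightarrow> \<exists>s>0. \<forall>r. 0 < r \<and> r < s \<longrightarrow> (\<integral>\<^sup>+x\<in>ball t r. ennreal \<bar>u x - v\<bar> \<partial>m) \<le> ennreal e * emeasure m (ball t r)"
  shows "has_ball_average_limit m u t v"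
proof -
  have ball[measurable]: "ball t r \<in> sets m" for r by (simp add: op)
  have const: "set_integrable m (ball t r) (\<lambda>_. v)" for r
    using fin(2)[of r] by (simp add: set_integrable_def)
  have diff: "set_integrable m (ball t r) (\<lambda>x. u x - v)"
    if "(\<integral>\<^sup>+x\<in>ball t r. ennreal \<bar>u x - v\<bar> \<partial>m) \<le> ennreal e * emeasure m (ball t r)" for r e
    unfolding set_integrable_def
  proof (rule integrableI_bounded)
    have "(\<integral>\<^sup>+x. ennreal (norm (indicator (ball t r) x *\<^sub>R (u x - v))) \<partial>m) = (\<integral>\<^sup>+x\<in>ball t r. ennreal \<bar>u x - v\<bar> \<partial>m)"
      by (intro nn_integral_cong) (auto simp: indicator_def)
    also have "\<dots> < \<infinity>"
      using fin(2)[of r] by (intro le_less_trans[OF that]) (simp add: ennreal_mult_less_top)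
    finally show "(\<integral>\<^sup>+x. ennreal (norm (indicator (ball t r) x *\<^sub>R (u x - v))) \<partial>m) < \<infinity>" .
  qed measurable
  have int: "set_integrable m (ball t r) u"
    if "(\<integral>\<^sup>+x\<in>ball t r. ennreal \<bar>u x - v\<bar> \<partial>m) \<le> ennreal e * emeasure m (ball t r)" for r e
    using set_integral_add(1)[OF diff[OF that] const] by simp
  have "\<forall>\<^sub>F r in at_right 0. set_integrable m (ball t r) u"
  proof -
    obtain s where "s > 0" "\<And>r. 0 < r \<Longrightarrow> r < s \<Longrightarrow> (\<integral>\<^sup>+x\<in>ball t r. ennreal \<bar>u x - v\<bar> \<partial>m) \<le> ennreal 1 * emeasure m (ball t r)"
      using lim[of 1] by auto
    then show ?thesis using int[where e = 1] by (auto simp: eventually_at_right_field)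
  qed
  moreover have "((\<lambda>r. 1 / measure m (ball t r) * (LINT x:ball t r|m. u x)) \<longlongrightarrow> v) (at_right 0)"
  proof (rule tendstoI)
    fix e :: real assume "e > 0"
    then obtain s where s: "s > 0" "\<And>r. 0 < r \<Longrightarrow> r < s \<Longrightarrow> (\<integral>\<^sup>+x\<in>ball t r. ennreal \<bar>u x - v\<bar> \<partial>m) \<le> ennreal (e / 2) * emeasure m (ball t r)"
      using lim[of "e / 2"] by auto
    have "dist (1 / measure m (ball t r) * (LINT x:ball t r|m. u x)) v < e" if r: "0 < r" "r < s" for r
    proof -
      define M where "M = measure m (ball t r)"
      have eM: "emeasure m (ball t r) = ennreal M"
        using fin(2)[of r] by (simp add: M_def emeasure_eq_ennreal_measure less_top)
      have M: "M > 0" using fin(1)[OF r(1)] eM by simp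
      have i: "set_integrable m (ball t r) u" by (rule int[OF s(2)[OF r]])
      have "(LINT x:ball t r|m. u x - v) = (LINT x:ball t r|m. u x) - (LINT x:ball t r|m. v)"
        by (rule set_integral_diff(2)[OF i const])
      also have "(LINT x:ball t r|m. v) = v * M"
        by (simp add: set_lebesgue_integral_def M_def)
      finally have eq: "1 / M * (LINT x:ball t r|m. u x) - v = (LINT x:ball t r|m. u x - v) / M"
        using M by (simp add: field_simps)
      have "ennreal \<bar>LINT x:ball t r|m. u x - v\<bar> \<le> (\<integral>\<^sup>+x. ennreal (norm (indicator (ball t r) x *\<^sub>R (u x - v))) \<partial>m)"
        using integral_norm_bound_ennreal[OF diff[OF s(2)[OF r], unfolded set_integrable_def]]
        by (simp add: set_lebesgue_integral_def)
      also have "\<dots> = (\<integral>\<^sup>+x\<in>ball t r. ennreal \<bar>u x - v\<bar> \<partial>m)"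
        by (intro nn_integral_cong) (auto simp: indicator_def)
      also have "\<dots> \<le> ennreal (e / 2) * ennreal M" using s(2)[OF r] by (simp add: eM)
      also have "\<dots> = ennreal (e / 2 * M)" using M \<open>e > 0\<close> by (intro ennreal_mult[symmetric]) auto
      finally have "\<bar>LINT x:ball t r|m. u x - v\<bar> \<le> e / 2 * M" using M \<open>e > 0\<close> by simp
      then have "\<bar>(LINT x:ball t r|m. u x - v) / M\<bar> \<le> e / 2" using M by (simp add: abs_divide field_simps)
      then have "\<bar>1 / M * (LINT x:ball t r|m. u x) - v\<bar> \<le> e / 2" by (simp only: eq)
      then show ?thesis using \<open>e > 0\<close> unfolding dist_real_def M_def by linarith
    qed
    then show "\<forall>\<^sub>F r in at_right 0. dist (1 / measure m (ball t r) * (LINT x:ball t r|m. u x)) v < e"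
      using s(1) by (auto simp: eventually_at_right_field)
  qed
  ultimately show ?thesis by (simp add: has_ball_average_limit_def)
qed

section \<open>The extension theorem\<close>

lemma borel_measurable_ident:
  fixes m :: "'a::metric_space measure"
  assumes "\<And>S. open S \<Longrightarrow> S \<in> sets m"
  shows "(\<lambda>x. x) \<in> measurable m borel" and "space m = UNIV"
proof -
  show sp: "space m = UNIV" using assms[of UNIV] sets.sets_into_space by fastforce
  show "(\<lambda>x. x) \<in> measurable m borel"
    by (rule borel_measurableI) (simp add: sp assms)
qed

text \<open>On balls of finite measure \<open>|u| \<le> 1 + |u| powr p\<close> makes an
  \<open>L^p\<close> function integrable, so a finite norm already places \<open>u\<close> in
  \<open>L1_loc\<close>.\<close>

lemma besov_space_UNIV_I:
  fixes m :: "'a::metric_space measure"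
  assumes op: "\<And>S. open S \<Longrightarrow> S \<in> sets m" and fin: "\<And>x r. emeasure m (ball x r) < \<infinity>"
    and [measurable]: "u \<in> borel_measurable m" and p: "p \<ge> 1" and norm: "besov_norm UNIV m \<alpha> p q u < \<infinity>"
  shows "u \<in> besov_space UNIV m \<alpha> p q"
proof -
  have "Lp_enorm UNIV m p u < \<infinity>" using norm by (auto simp: besov_norm_def)
  then have Lp: "(\<integral>\<^sup>+x. ennreal (\<bar>u x\<bar> powr p) \<partial>m) < \<infinity>"
    using ennreal_rpow_eq_top_iff[of "\<integral>\<^sup>+x. ennreal (\<bar>u x\<bar> powr p) \<partial>m" "1 / p"]
    by (simp add: Lp_enorm_def flip: top.not_eq_extremum)
  have "set_integrable m (ball x r \<inter> UNIV) u" for x r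
    unfolding set_integrable_def
  proof (rule integrableI_bounded)
    have [measurable]: "ball x r \<in> sets m" by (simp add: op)
    show "(\<lambda>z. indicator (ball x r \<inter> UNIV) z *\<^sub>R u z) \<in> borel_measurable m" by measurable
    have "(\<integral>\<^sup>+z. ennreal (norm (indicator (ball x r \<inter> UNIV) z *\<^sub>R u z)) \<partial>m) \<le> (\<integral>\<^sup>+z. indicator (ball x r) z + ennreal (\<bar>u z\<bar> powr p) \<partial>m)"
    proof (rule nn_integral_mono, goal_cases)
      case (1 z)
      have "\<bar>u z\<bar> \<le> 1 + \<bar>u z\<bar> powr p"
      proof (cases "\<bar>u z\<bar> \<le> 1")
        case False
        then have "\<bar>u z\<bar> powr 1 \<le> \<bar>u z\<bar> powr p" using p by (intro powr_mono) auto
        then show ?thesis using False by simp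
      qed (simp add: add_increasing2)
      then have "ennreal \<bar>u z\<bar> \<le> 1 + ennreal (\<bar>u z\<bar> powr p)"
        by (metis ennreal_1 ennreal_leI ennreal_plus powr_ge_zero zero_le_one)
      then show ?case
        by (auto simp: indicator_def)
    qed
    also have "\<dots> = emeasure m (ball x r) + (\<integral>\<^sup>+z. ennreal (\<bar>u z\<bar> powr p) \<partial>m)"
      by (subst nn_integral_add) auto
    also have "\<dots> < \<infinity>" using fin Lp by simp
    finally show "(\<integral>\<^sup>+z. ennreal (norm (indicator (ball x r \<inter> UNIV) z *\<^sub>R u z)) \<partial>m) < \<infinity>" .
  qed
  then show ?thesis using norm by (simp add: besov_space_def L1_loc_def)
qed

theorem theorem3p1:
  fixes m \<mu> :: "'a::metric_space measure" and F :: "'a set" and \<gamma> :: real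
  assumes "homogeneous_type m"
    and "closed F" and "emeasure m F = 0"
    and "sets \<mu> = sets borel" and "emeasure \<mu> (space \<mu>) \<noteq> 0"
    and "measure_support \<mu> = F" and "doubling_centered F \<mu>"
    and "\<gamma> > 0" and "codim_comparable m \<mu> F \<gamma>"
  shows "\<exists>E :: ('a \<Rightarrow> real) \<Rightarrow> ('a \<Rightarrow> real).
           linear_operator_L1_loc F \<mu> m E \<and>
           extension_operator_L1_loc F \<mu> m E \<and>
           (\<forall>(p::real) (q::ennreal) (\<beta>::real).
              1 \<le> p \<longrightarrow> 1 \<le> q \<longrightarrow> 0 < \<beta> \<longrightarrow> \<beta> < 1 - \<gamma> / p \<longrightarrow>
              (\<exists>C::real. \<forall>f \<in> besov_space F \<mu> \<beta> p q.
                 E f \<in> besov_space UNIV m (\<beta> + \<gamma> / p) p q \<and>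
                 besov_norm UNIV m (\<beta> + \<gamma> / p) p q (E f) \<le> ennreal C * besov_norm F \<mu> \<beta> p q f))"
proof -
  have op: "\<And>S. open S \<Longrightarrow> S \<in> sets m"
    and m_pos: "\<And>x r. r > 0 \<Longrightarrow> 0 < emeasure m (ball x r)"
    using assms(1) by (auto simp: homogeneous_type_def)
  have m_fin: "emeasure m (ball x r) < \<infinity>" for x r
  proof (cases "r > 0")
    case True
    then show ?thesis using assms(1) by (auto simp: homogeneous_type_def)
  qed (simp add: ball_empty)
  obtain C1 :: real where C1: "\<And>x r. r > 0 \<Longrightarrow> emeasure m (ball x (2 * r)) \<le> ennreal C1 * emeasure m (ball x r)"
    using assms(1) unfolding homogeneous_type_def by blast
  obtain C2 :: real where C2: "\<And>x r. x \<in> F \<Longrightarrow> r > 0 \<Longrightarrow> 0 < emeasure \<mu> (ball x (2 * r)) \<and>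
      emeasure \<mu> (ball x (2 * r)) \<le> ennreal C2 * emeasure \<mu> (ball x r) \<and> ennreal C2 * emeasure \<mu> (ball x r) < \<infinity>"
    using assms(7) unfolding doubling_centered_def by blast
  define c where "c = max 1 (max C1 C2)"
  have c: "c \<ge> 1" "ennreal C1 \<le> ennreal c" "ennreal C2 \<le> ennreal c"
    by (auto simp: c_def intro!: ennreal_leI)
  have m_dbl: "emeasure m (ball x (2 * r)) \<le> ennreal c * emeasure m (ball x r)" if "r > 0" for x r
    by (rule order_trans[OF C1[OF that] mult_right_mono[OF c(2)]]) simp
  \<comment> \<open>The hypothesis states positivity for radius \<open>2 * r\<close>; it is used at
    half the radius.\<close>
  have mu_pos: "0 < emeasure \<mu> (ball x r)" if "x \<in> F" "r > 0" for x r
    using C2[of x "r / 2"] that by simp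
  have mu_fin: "emeasure \<mu> (ball x r) < \<infinity>" if "x \<in> F" for x r
  proof (cases "r > 0")
    case True
    then show ?thesis using C2[of x "r / 2"] that by (auto intro: le_less_trans)
  qed (simp add: ball_empty)
  have mu_dbl: "emeasure \<mu> (ball x (2 * r)) \<le> ennreal c * emeasure \<mu> (ball x r)" if "x \<in> F" "r > 0" for x r
    using C2[OF that] by (intro order_trans[OF _ mult_right_mono[OF c(3)]]) auto
  obtain D :: "'a set" where D: "countable D" "\<And>x e. e > 0 \<Longrightarrow> \<exists>d\<in>D. dist d x < e"
    using doubling_imp_separable[OF op m_pos m_fin m_dbl] c(1) by force
  interpret separable_metric D by unfold_locales (use D in auto)
  have null: "emeasure \<mu> (- F) = 0" by (rule null_set_compl_support[OF assms(4,6)])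
  have sp: "space \<mu> = UNIV" using sets_eq_imp_space_eq[OF assms(4)] by simp
  \<comment> \<open>If \<open>F\<close> were empty, its null complement would be the whole
    space.\<close>
  have F_ne: "F \<noteq> {}" using null assms(5) by (auto simp: sp)

  \<comment> \<open>The \<open>\<sigma>\<close>-algebra of \<open>m\<close> may be larger than the Borel one; \<open>n\<close> is the Borel restriction of \<open>m\<close>.\<close>
  define n where "n = distr m borel (\<lambda>x. x)"
  have id[measurable]: "(\<lambda>x. x) \<in> measurable m borel" by (rule borel_measurable_ident(1)[OF op])
  have spm: "space m = UNIV" by (rule borel_measurable_ident(2)[OF op])
  have n_eq: "emeasure n A = emeasure m A" if "A \<in> sets borel" for A
    using that by (simp add: n_def emeasure_distr spm)
  have n_int: "(\<integral>\<^sup>+x. g x \<partial>n) = (\<integral>\<^sup>+x. g x \<partial>m)" if "g \<in> borel_measurable borel" for g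
    using that unfolding n_def by (intro nn_integral_distr) auto
  have n_ball: "emeasure n (ball x r) = emeasure m (ball x r)" for x r by (simp add: n_eq)

  obtain G where G: "G \<ge> 1" "\<And>x r. x \<in> F \<Longrightarrow> r > 0 \<Longrightarrow> (bounded F \<Longrightarrow> r < 2 * diameter F) \<Longrightarrow>
     inverse G * r powr \<gamma> \<le> measure m (ball x r) / measure \<mu> (ball x r) \<and>
     measure m (ball x r) / measure \<mu> (ball x r) \<le> G * r powr \<gamma>"
    using assms(9) unfolding codim_comparable_def by blast
  \<comment> \<open>The default 1 also covers the one-point case, where the diameter is 0.\<close>
  define R where "R = (if bounded F \<and> diameter F > 0 then diameter F else 1)"
  have codim: "emeasure n (ball z r) \<le> ennreal (G * r powr \<gamma>) * emeasure \<mu> (ball z r) \<and>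
      emeasure \<mu> (ball z r) \<le> ennreal (G * r powr (- \<gamma>)) * emeasure n (ball z r)"
    if z: "z \<in> F" "F \<noteq> {z}" and r: "0 < r" "r \<le> R" for z r
  proof -
    \<comment> \<open>A second point makes the diameter positive, so \<open>R\<close> is the
      diameter and \<open>r \<le> R\<close> lies strictly below twice the diameter.\<close>
    have "r < 2 * diameter F" if b: "bounded F"
    proof -
      obtain w where "w \<in> F" "w \<noteq> z" using z by blast
      then have "0 < dist w z" "dist w z \<le> diameter F" using diameter_bounded_bound[OF b _ z(1)] by auto
      then have "diameter F > 0" by linarith
      then show ?thesis using r b by (simp add: R_def)
    qed
    note * = G(2)[OF z(1) r(1) this]
    define a b where "a = measure m (ball z r)" and "b = measure \<mu> (ball z r)"
    have ab: "emeasure n (ball z r) = ennreal a" "emeasure \<mu> (ball z r) = ennreal b"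
      using m_fin[of z r] mu_fin[OF z(1), of r] by (auto simp: a_def b_def n_ball emeasure_eq_ennreal_measure less_top)
    have b: "b > 0" using mu_pos[OF z(1) r(1)] ab by simp
    have "a \<le> G * r powr \<gamma> * b" using * b by (simp add: a_def[symmetric] b_def[symmetric] pos_divide_le_eq)
    moreover have "b \<le> G * r powr (- \<gamma>) * a"
      using * b G(1) r by (simp add: a_def[symmetric] b_def[symmetric] powr_minus field_simps)
    ultimately show ?thesis
      unfolding ab using G(1) b by (auto simp: a_def ennreal_mult[symmetric] intro!: ennreal_leI)
  qed
  interpret T: trace_codim D \<mu> F c n \<gamma> G R
  proof unfold_locales
    show "sets n = sets borel" by (simp add: n_def)
    show "R > 0" by (simp add: R_def)
    show "emeasure n F = 0" using assms(2,3) by (simp add: n_eq)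
  qed (use assms(2,4,8) F_ne null c(1) mu_pos mu_fin mu_dbl m_pos m_fin m_dbl codim G(1) in \<open>auto simp: n_ball\<close>)

  \<comment> \<open>Extension by 0 discards the values of \<open>f\<close> off \<open>F\<close>,
    which carry no information.\<close>
  define res where "res f = (\<lambda>z. indicator F z * f z)" for f :: "'a \<Rightarrow> real"
  define E where "E f = T.Ext (res f)" for f
  have loc: "T.locint (res f)" if "f \<in> L1_loc F \<mu>" for f
    unfolding res_def by (rule T.locint_indicator[OF that])
  have E_borel: "E f \<in> borel_measurable borel" if "f \<in> L1_loc F \<mu>" for f
    unfolding E_def using T.measurable_Ext[OF loc[OF that], of "\<lambda>x. x" borel] by simp
  have E_m: "E f \<in> borel_measurable m" if "f \<in> L1_loc F \<mu>" for f
    using measurable_compose[OF id E_borel[OF that]] by simp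

  have "linear_operator_L1_loc F \<mu> m E"
    unfolding linear_operator_L1_loc_def
  proof (intro conjI ballI impI allI)
    fix f g assume fg: "f \<in> L1_loc F \<mu>" "g \<in> L1_loc F \<mu>"
    show "E (\<lambda>x. a * f x + b * g x) = (\<lambda>x. a * E f x + b * E g x)" for a b
    proof -
      have eq: "res (\<lambda>x. a * f x + b * g x) = (\<lambda>x. a * res f x + b * res g x)"
        by (simp add: res_def fun_eq_iff algebra_simps)
      show ?thesis unfolding E_def eq by (intro ext T.Ext_linear loc fg)
    qed
    assume ae: "AE x in \<mu>. x \<in> F \<longrightarrow> f x = g x"
    have "AE x in \<mu>. res f x = res g x"
      using ae by eventually_elim (auto simp: res_def indicator_def)
    then show "AE x in m. E f x = E g x"
      using T.Ext_cong_AE[OF loc[OF fg(1)] loc[OF fg(2)]] by (simp add: E_def)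
  qed (rule E_m)
  moreover have "extension_operator_L1_loc F \<mu> m E"
    unfolding extension_operator_L1_loc_def
  proof
    fix f assume f: "f \<in> L1_loc F \<mu>"
    note [measurable] = E_borel[OF f]
    show "AE t in \<mu>. t \<in> F \<longrightarrow> has_ball_average_limit m (E f) t (f t)"
      using T.Ext_ball_average[OF loc[OF f]]
    proof eventually_elim
      case (elim t)
      show ?case
      proof
        assume t: "t \<in> F"
        show "has_ball_average_limit m (E f) t (f t)"
        proof (rule has_ball_average_limitI[OF op m_pos m_fin E_m[OF f]])
          fix e :: real assume "e > 0"
          then obtain s where s: "s > 0" "\<And>r. 0 < r \<Longrightarrow> r < s \<Longrightarrow>
            (\<integral>\<^sup>+x\<in>ball t r. ennreal \<bar>T.Ext (res f) x - res f t\<bar> \<partial>n) \<le> ennreal e * emeasure n (ball t r)"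
            using elim t by blast
          have "(\<integral>\<^sup>+x\<in>ball t r. ennreal \<bar>E f x - f t\<bar> \<partial>m) \<le> ennreal e * emeasure m (ball t r)" if "0 < r" "r < s" for r
          proof -
            have "(\<integral>\<^sup>+x\<in>ball t r. ennreal \<bar>E f x - f t\<bar> \<partial>m) = (\<integral>\<^sup>+x\<in>ball t r. ennreal \<bar>E f x - f t\<bar> \<partial>n)"
              by (rule n_int[symmetric]) measurable
            moreover have "res f t = f t" using t by (simp add: res_def)
            ultimately show ?thesis using s(2)[OF that] by (simp add: E_def n_ball)
          qed
          then show "\<exists>s>0. \<forall>r. 0 < r \<and> r < s \<longrightarrow> (\<integral>\<^sup>+x\<in>ball t r. ennreal \<bar>E f x - f t\<bar> \<partial>m) \<le> ennreal e * emeasure m (ball t r)"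
            using s(1) by blast
        qed
      qed
    qed
  qed
  moreover have "\<exists>C::real. \<forall>f \<in> besov_space F \<mu> \<beta> p q.
                 E f \<in> besov_space UNIV m (\<beta> + \<gamma> / p) p q \<and>
                 besov_norm UNIV m (\<beta> + \<gamma> / p) p q (E f) \<le> ennreal C * besov_norm F \<mu> \<beta> p q f"
    if p: "1 \<le> p" and q: "1 \<le> q" and \<beta>: "0 < \<beta>" "\<beta> < 1 - \<gamma> / p" for p \<beta> :: real and q :: ennreal
  proof -
    \<comment> \<open>\<open>E\<close> is already fixed; only \<open>K\<close> depends on the
      exponents.\<close>
    obtain K where K: "K \<ge> 0" "\<And>f. T.locint f \<Longrightarrow>
      ennreal_rpow (Lp_pow n p (T.Ext f)) (1 / p) + besov_of (\<beta> + \<gamma> / p) p q (Modulus n (T.Ext f) p)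
      \<le> ennreal K * (ennreal_rpow (Lp_pow \<mu> p f) (1 / p) + besov_of \<beta> p q (Modulus \<mu> f p))"
      using T.besov_bound[OF p q \<beta>] by blast
    have "E f \<in> besov_space UNIV m (\<beta> + \<gamma> / p) p q \<and>
       besov_norm UNIV m (\<beta> + \<gamma> / p) p q (E f) \<le> ennreal K * besov_norm F \<mu> \<beta> p q f"
      if f: "f \<in> besov_space F \<mu> \<beta> p q" for f
    proof -
      have f': "f \<in> L1_loc F \<mu>" "besov_norm F \<mu> \<beta> p q f < \<infinity>" using f by (auto simp: besov_space_def)
      note [measurable] = E_borel[OF f'(1)]
      \<comment> \<open>The moduli for \<open>m\<close> and for its Borel restriction agree because
        all integrands are Borel; the outer and the inner integral are transferred in turn.\<close>
      have "Lp_modulus UNIV m p (E f) t = ennreal_rpow (Modulus n (E f) p t) (1 / p)" for t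
      proof -
        have "Modulus n (E f) p t = (\<integral>\<^sup>+x. (\<integral>\<^sup>+y. (if dist x y < t then ennreal (\<bar>E f y - E f x\<bar> powr p) else 0) \<partial>n) * inverse (emeasure n (ball x t)) \<partial>m)"
          unfolding Modulus_def by (rule n_int) measurable
        also have "\<dots> = (\<integral>\<^sup>+x. (\<integral>\<^sup>+y. (if dist x y < t then ennreal (\<bar>E f y - E f x\<bar> powr p) else 0) \<partial>m) * inverse (emeasure m (ball x t)) \<partial>m)"
          unfolding n_ball by (intro nn_integral_cong arg_cong2[where f = "(*)"] refl n_int) measurable
        also have "\<dots> = (\<integral>\<^sup>+x\<in>UNIV. (\<integral>\<^sup>+y\<in>ball x t \<inter> UNIV. ennreal (\<bar>E f y - E f x\<bar> powr p) \<partial>m) / emeasure m (ball x t \<inter> UNIV) \<partial>m)"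
          unfolding divide_ennreal_def
          by (intro nn_integral_cong) (auto simp: indicator_def intro!: arg_cong2[where f = "(*)"] nn_integral_cong)
        finally show ?thesis by (simp add: Lp_modulus_def)
      qed
      moreover have "Lp_enorm UNIV m p (E f) = ennreal_rpow (Lp_pow n p (E f)) (1 / p)"
        unfolding Lp_enorm_def by (subst n_int) auto
      ultimately have "besov_norm UNIV m (\<beta> + \<gamma> / p) p q (E f) =
        ennreal_rpow (Lp_pow n p (E f)) (1 / p) + besov_of (\<beta> + \<gamma> / p) p q (Modulus n (E f) p)"
        by (simp add: besov_norm_def besov_seminorm_def besov_of_def)
      also have "\<dots> \<le> ennreal K * besov_norm F \<mu> \<beta> p q f"
        using K(2)[OF loc[OF f'(1)]] by (simp add: E_def T.besov_norm_F res_def)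
      finally have le: "besov_norm UNIV m (\<beta> + \<gamma> / p) p q (E f) \<le> ennreal K * besov_norm F \<mu> \<beta> p q f" .
      also have "\<dots> < \<infinity>" using f'(2) by (simp add: ennreal_mult_less_top)
      finally have "E f \<in> besov_space UNIV m (\<beta> + \<gamma> / p) p q"
        by (intro besov_space_UNIV_I[OF op m_fin E_m[OF f'(1)] p]) auto
      then show ?thesis using le by simp
    qed
    then show ?thesis by blast
  qed
  ultimately show ?thesis by blast
qed

end
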